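(* Assume the Riemann hypothesis. Let $a,b,\tau$ be positive numbers with $0<b<\pi/2$ and $b\tau>0.5$, put $\gamma=b\tau+0.5$, let $N\geqslant 2$ be an integer, and let \[ S_{N}(u)=\sum_{p\leqslant N}\arctan\Bigl(\frac{2\sqrt{p}}{p-1}\cos(u\tau\ln p)\Bigr),\qquad \kappa=\kappa(a,b)=2\int_{0}^{+\infty}e^{-a\cos(b)\cosh u}\,du, \] \[ \zeta_{N}(\gamma)=\prod_{p>N}(1-p^{-\gamma})^{-1}=\zeta(\gamma)\prod_{p\leqslant N}(1-p^{-\gamma}), \] where $p$ runs over primes. Suppose that \[ I=\frac{1}{\pi}\Bigl(\int_{0}^{+\infty}K_{a}(u)S_{N}(u)\,du-\kappa\ln\zeta_{N}(\gamma)\Bigr)>0. \] Then there is $\varepsilon_{0}=\varepsilon_{0}(a,b,\tau)>0$ such that for every fixed $\varepsilon$ with $0<\varepsilon<\varepsilon_{0}$ there exist constants $c_{0}=c_{0}(\varepsilon;a,b,\tau)$ and $T_{0}=T_{0}(\varepsilon;a,b,\tau)$ such that for every $T\geqslant T_{0}$, with $H=\tau\ln\ln\ln T+c_{0}$, \[ \max_{|T-t|\leqslant H}S(t)>\frac{I-\varepsilon}{\widehat{K}_{a}(0)}\quad\text{and}\quad \max_{|T-t|\leqslant H}\bigl(-S(t)\bigr)>\frac{I-\varepsilon}{\widehat{K}_{a}(0)}. \]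
   Context: For $a>0$, $K_{a}(z)=\exp(-a\cosh z)$ and $\widehat{K}_{a}(0)=\int_{-\infty}^{+\infty}K_{a}(x)\,dx$. $S(t)=\frac{1}{\pi}\arg\zeta(0.5+it)$: for $t$ not the ordinate of a zero of $\zeta$, the argument is obtained by continuous variation along the horizontal half-line $\{\sigma+it:\sigma\geqslant 0.5\}$ starting from the value $0$ at $\sigma=+\infty$; at ordinates of zeros, $S(t)=\frac12(S(t+0)+S(t-0))$. *)

theory Defs
  imports "HOL-Complex_Analysis.Complex_Analysis" "HOL-Computational_Algebra.Primes"
begin

text \<open>The analytic continuation of the Dirichlet series. It is unique on the complement of
  the pole \<open>1\<close>; the value at \<open>1\<close> is arbitrary, so \<open>1\<close> has to be excluded
  explicitly when speaking of zeros.\<close>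

definition riemann_zeta :: "complex \<Rightarrow> complex" where
  "riemann_zeta = (SOME f. f holomorphic_on - {1} \<and>
     (\<forall>s. Re s > 1 \<longrightarrow> (\<lambda>n. of_nat (Suc n) powr (- s)) sums f s))"

definition zeta_zero :: "complex \<Rightarrow> bool" where
  "zeta_zero s \<longleftrightarrow> s \<noteq> 1 \<and> riemann_zeta s = 0"

definition trivial_zeta_zero :: "complex \<Rightarrow> bool" where
  "trivial_zeta_zero s \<longleftrightarrow> (\<exists>n::nat. n \<ge> 1 \<and> s = - (2 * of_nat n))"

definition riemann_hypothesis :: bool where
  "riemann_hypothesis \<longleftrightarrow>
     (\<forall>s. zeta_zero s \<and> \<not> trivial_zeta_zero s \<longrightarrow> Re s = 1 / 2)"

definition zeta_ordinate :: "real \<Rightarrow> bool" where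
  "zeta_ordinate t \<longleftrightarrow> (\<exists>s. zeta_zero s \<and> Im s = t)"

text \<open>Continuous variation of the argument along \<open>{\<sigma> + \<i>t | \<sigma> \<ge> 1/2}\<close>, starting
  from \<open>0\<close> at \<open>\<sigma> = +\<infinity>\<close>. Only meaningful if \<open>t\<close> is not an ordinate of a zero.\<close>

definition zeta_arg_half :: "real \<Rightarrow> real" where
  "zeta_arg_half t = (THE x. \<exists>\<phi>. continuous_on {1/2..} \<phi> \<and>
      (\<forall>\<sigma>\<ge>1/2. is_Arg (riemann_zeta (Complex \<sigma> t)) (\<phi> \<sigma>)) \<and>
      (\<phi> \<longlongrightarrow> 0) at_top \<and> x = \<phi> (1/2))"

text \<open>Ordinates of zeros are isolated, so the one-sided limits of \<open>S\<close> may be taken through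
  values at non-ordinates.\<close>

definition zeta_S :: "real \<Rightarrow> real" where
  "zeta_S t =
     (if zeta_ordinate t
      then (Lim (at_right t) (\<lambda>u. zeta_arg_half u / pi) +
            Lim (at_left t) (\<lambda>u. zeta_arg_half u / pi)) / 2
      else zeta_arg_half t / pi)"

definition K :: "real \<Rightarrow> real \<Rightarrow> real" where
  "K a x = exp (- a * cosh x)"

definition K_hat_0 :: "real \<Rightarrow> real" where
  "K_hat_0 a = (LBINT x. K a x)"

definition S_N :: "real \<Rightarrow> nat \<Rightarrow> real \<Rightarrow> real" where
  "S_N \<tau> N u = (\<Sum>p | prime p \<and> p \<le> N.
     arctan (2 * sqrt (real p) / (real p - 1) * cos (u * \<tau> * ln (real p))))"

definition kappa :: "real \<Rightarrow> real \<Rightarrow> real" where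
  "kappa a b = 2 * (LBINT u:{0..}. exp (- a * cos b * cosh u))"

definition zeta_N :: "nat \<Rightarrow> real \<Rightarrow> real" where
  "zeta_N N \<gamma> =
     (\<Prod>p. if prime p \<and> p > N then inverse (1 - real p powr (- \<gamma>)) else 1)"

definition I_N :: "real \<Rightarrow> real \<Rightarrow> real \<Rightarrow> nat \<Rightarrow> real" where
  "I_N a b \<tau> N = 1 / pi *
     ((LBINT u:{0..}. K a u * S_N \<tau> N u) - kappa a b * ln (zeta_N N (b * \<tau> + 1 / 2)))"

end

theory Submission
  imports Defs "HOL-Real_Asymp.Real_Asymp"
begin

text \<open>
  On the quarter plane \<open>Re s > 1/2, Im s > 0\<close> the Riemann hypothesis provides a holomorphic
  logarithm of \<open>\<zeta>\<close>, given by the Euler product for \<open>Re s > 1\<close>, and \<open>\<pi> S(t)\<close> is the boundary value of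
  its imaginary part. Subtract from it the part \<open>P\<^sub>M\<close> coming from the primes \<open>p \<le> M\<close> and integrate
  against \<open>K\<^sub>a(u)\<close> over \<open>s = 1/2 + \<delta> + \<i>(t\<^sub>0 + \<tau>u)\<close>, \<open>|u| \<le> U\<close>. Moving the line of integration to
  \<open>u - \<i>b\<close> takes \<open>s\<close> into the half-plane of absolute convergence, where the difference is at most
  \<open>ln \<zeta>\<^sub>M(\<gamma>)\<close>, so the integral is at most \<open>\<kappa> ln \<zeta>\<^sub>M(\<gamma>)\<close> up to the contribution of the vertical sides.
  There \<open>K\<^sub>a\<close> is at most a negative power of \<open>ln T\<close> once \<open>U = ln ln ln T + c\<close>, while the logarithm is only
  \<open>O(ln T / (Re s - 1/2))\<close> by the Borel-Caratheodory theorem; the extra weight \<open>1 - u\<^sup>2/U\<^sup>2\<close> vanishes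
  at the corners and compensates the blow-up.

  By Kronecker's theorem and a pigeonhole argument, within bounded distance of every \<open>T\<close> there is a
  \<open>t\<^sub>0\<close> such that \<open>p\<^sup>-\<^sup>i\<^sup>t\<^sup>0\<close> is close to \<open>\<plusminus>\<i>\<close> for all \<open>p \<le> M\<close>, and then the contribution of \<open>P\<^sub>M\<close> is close to
  \<open>\<plusminus>\<integral> K\<^sub>a S\<^sub>M\<close>. Hence \<open>\<plusminus>arg \<zeta>\<close> is large somewhere on the segment, and the bound survives the limit
  \<open>\<delta> \<rightarrow> 0\<close> because \<open>\<zeta>(s) = (s - \<rho>)\<^sup>m g(s)\<close> near each point \<open>\<rho>\<close> of the critical line. The numbers \<open>I\<^sub>N\<close> are
  bounded, so one \<open>M\<close> with \<open>I\<^sub>M\<close> near their supremum serves all \<open>N\<close>.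
\<close>

section \<open>Analytic continuation of the zeta function\<close>

text \<open>The obstacle is the critical line itself. Zeros on it make the logarithm singular, so
  the integral is taken at distance \<delta> from it, and every threshold for \<open>T\<close> has
  to be free of \<delta>, because \<delta> tends to 0 while \<open>T\<close> stays fixed. A factor
  1/\<delta> from the upper corners would destroy this uniformity; that is why a weight is inserted.
  The targets \<i> and -\<i> have an algebraic origin: the Euler factors at \<open>u\<close> and
  \<open>-u\<close>, twisted by such a number, multiply to something whose argument is one
  arctangent of \<open>S_N\<close>, up to the chosen sign. The constants of the theorem precede
  \<open>N\<close>, whereas the waiting time for the approximation depends on the set of primes
  used; hence the wish for a single \<open>M\<close>. Boundedness of \<open>I_N\<close> is not
  visible from \<open>S_N\<close>, whose terms have size \<open>p powr (-1/2)\<close>: it comes from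
  the same shift, applied to a finite Euler product. Since \<open>riemann_zeta\<close> is given by a
  choice operator, continuation and growth are established from scratch, by means that reach just
  past the critical line wherever bounds are required.\<close>

lemma holomorphic_suminf_local:
  fixes f :: "nat \<Rightarrow> complex \<Rightarrow> complex"
  assumes S: "open S" and hol: "\<And>n. f n holomorphic_on S"
    and bd: "\<And>x. x \<in> S \<Longrightarrow> \<exists>d h. 0 < d \<and> summable h \<and> (\<forall>n. \<forall>y\<in>ball x d \<inter> S. norm (f n y) \<le> h n)"
  shows "(\<lambda>s. \<Sum>n. f n s) holomorphic_on S" and "\<And>s. s \<in> S \<Longrightarrow> summable (\<lambda>n. f n s)"
proof -
  have "\<exists>g g'. \<forall>x \<in> S. ((\<lambda>n. f n x) sums g x) \<and> ((\<lambda>n. deriv (f n) x) sums g' x)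
          \<and> (g has_field_derivative g' x) (at x)"
  proof (rule series_and_derivative_comparison_local[OF S])
    show "(f n has_field_derivative deriv (f n) x) (at x)" if "x \<in> S" for n x
      using holomorphic_derivI[OF hol S that] .
    show "\<exists>d h. 0 < d \<and> summable h \<and> (\<forall>\<^sub>F n in sequentially. \<forall>y\<in>ball x d \<inter> S. norm (f n y) \<le> h n)"
      if "x \<in> S" for x
    proof -
      obtain d h where "0 < d" "summable h" "\<forall>n. \<forall>y\<in>ball x d \<inter> S. norm (f n y) \<le> h n"
        using bd[OF \<open>x \<in> S\<close>] by blast
      then show ?thesis by (intro exI[of _ d] exI[of _ h]) auto
    qed
  qed
  then obtain g g' where g: "\<And>x. x \<in> S \<Longrightarrow> (\<lambda>n. f n x) sums g x"
      "\<And>x. x \<in> S \<Longrightarrow> (g has_field_derivative g' x) (at x)" by blast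
  show "\<And>s. s \<in> S \<Longrightarrow> summable (\<lambda>n. f n s)" using g(1) sums_summable by blast
  have "g holomorphic_on S" using g(2) S by (auto simp: holomorphic_on_open)
  moreover have "(\<Sum>n. f n s) = g s" if "s \<in> S" for s using g(1)[OF that] by (simp add: sums_iff)
  ultimately show "(\<lambda>s. \<Sum>n. f n s) holomorphic_on S"
    using holomorphic_cong by (metis (no_types, lifting))
qed

section \<open>Taylor recurrence for the Dirichlet series\<close>

lemma summable_Suc_powr: "x < -1 \<Longrightarrow> summable (\<lambda>n. real (Suc n) powr x)"
  using summable_Suc_iff[of "\<lambda>n. real n powr x"] summable_real_powr_iff by blast

lemma summable_dirichlet: "Re s > 1 \<Longrightarrow> summable (\<lambda>n. (of_nat (Suc n) :: complex) powr (- s))"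
  by (rule summable_norm_cancel)
     (use summable_Suc_powr[of "- Re s"] in \<open>simp add: norm_powr_real_powr del: of_nat_Suc\<close>)

text \<open>\<open>riemann_zeta\<close> says nothing until a continuation is known to exist; this
  concrete sum, meaningful for \<open>Re s > 1\<close>, stands in for it during the
  construction.\<close>

definition dirichlet_zeta :: "complex \<Rightarrow> complex" where
  "dirichlet_zeta s = (\<Sum>n. of_nat (Suc n) powr (- s))"

lemma dirichlet_zeta_sums: "Re s > 1 \<Longrightarrow> (\<lambda>n. of_nat (Suc n) powr (- s)) sums dirichlet_zeta s"
  unfolding dirichlet_zeta_def using summable_dirichlet by (rule summable_sums)

text \<open>\<open>falling i s * x powr (1 - s - i)\<close> is the \<open>i\<close>-th derivative of
  \<open>x powr (1 - s)\<close> in \<open>x\<close>.\<close>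

definition falling :: "nat \<Rightarrow> complex \<Rightarrow> complex" where
  "falling i s = (\<Prod>k<i. 1 - s - of_nat k)"

lemma falling_Suc: "falling (Suc i) s = falling i s * (1 - s - of_nat i)"
  by (simp add: falling_def)

lemma holomorphic_falling [holomorphic_intros]: "falling i holomorphic_on A"
  unfolding falling_def by (intro holomorphic_intros)

text \<open>The Taylor remainder of \<open>x powr (1 - s)\<close> at \<open>n + 1\<close>, evaluated at \<open>n + 2\<close>. Summing over \<open>n\<close>
  telescopes and expresses \<open>(s - 1) \<zeta>(s)\<close> through \<open>\<zeta>(s + 1), \<zeta>(s + 2), \<dots>\<close>, which continues it to
  the left step by step.\<close>

definition taylor_rest :: "nat \<Rightarrow> nat \<Rightarrow> complex \<Rightarrow> complex" where
  "taylor_rest m n s = of_nat (Suc (Suc n)) powr (1 - s)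
     - (\<Sum>i\<le>m. falling i s / fact i * of_nat (Suc n) powr (1 - s - of_nat i))"

text \<open>The segment from \<open>n + 1\<close> to \<open>n + 2\<close> has length 1, and the
  derivative of order \<open>m + 1\<close> has modulus a constant times
  \<open>x powr (- Re s - m)\<close>. The hypothesis makes this exponent nonpositive, so the left
  endpoint gives the maximum.\<close>

lemma norm_taylor_rest:
  assumes "Re s + real m \<ge> 0"
  shows "norm (taylor_rest m n s) \<le> norm (falling (Suc m) s) * real (Suc n) powr (- Re s - real m)"
proof -
  define f where "f = (\<lambda>i x. falling i s * x powr (1 - s - of_nat i))"
  define S where "S = closed_segment (of_nat (Suc n) :: complex) (of_nat (Suc (Suc n)))"
  have S: "\<exists>t. x = of_real t \<and> t \<ge> real (Suc n)" if x: "x \<in> S" for x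
  proof -
    obtain u where u: "0 \<le> u" "u \<le> 1" "x = (1 - u) *\<^sub>R of_nat (Suc n) + u *\<^sub>R of_nat (Suc (Suc n))"
      using x unfolding S_def closed_segment_def by blast
    have "x = of_real (real (Suc n) + u)"
      unfolding u(3) by (simp add: scaleR_conv_of_real algebra_simps)
    then show ?thesis using u by (intro exI[of _ "real (Suc n) + u"]) auto
  qed
  have "cmod (f 0 (of_nat (Suc (Suc n))) - (\<Sum>i\<le>m. f i (of_nat (Suc n)) * (of_nat (Suc (Suc n)) - of_nat (Suc n)) ^ i / fact i))
     \<le> (norm (falling (Suc m) s) * real (Suc n) powr (- Re s - real m)) *
        cmod (of_nat (Suc (Suc n)) - of_nat (Suc n)) ^ Suc m / fact m"
  proof (rule complex_Taylor[where S = S])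
    fix i x assume x: "x \<in> S"
    then obtain t where t: "x = of_real t" "t \<ge> real (Suc n)" using S by blast
    have "x \<notin> \<real>\<^sub>\<le>\<^sub>0" using t by auto
    then have D: "((\<lambda>x. falling i s * x powr (1 - s - of_nat i)) has_field_derivative
        falling i s * ((1 - s - of_nat i) * x powr (1 - s - of_nat i - 1))) (at x)"
      by (intro DERIV_cmult has_field_derivative_powr)
    show "(f i has_field_derivative f (Suc i) x) (at x within S)"
    proof -
      have "1 - s - of_nat i - 1 = 1 - s - of_nat (Suc i)" by simp
      then show ?thesis using D unfolding f_def falling_Suc
        by (metis (no_types) has_field_derivative_at_within mult.assoc)
    qed
    have "t powr (- Re s - real m) \<le> real (Suc n) powr (- Re s - real m)"
      using t assms by (intro powr_mono2') auto
    moreover have "norm (x powr (1 - s - of_nat (Suc m))) = t powr (- Re s - real m)"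
      using t by (subst norm_powr_real_powr) auto
    ultimately show "cmod (f (Suc m) x) \<le> norm (falling (Suc m) s) * real (Suc n) powr (- Re s - real m)"
      unfolding f_def by (simp add: norm_mult mult_left_mono)
  qed (auto simp: S_def)
  also have "\<dots> \<le> norm (falling (Suc m) s) * real (Suc n) powr (- Re s - real m)"
  proof -
    have "x / fact m \<le> x" if "x \<ge> 0" for x :: real
      using that fact_ge_1[of m, where 'a = real] by (simp add: divide_le_eq mult_le_cancel_left1)
    then show ?thesis by simp
  qed
  finally show ?thesis
    unfolding taylor_rest_def f_def by (simp add: falling_def[of 0])
qed

definition taylor_rest_sum :: "nat \<Rightarrow> complex \<Rightarrow> complex" where
  "taylor_rest_sum m s = (\<Sum>n. taylor_rest m n s)"

text \<open>The bound for the remainder is summable as soon as \<open>Re s > 1 - m\<close>: each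
  further Taylor term gains a strip of width 1.\<close>

lemma taylor_rest_sum:
  assumes m: "m \<ge> 1"
  shows "taylor_rest_sum m holomorphic_on {s. Re s > 1 - real m}"
    and "\<And>s. Re s > 1 - real m \<Longrightarrow> summable (\<lambda>n. taylor_rest m n s)"
proof -
  let ?S = "{s. Re s > 1 - real m}"
  have 1: "open ?S" by (simp add: open_halfspace_Re_gt)
  have 2: "taylor_rest m n holomorphic_on ?S" for n
    unfolding taylor_rest_def by (intro holomorphic_intros) (auto simp del: of_nat_Suc)
  have 3: "\<exists>d h. 0 < d \<and> summable h \<and> (\<forall>n. \<forall>y\<in>ball x d \<inter> ?S. norm (taylor_rest m n y) \<le> h n)"
    if x: "x \<in> ?S" for x
  proof -
    \<comment> \<open>Half the distance to the boundary: moving by less than \<open>d\<close> leaves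
      the exponent below \<open>- 1 - d\<close>.\<close>
    define d where "d = (Re x - (1 - real m)) / 2"
    have d: "d > 0" using x by (simp add: d_def)
    have "continuous_on (cball x d) (falling (Suc m))"
      by (intro holomorphic_on_imp_continuous_on holomorphic_intros)
    then have "bounded (falling (Suc m) ` cball x d)"
      by (intro compact_imp_bounded compact_continuous_image) auto
    then obtain B where B: "\<And>y. y \<in> cball x d \<Longrightarrow> norm (falling (Suc m) y) \<le> B"
      unfolding bounded_iff by blast
    have "norm (taylor_rest m n y) \<le> B * real (Suc n) powr (- 1 - d)" if y: "y \<in> ball x d \<inter> ?S" for n y
    proof -
      have "\<bar>Re (x - y)\<bar> < d" using y abs_Re_le_cmod[of "x - y"] by (simp add: dist_norm)
      then have r: "Re y + real m > 1 + d" using d_def by (simp add: abs_less_iff) argo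
      have "norm (taylor_rest m n y) \<le> norm (falling (Suc m) y) * real (Suc n) powr (- Re y - real m)"
        using r d by (intro norm_taylor_rest) auto
      also have "\<dots> \<le> B * real (Suc n) powr (- 1 - d)"
      proof (intro mult_mono B powr_mono)
        show "0 \<le> B" using y d by (intro order_trans[OF norm_ge_zero B[of x]]) auto
      qed (use y r d in auto)
      finally show ?thesis .
    qed
    moreover have "summable (\<lambda>n. B * real (Suc n) powr (- 1 - d))"
      using d by (intro summable_mult summable_Suc_powr) auto
    ultimately show ?thesis using d by blast
  qed
  show "taylor_rest_sum m holomorphic_on ?S"
    unfolding taylor_rest_sum_def[abs_def] using holomorphic_suminf_local(1)[OF 1 2 3] by blast
  show "\<And>s. Re s > 1 - real m \<Longrightarrow> summable (\<lambda>n. taylor_rest m n s)"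
    using holomorphic_suminf_local(2)[OF 1 2 3] by blast
qed

lemma Suc_powr_tendsto_0:
  assumes "Re s > 1" shows "(\<lambda>n. (of_nat (Suc n) :: complex) powr (1 - s)) \<longlonglongrightarrow> 0"
proof -
  have "(\<lambda>n. real n powr (1 - Re s)) \<longlonglongrightarrow> 0"
    using tendsto_neg_powr[of "1 - Re s" real sequentially] assms filterlim_real_sequentially by simp
  then have "(\<lambda>n. real (Suc n) powr (1 - Re s)) \<longlonglongrightarrow> 0" by (rule LIMSEQ_Suc)
  then show ?thesis
    by (subst tendsto_norm_zero_iff[symmetric]) (simp add: norm_powr_real_powr del: of_nat_Suc)
qed

text \<open>The difference of powers telescopes to -1, the Taylor term of order 1 yields
  \<open>(1 - s)\<close> times zeta at \<open>s\<close>, and for \<open>i \<ge> 2\<close> the last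
  factor of \<open>falling i s\<close> is \<open>- (s + (i - 1) - 1)\<close>. Joining it to the
  shifted zeta value leaves only expressions \<open>(w - 1) * dirichlet_zeta w\<close>, so no pole
  has to be carried along.\<close>

lemma dirichlet_zeta_recurrence:
  assumes s: "Re s > 1" and m: "m \<ge> 1"
  shows "(s - 1) * dirichlet_zeta s = 1 + taylor_rest_sum m s -
    (\<Sum>i=2..m. falling (i - 1) s / fact i * ((s + of_nat (i - 1) - 1) * dirichlet_zeta (s + of_nat (i - 1))))"
proof -
  have a: "(\<lambda>n. of_nat (Suc (Suc n)) powr (1 - s) - of_nat (Suc n) powr (1 - s)) sums (0 - 1 :: complex)"
    using telescope_sums[OF Suc_powr_tendsto_0[OF s]] by simp
  have b: "(\<lambda>n. \<Sum>i=1..m. falling i s / fact i * of_nat (Suc n) powr (- (s + of_nat (i - 1))))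
      sums (\<Sum>i=1..m. falling i s / fact i * dirichlet_zeta (s + of_nat (i - 1)))"
    using s by (intro sums_sum sums_mult dirichlet_zeta_sums) auto
  have e: "taylor_rest m n s = of_nat (Suc (Suc n)) powr (1 - s) - of_nat (Suc n) powr (1 - s)
       - (\<Sum>i=1..m. falling i s / fact i * of_nat (Suc n) powr (- (s + of_nat (i - 1))))" for n
  proof -
    have "(\<Sum>i\<le>m. falling i s / fact i * of_nat (Suc n) powr (1 - s - of_nat i))
      = of_nat (Suc n) powr (1 - s) + (\<Sum>i=1..m. falling i s / fact i * of_nat (Suc n) powr (1 - s - of_nat i))"
      by (simp add: atMost_atLeast0 sum.atLeast_Suc_atMost falling_def)
    also have "(\<Sum>i=1..m. falling i s / fact i * of_nat (Suc n) powr (1 - s - of_nat i)) =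
       (\<Sum>i=1..m. falling i s / fact i * of_nat (Suc n) powr (- (s + of_nat (i - 1))))"
      by (intro sum.cong refl) (auto simp: of_nat_diff algebra_simps)
    finally show ?thesis unfolding taylor_rest_def by (simp add: algebra_simps)
  qed
  have "(\<lambda>n. taylor_rest m n s) sums (0 - 1 - (\<Sum>i=1..m. falling i s / fact i * dirichlet_zeta (s + of_nat (i - 1))))"
    unfolding e by (intro sums_diff a b)
  then have "taylor_rest_sum m s = - 1 - (\<Sum>i=1..m. falling i s / fact i * dirichlet_zeta (s + of_nat (i - 1)))"
    unfolding taylor_rest_sum_def by (simp add: sums_iff)
  also have "(\<Sum>i=1..m. falling i s / fact i * dirichlet_zeta (s + of_nat (i - 1))) =
     (1 - s) * dirichlet_zeta s + (\<Sum>i=2..m. falling i s / fact i * dirichlet_zeta (s + of_nat (i - 1)))"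
    using m by (simp add: sum.atLeast_Suc_atMost falling_def numeral_2_eq_2)
  also have "(\<Sum>i=2..m. falling i s / fact i * dirichlet_zeta (s + of_nat (i - 1))) =
     - (\<Sum>i=2..m. falling (i - 1) s / fact i * ((s + of_nat (i - 1) - 1) * dirichlet_zeta (s + of_nat (i - 1))))"
    unfolding sum_negf[symmetric]
  proof (intro sum.cong refl)
    fix i assume "i \<in> {2..m}"
    then obtain j where j: "i = Suc j" by (cases i) auto
    have e: "1 - s - of_nat j = - (s + of_nat j - 1)" by simp
    show "falling i s / fact i * dirichlet_zeta (s + of_nat (i - 1)) =
      - (falling (i - 1) s / fact i * ((s + of_nat (i - 1) - 1) * dirichlet_zeta (s + of_nat (i - 1))))"
      unfolding j falling_Suc e diff_Suc_1 by (simp del: fact_Suc minus_diff_eq)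
  qed
  finally show ?thesis by (simp add: algebra_simps)
qed

text \<open>With \<open>m = k + 2\<close> the remainder is holomorphic for
  \<open>Re s > - (k + 1)\<close>, and the arguments \<open>s + (i - 1)\<close> with
  \<open>i \<ge> 2\<close> fall into the half-plane of the induction hypothesis.\<close>

lemma zeta_continuation_step:
  "\<exists>g. g holomorphic_on {s. Re s > - real k} \<and> (\<forall>s. Re s > 1 \<longrightarrow> g s = (s - 1) * dirichlet_zeta s)"
proof (induction k)
  case 0
  have "(\<lambda>s. 1 + taylor_rest_sum 1 s) holomorphic_on {s. Re s > 0}"
    using taylor_rest_sum(1)[of 1] by (intro holomorphic_intros) auto
  then show ?case using dirichlet_zeta_recurrence[of _ 1]
    by (intro exI[of _ "\<lambda>s. 1 + taylor_rest_sum 1 s"]) auto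
next
  case (Suc k)
  then obtain g where g: "g holomorphic_on {s. Re s > - real k}"
    "\<And>s. Re s > 1 \<Longrightarrow> g s = (s - 1) * dirichlet_zeta s" by blast
  define h where "h = (\<lambda>s. 1 + taylor_rest_sum (Suc (Suc k)) s -
    (\<Sum>i=2..Suc (Suc k). falling (i - 1) s / fact i * g (s + of_nat (i - 1))))"
  have "(\<lambda>s. g (s + of_nat (i - 1))) holomorphic_on {s. Re s > - real (Suc k)}" if "i \<in> {2..Suc (Suc k)}" for i
  proof -
    have "(g \<circ> (\<lambda>s. s + of_nat (i - 1))) holomorphic_on {s. Re s > - real (Suc k)}"
      by (rule holomorphic_on_compose_gen[OF _ g(1)]) (use that in \<open>auto intro!: holomorphic_intros\<close>)
    then show ?thesis by (simp add: o_def)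
  qed
  then have "h holomorphic_on {s. Re s > - real (Suc k)}"
    unfolding h_def using taylor_rest_sum(1)[of "Suc (Suc k)"] by (intro holomorphic_intros) auto
  moreover have "h s = (s - 1) * dirichlet_zeta s" if "Re s > 1" for s
  proof -
    have "h s = 1 + taylor_rest_sum (Suc (Suc k)) s -
    (\<Sum>i=2..Suc (Suc k). falling (i - 1) s / fact i * ((s + of_nat (i - 1) - 1) * dirichlet_zeta (s + of_nat (i - 1))))"
      unfolding h_def using that by (intro arg_cong2[of _ _ _ _ "(-)"] refl sum.cong) (auto simp: g(2))
    then show ?thesis using dirichlet_zeta_recurrence[OF that, of "Suc (Suc k)"] by simp
  qed
  ultimately show ?case by blast
qed

lemma halfplane_identity:
  assumes "f holomorphic_on {s. Re s > x}" "g holomorphic_on {s. Re s > x}"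
    and "\<And>s. Re s > 1 \<Longrightarrow> f s = g s" and "Re s > x"
  shows "f s = g s"
proof (cases "x \<ge> 1")
  case True then show ?thesis using assms(3,4) by auto
next
  case False
  show ?thesis
  proof (rule analytic_continuation_open[of "{s. Re s > 1}" "{s. Re s > x}" f g])
    show "{s. Re s > 1} \<noteq> {}" by (auto intro: exI[of _ "2 :: complex"])
    show "connected {s. Re s > x}" by (intro convex_connected convex_halfspace_Re_gt)
  qed (use assms False in \<open>auto simp: open_halfspace_Re_gt\<close>)
qed

lemma zeta_continuation:
  "\<exists>f. f holomorphic_on - {1} \<and> (\<forall>s. Re s > 1 \<longrightarrow> (\<lambda>n. of_nat (Suc n) powr (- s)) sums f s)"
proof -
  obtain g where g: "\<And>k. g k holomorphic_on {s. Re s > - real k}"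
    "\<And>k s. Re s > 1 \<Longrightarrow> g k s = (s - 1) * dirichlet_zeta s"
    using zeta_continuation_step by metis
  have ag: "g k s = g l s" if "Re s > - real k" "Re s > - real l" for k l s
    by (rule halfplane_identity[of "g k" "- real (min k l)"])
       (use that g in \<open>auto intro!: holomorphic_on_subset[OF g(1)]\<close>)
  \<comment> \<open>The index is large enough for \<open>s\<close>; since the \<open>g k\<close>
    agree on overlaps by \<open>ag\<close>, near each point \<open>Z\<close> is a single
    \<open>g k\<close>.\<close>
  define Z where "Z s = g (nat \<lceil>\<bar>Re s\<bar>\<rceil> + 1) s" for s
  have Z: "Z s = g k s" if "Re s > - real k" for k s
    unfolding Z_def using that by (intro ag) (auto, linarith)
  have "Z field_differentiable at s" for s
  proof -
    define k where "k = nat \<lceil>\<bar>Re s\<bar>\<rceil> + 1"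
    have k: "Re s > - real k" unfolding k_def by (auto, linarith)
    have "Z holomorphic_on {s. Re s > - real k}"
      using g(1)[of k] Z holomorphic_cong[of "{s. Re s > - real k}" _ Z "g k"] by auto
    then show ?thesis using k
      by (auto simp: holomorphic_on_open open_halfspace_Re_gt field_differentiable_def)
  qed
  then have "Z holomorphic_on UNIV" by (simp add: holomorphic_on_def field_differentiable_at_within)
  then have "(\<lambda>s. Z s / (s - 1)) holomorphic_on - {1}"
    by (intro holomorphic_intros) (auto intro: holomorphic_on_subset)
  moreover have "Z s / (s - 1) = dirichlet_zeta s" if "Re s > 1" for s
  proof -
    have "s \<noteq> 1" using that by auto
    then show ?thesis using that Z[of 0 s] g(2)[OF that, of 0] by simp
  qed
  ultimately show ?thesis using dirichlet_zeta_sums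
    by (intro exI[of _ "\<lambda>s. Z s / (s - 1)"]) simp
qed

lemma riemann_zeta_holomorphic: "riemann_zeta holomorphic_on - {1}"
  and riemann_zeta_sums: "Re s > 1 \<Longrightarrow> (\<lambda>n. of_nat (Suc n) powr (- s)) sums riemann_zeta s"
  using someI_ex[OF zeta_continuation] unfolding riemann_zeta_def[symmetric] by auto

text \<open>\<open>riemann_zeta\<close> is a chosen function, so the formula reaches it through the
  identity theorem on a punctured half-plane. The case \<open>m = 1\<close> already covers
  \<open>Re s > 0\<close>.\<close>

lemma riemann_zeta_eq_taylor:
  assumes "Re s > 0" "s \<noteq> 1"
  shows "(s - 1) * riemann_zeta s = 1 + taylor_rest_sum 1 s"
proof (rule analytic_continuation_open[of "{s. Re s > 1}" "{s. Re s > 0} - {1}"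
      "\<lambda>s. (s - 1) * riemann_zeta s" "\<lambda>s. 1 + taylor_rest_sum 1 s"])
  show "{s. Re s > 1} \<noteq> {}" by (auto intro: exI[of _ "2 :: complex"])
  show "connected ({s. Re s > 0} - {1})"
    by (rule connected_open_diff_countable)
       (auto simp: open_halfspace_Re_gt convex_connected convex_halfspace_Re_gt)
  show "(\<lambda>s. (s - 1) * riemann_zeta s) holomorphic_on {s. Re s > 0} - {1}"
    by (intro holomorphic_intros holomorphic_on_subset[OF riemann_zeta_holomorphic]) auto
  show "(\<lambda>s. 1 + taylor_rest_sum 1 s) holomorphic_on {s. Re s > 0} - {1}"
    using taylor_rest_sum(1)[of 1] by (intro holomorphic_intros holomorphic_on_subset[OF taylor_rest_sum(1)]) auto
  show "(s - 1) * riemann_zeta s = 1 + taylor_rest_sum 1 s" if "s \<in> {s. Re s > 1}" for s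
  proof -
    have "riemann_zeta s = dirichlet_zeta s"
      using that riemann_zeta_sums dirichlet_zeta_sums sums_unique2 by blast
    then show ?thesis using dirichlet_zeta_recurrence[of s 1] that by simp
  qed
qed (use assms in \<open>auto simp: open_halfspace_Re_gt\<close>)

lemma norm_riemann_zeta_le:
  obtains C where "C > 0" "\<And>s. Re s \<ge> 1/2 \<Longrightarrow> norm (s - 1) \<ge> 1 \<Longrightarrow> norm (riemann_zeta s) \<le> 1 + C * norm s"
proof
  define C where "C = (\<Sum>n. real (Suc n) powr (- 3/2))"
  have summ: "summable (\<lambda>n. real (Suc n) powr (- 3/2))" by (rule summable_Suc_powr) simp
  show "C > 0" unfolding C_def by (rule suminf_pos[OF summ]) auto
  fix s :: complex assume s: "Re s \<ge> 1/2" "norm (s - 1) \<ge> 1"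
  \<comment> \<open>The factor \<open>s - 1\<close> cancels the one in the continuation formula,
    which leaves linear growth.\<close>
  have f: "falling 2 s = (s - 1) * s" by (simp add: falling_def numeral_2_eq_2 algebra_simps)
  have "norm (taylor_rest 1 n s) \<le> norm (s - 1) * norm s * real (Suc n) powr (- 3/2)" for n
  proof -
    have "norm (taylor_rest 1 n s) \<le> norm (falling (Suc 1) s) * real (Suc n) powr (- Re s - real 1)"
      using s by (intro norm_taylor_rest) auto
    also have "\<dots> \<le> norm (falling (Suc 1) s) * real (Suc n) powr (- 3/2)"
      using s by (intro mult_left_mono powr_mono) auto
    finally show ?thesis using f by (simp add: norm_mult numeral_2_eq_2)
  qed
  then have "norm (taylor_rest_sum 1 s) \<le> (\<Sum>n. norm (s - 1) * norm s * real (Suc n) powr (- 3/2))"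
    unfolding taylor_rest_sum_def by (intro norm_suminf_le summable_mult summ)
  then have t: "norm (taylor_rest_sum 1 s) \<le> norm (s - 1) * norm s * C"
    unfolding C_def using suminf_mult[OF summ] by simp
  have ne: "s \<noteq> 1" using s by auto
  have "norm (s - 1) * norm (riemann_zeta s) = norm (1 + taylor_rest_sum 1 s)"
    using riemann_zeta_eq_taylor[of s] s ne by (simp flip: norm_mult)
  also have "\<dots> \<le> 1 + norm (s - 1) * norm s * C"
    using norm_triangle_ineq[of 1 "taylor_rest_sum 1 s"] t by simp
  also have "\<dots> \<le> norm (s - 1) * (1 + C * norm s)" using s by (simp add: algebra_simps)
  finally show "norm (riemann_zeta s) \<le> 1 + C * norm s"
    using ne by (simp add: mult_le_cancel_left)
qed

section \<open>Euler product\<close>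

text \<open>The power series of \<open>- Ln (1 - z)\<close> has nonnegative coefficients, so its
  value at \<open>norm z\<close> is a majorant.\<close>

lemma norm_Ln_one_minus_le:
  fixes z :: complex
  assumes "norm z < 1"
  shows "norm (Ln (1 - z)) \<le> - ln (1 - norm z)"
proof -
  have s: "(\<lambda>n. - (w ^ n) / of_nat n) sums ln (1 - w)" if "norm w < 1" for w :: complex
    using Ln_series'[of "- w"] that by simp
  have "(\<lambda>n. - (of_real (norm z) ^ n) / of_nat n) sums (ln (1 - of_real (norm z)) :: complex)"
    using assms by (intro s) auto
  then have "(\<lambda>n. Re (- (of_real (norm z) ^ n) / of_nat n)) sums Re (ln (1 - of_real (norm z)) :: complex)"
    by (rule sums_Re)
  moreover have "ln (1 - of_real (norm z) :: complex) = of_real (ln (1 - norm z))"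
    using assms Ln_of_real[of "1 - norm z"] by simp
  moreover have "Re (- (of_real (norm z) ^ n) / of_nat n) = - (norm z ^ n / real n)" for n
  proof -
    have "- (of_real (norm z) ^ n) / of_nat n = (of_real (- (norm z ^ n / real n)) :: complex)" by simp
    then show ?thesis by (metis Re_complex_of_real)
  qed
  ultimately have "(\<lambda>n. - (norm z ^ n / real n)) sums ln (1 - norm z)" by simp
  then have t: "(\<lambda>n. norm z ^ n / real n) sums - ln (1 - norm z)"
    using sums_minus by fastforce
  have "norm (\<Sum>n. - (z ^ n) / of_nat n) \<le> (\<Sum>n. norm z ^ n / real n)"
    using t by (intro norm_suminf_le) (auto simp: norm_divide norm_power sums_iff)
  then show ?thesis using s[OF assms] t by (simp add: sums_iff)
qed

lemma minus_ln_one_minus_le: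
  fixes x :: real assumes "0 \<le> x" "x \<le> 1/2" shows "- ln (1 - x) \<le> 2 * x"
proof -
  have "ln (inverse (1 - x)) \<le> inverse (1 - x) - 1" using assms by (intro ln_le_minus_one) auto
  also have "\<dots> \<le> 2 * x" using assms by (simp add: field_simps) (use mult_left_mono[of x "1/2" x] in simp)
  finally show ?thesis using assms by (simp add: ln_inverse)
qed

lemma Ln_one_minus_lipschitz:
  fixes z w :: complex
  assumes "norm z \<le> r" "norm w \<le> r" "r < 1"
  shows "norm (Ln (1 - z) - Ln (1 - w)) \<le> norm (z - w) / (1 - r)"
proof -
  have "norm (Ln (1 - z) - Ln (1 - w)) \<le> 1 / (1 - r) * norm (z - w)"
  proof (rule field_differentiable_bound[where S = "cball 0 r" and f = "\<lambda>x. Ln (1 - x)" and f' = "\<lambda>x. - 1 / (1 - x)"])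
    fix x :: complex assume x: "x \<in> cball 0 r"
    then have nx: "norm x < 1" using assms by auto
    then have "Re x < 1" using complex_Re_le_cmod[of x] by linarith
    then have "1 - x \<notin> \<real>\<^sub>\<le>\<^sub>0" by (auto simp: complex_nonpos_Reals_iff)
    then show "((\<lambda>x. Ln (1 - x)) has_field_derivative - 1 / (1 - x)) (at x within cball 0 r)"
      by (auto intro!: derivative_eq_intros simp: divide_inverse)
    have "1 - r \<le> norm (1 - x)"
      using norm_triangle_ineq2[of 1 x] x by auto
    then show "norm (- 1 / (1 - x)) \<le> 1 / (1 - r)"
      using assms by (simp add: norm_divide frac_le)
  qed (use assms in auto)
  then show ?thesis by simp
qed

section \<open>Prime sums and the tail of the Euler product\<close>

lemma norm_nat_powr: "n > 0 \<Longrightarrow> norm ((of_nat n :: complex) powr s) = real n powr Re s"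
  by (subst norm_powr_real_powr) auto

lemma nat_powr_le_half_powr:
  assumes "p \<ge> 2" "x \<ge> 0" shows "real p powr (- x) \<le> 2 powr (- x)"
  using assms by (intro powr_mono2') auto

lemma prime_powr_lt_1: "prime p \<Longrightarrow> x > 0 \<Longrightarrow> real p powr (- x) < 1"
  using prime_gt_1_nat[of p] by (simp add: powr_less_one)

text \<open>Extension by zero to non-primes lets all sums range over the natural numbers. The
  companion \<open>prime_ln\<close> is the value at a real point and serves as majorant.\<close>

definition prime_log :: "complex \<Rightarrow> nat \<Rightarrow> complex" where
  "prime_log s p = (if prime p then - Ln (1 - of_nat p powr (- s)) else 0)"

definition prime_ln :: "real \<Rightarrow> nat \<Rightarrow> real" where
  "prime_ln x p = (if prime p then - ln (1 - real p powr (- x)) else 0)"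

lemma prime_ln_nonneg: "x > 0 \<Longrightarrow> prime_ln x p \<ge> 0"
  using prime_powr_lt_1[of p x] prime_gt_0_nat[of p] by (auto simp: prime_ln_def)

lemma prime_ln_antimono: "0 < x \<Longrightarrow> x \<le> y \<Longrightarrow> prime_ln y p \<le> prime_ln x p"
  using prime_powr_lt_1[of p x] prime_powr_lt_1[of p y] prime_gt_1_nat[of p]
  by (auto simp: prime_ln_def intro!: powr_mono)

lemma norm_prime_log_le: "Re s \<ge> x \<Longrightarrow> x > 0 \<Longrightarrow> norm (prime_log s p) \<le> prime_ln x p"
proof -
  assume s: "Re s \<ge> x" "x > 0"
  have "norm (prime_log s p) \<le> prime_ln (Re s) p"
    using s norm_Ln_one_minus_le[of "of_nat p powr (- s)"] prime_powr_lt_1[of p "Re s"] prime_gt_0_nat[of p]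
    by (auto simp: prime_log_def prime_ln_def norm_nat_powr)
  also have "\<dots> \<le> prime_ln x p" using s by (intro prime_ln_antimono) auto
  finally show ?thesis .
qed

lemma prime_ln_le:
  assumes "x \<ge> 1" shows "prime_ln x p \<le> 2 * real p powr (- x)"
proof (cases "prime p")
  case True
  have "real p powr (- x) \<le> 2 powr (- x)" using True assms prime_ge_2_nat by (intro nat_powr_le_half_powr) auto
  also have "\<dots> \<le> 2 powr (- 1)" using assms by (intro powr_mono) auto
  finally show ?thesis using True minus_ln_one_minus_le[of "real p powr (- x)"] by (simp add: prime_ln_def powr_minus)
qed (auto simp: prime_ln_def)

lemma summable_prime_ln: "x > 1 \<Longrightarrow> summable (prime_ln x)"
  by (rule summable_comparison_test'[of "\<lambda>p. 2 * real p powr (- x)" 0])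
     (use prime_ln_le prime_ln_nonneg summable_real_powr_iff in \<open>auto intro!: summable_mult\<close>)

text \<open>Each factor is the exponential of a \<open>prime_ln\<close> term, and summability of
  these terms makes the infinite product converge.\<close>

lemma zeta_N_eq:
  assumes "x > 1"
  shows "ln (zeta_N N x) = (\<Sum>p. if p > N then prime_ln x p else 0)"
    and "summable (\<lambda>p. if p > N then prime_ln x p else 0)"
proof -
  show s: "summable (\<lambda>p. if p > N then prime_ln x p else 0)"
    using assms by (intro summable_comparison_test'[OF summable_prime_ln[OF assms], of 0])
      (auto simp: prime_ln_nonneg)
  have "(if prime p \<and> p > N then inverse (1 - real p powr (- x)) else 1) =
      exp (if p > N then prime_ln x p else 0)" for p
    using prime_powr_lt_1[of p x] assms by (auto simp: prime_ln_def exp_minus)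
  then have "zeta_N N x = exp (\<Sum>p. if p > N then prime_ln x p else 0)"
    unfolding zeta_N_def using prodinf_exp[OF s] by simp
  then show "ln (zeta_N N x) = (\<Sum>p. if p > N then prime_ln x p else 0)" by simp
qed

lemma ln_zeta_N_nonneg: "x > 1 \<Longrightarrow> ln (zeta_N N x) \<ge> 0"
  unfolding zeta_N_eq(1) by (rule suminf_nonneg[OF zeta_N_eq(2)]) (auto simp: prime_ln_nonneg)

definition zeta_log_series :: "complex \<Rightarrow> complex" where
  "zeta_log_series s = (\<Sum>p. prime_log s p)"

lemma summable_prime_log: "Re s > 1 \<Longrightarrow> summable (prime_log s)"
  using norm_prime_log_le[of "Re s" s]
  by (intro summable_comparison_test'[OF summable_prime_ln[of "Re s"], of 0]) auto

text \<open>What remains is the tail over primes above \<open>N\<close>, and its majorant at the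
  real point \<open>x\<close> is the logarithm of \<open>zeta_N\<close>: the source of
  \<open>ln (zeta_N N \<gamma>)\<close> in \<open>I_N\<close>.\<close>

lemma zeta_log_series_truncate:
  assumes "Re s \<ge> x" "x > 1"
  shows "norm (zeta_log_series s - (\<Sum>p\<le>N. prime_log s p)) \<le> ln (zeta_N N x)"
proof -
  have "(\<lambda>p. prime_log s p - (if p \<in> {..N} then prime_log s p else 0)) sums
      (zeta_log_series s - (\<Sum>p\<le>N. prime_log s p))"
    unfolding zeta_log_series_def using assms
    by (intro sums_diff summable_sums summable_prime_log sums_If_finite_set) auto
  also have "(\<lambda>p. prime_log s p - (if p \<in> {..N} then prime_log s p else 0)) =
      (\<lambda>p. if p > N then prime_log s p else 0)" by auto
  finally have "zeta_log_series s - (\<Sum>p\<le>N. prime_log s p) = (\<Sum>p. if p > N then prime_log s p else 0)"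
    by (simp add: sums_iff)
  also have "norm \<dots> \<le> (\<Sum>p. if p > N then prime_ln x p else 0)"
    using assms norm_prime_log_le[of x s] by (intro norm_suminf_le zeta_N_eq) auto
  finally show ?thesis using zeta_N_eq(1)[OF assms(2)] by simp
qed

lemma norm_zeta_log_series_le:
  assumes "Re s \<ge> x" "x > 1" shows "norm (zeta_log_series s) \<le> ln (zeta_N 0 x)"
  using zeta_log_series_truncate[OF assms, of 0] by (simp add: prime_log_def)

lemma zeta_log_series_holomorphic: "zeta_log_series holomorphic_on {s. Re s > 1}"
  unfolding zeta_log_series_def[abs_def]
proof (rule holomorphic_suminf_local(1)[of _ "\<lambda>p s. prime_log s p"])
  show "(\<lambda>s. prime_log s p) holomorphic_on {s. Re s > 1}" for p
  proof (cases "prime p")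
    case True
    have "1 - of_nat p powr - s \<notin> \<real>\<^sub>\<le>\<^sub>0" if "Re s > 1" for s
    proof -
      have "norm ((of_nat p :: complex) powr - s) < 1"
        using True that prime_powr_lt_1[of p "Re s"] prime_gt_0_nat[of p] by (simp add: norm_nat_powr)
      then have "Re ((of_nat p :: complex) powr - s) < 1" using complex_Re_le_cmod order_le_less_trans by blast
      then show ?thesis by (auto simp: complex_nonpos_Reals_iff)
    qed
    then show ?thesis using True prime_gt_0_nat[of p] unfolding prime_log_def by (auto intro!: holomorphic_intros)
  qed (auto simp: prime_log_def)
  show "\<exists>d h. 0 < d \<and> summable h \<and> (\<forall>n. \<forall>y\<in>ball x d \<inter> {s. 1 < Re s}. cmod (prime_log y n) \<le> h n)"
    if x: "x \<in> {s. 1 < Re s}" for x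
  proof (intro exI conjI allI ballI)
    show "0 < (Re x - 1) / 2" using x by auto
    show "summable (prime_ln ((Re x + 1) / 2))" using x by (intro summable_prime_ln) auto
    fix n y assume y: "y \<in> ball x ((Re x - 1) / 2) \<inter> {s. 1 < Re s}"
    have "\<bar>Re (x - y)\<bar> < (Re x - 1) / 2"
      using y abs_Re_le_cmod[of "x - y"] by (auto simp: dist_norm)
    then have "Re y \<ge> (Re x + 1) / 2" by (simp add: abs_less_iff) argo
    then show "cmod (prime_log y n) \<le> prime_ln ((Re x + 1) / 2) n"
      using x by (intro norm_prime_log_le) auto
  qed
qed (auto simp: open_halfspace_Re_gt)

text \<open>Sieve of Eratosthenes: for prime \<open>N\<close> the elements of \<open>A N\<close>
  divisible by \<open>N\<close> are the products of \<open>N\<close> with elements of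
  \<open>A N\<close>, and by multiplicativity they contribute \<open>f N\<close> times the sum over
  \<open>A N\<close>. Removing them gives the factor \<open>1 - f N\<close>.\<close>

lemma rough_numbers_sieve:
  fixes f :: "nat \<Rightarrow> complex" and A :: "nat \<Rightarrow> nat set"
  defines "A \<equiv> \<lambda>N. {n. n > 0 \<and> (\<forall>q. prime q \<and> q < N \<longrightarrow> \<not> q dvd n)}"
  assumes f: "f summable_on UNIV" and mult: "\<And>m n. f (m * n) = f m * f n"
  shows "infsum f (A N) = infsum f {0<..} * (\<Prod>p | prime p \<and> p < N. 1 - f p)"
proof (induction N)
  case 0
  have "A 0 = {0<..}" by (auto simp: A_def)
  then show ?case by simp
next
  case (Suc N)
  have sm: "f summable_on B" for B using f summable_on_subset_banach by blast
  show ?case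
  proof (cases "prime N")
    case False
    have "q < Suc N \<longleftrightarrow> q < N" if "prime q" for q using that False by (auto simp: less_Suc_eq)
    then have "A (Suc N) = A N" "{p. prime p \<and> p < Suc N} = {p. prime p \<and> p < N}" unfolding A_def by blast+
    then show ?thesis using Suc by simp
  next
    case True
    have N: "N > 0" using True prime_gt_0_nat by blast
    have 1: "A N = A (Suc N) \<union> (\<lambda>k. N * k) ` A N"
    proof (intro equalityI subsetI)
      fix n assume n: "n \<in> A N"
      show "n \<in> A (Suc N) \<union> (\<lambda>k. N * k) ` A N"
      proof (cases "N dvd n")
        case True
        then obtain k where k: "n = N * k" by blast
        then have "k \<in> A N" using n unfolding A_def by auto
        then show ?thesis using k by auto
      next
        case False
        then show ?thesis using n unfolding A_def by (auto simp: less_Suc_eq)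
      qed
    next
      fix n assume "n \<in> A (Suc N) \<union> (\<lambda>k. N * k) ` A N"
      then show "n \<in> A N"
      proof
        assume "n \<in> A (Suc N)" then show ?thesis unfolding A_def by auto
      next
        assume "n \<in> (\<lambda>k. N * k) ` A N"
        then obtain k where k: "n = N * k" "k \<in> A N" by blast
        have "\<not> q dvd N * k" if "prime q" "q < N" for q
        proof
          assume "q dvd N * k"
          then have "q dvd N \<or> q dvd k" using that(1) prime_dvd_mult_iff by blast
          moreover have "\<not> q dvd N" using that True primes_dvd_imp_eq by blast
          moreover have "\<not> q dvd k" using k(2) that unfolding A_def by blast
          ultimately show False by blast
        qed
        then show ?thesis using k N unfolding A_def by auto
      qed
    qed
    have 2: "A (Suc N) \<inter> (\<lambda>k. N * k) ` A N = {}" using True unfolding A_def by auto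
    have inj: "inj_on (\<lambda>k. N * k) (A N)" using N by (auto simp: inj_on_def)
    have "infsum f (A N) = infsum f (A (Suc N)) + infsum f ((\<lambda>k. N * k) ` A N)"
      using infsum_Un_disjoint[OF sm sm 2] 1 by simp
    also have "infsum f ((\<lambda>k. N * k) ` A N) = (\<Sum>\<^sub>\<infinity>k\<in>A N. f N * f k)"
      using infsum_reindex[OF inj, of f] by (simp add: o_def mult)
    also have "\<dots> = f N * infsum f (A N)" by (simp add: infsum_cmult_right' )
    finally have e: "infsum f (A (Suc N)) = infsum f (A N) * (1 - f N)"
      by (metis add_diff_cancel_right' mult.commute mult.right_neutral right_diff_distrib)
    have "{p. prime p \<and> p < Suc N} = insert N {p. prime p \<and> p < N}" using True by (auto simp: less_Suc_eq)
    then have "(\<Prod>p | prime p \<and> p < Suc N. 1 - f p) = (1 - f N) * (\<Prod>p | prime p \<and> p < N. 1 - f p)"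
      by simp
    then show ?thesis using Suc e by simp
  qed
qed

text \<open>Apart from 1, a positive number without prime factors below \<open>N\<close> is at least
  \<open>N\<close>, so the sieved sum is 1 plus part of the tail of a convergent series.\<close>

lemma euler_product_limit:
  assumes s: "Re s > 1"
  shows "(\<lambda>N. riemann_zeta s * (\<Prod>p | prime p \<and> p < N. 1 - of_nat p powr (- s))) \<longlonglongrightarrow> 1"
proof -
  define f where "f = (\<lambda>n::nat. (of_nat n :: complex) powr (- s))"
  define h where "h = (\<lambda>n::nat. real n powr (- Re s))"
  have nf: "norm (f n) = h n" for n
    by (cases "n = 0") (auto simp: f_def h_def norm_nat_powr)
  have hs: "summable h" unfolding h_def using s summable_real_powr_iff by auto
  have hsm: "h summable_on B" for B
    using hs by (intro summable_on_subset_banach[OF norm_summable_imp_summable_on[of h], of B]) (auto simp: h_def)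
  have fsm: "f summable_on B" for B
    using hs nf by (intro summable_on_subset_banach[OF norm_summable_imp_summable_on[of f], of B]) auto
  have mult: "f (m * n) = f m * f n" for m n
    unfolding f_def by (simp add: powr_times_real)
  have "((\<lambda>n. f (Suc n)) has_sum riemann_zeta s) UNIV"
  proof (rule norm_summable_imp_has_sum)
    show "summable (\<lambda>n. norm (f (Suc n)))" unfolding nf using hs by (simp add: summable_Suc_iff)
    show "(\<lambda>n. f (Suc n)) sums riemann_zeta s" using riemann_zeta_sums[OF s] unfolding f_def .
  qed
  then have "infsum (f \<circ> Suc) UNIV = riemann_zeta s" by (simp add: infsumI o_def)
  then have z: "infsum f {0<..} = riemann_zeta s"
    using infsum_reindex[of Suc UNIV f] by (simp add: greaterThan_0)
  define A where "A = (\<lambda>N. {n::nat. n > 0 \<and> (\<forall>q. prime q \<and> q < N \<longrightarrow> \<not> q dvd n)})"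
  have eq: "infsum f (A N) = riemann_zeta s * (\<Prod>p | prime p \<and> p < N. 1 - of_nat p powr (- s))" for N
    using rough_numbers_sieve[OF fsm mult, of N] unfolding A_def z by (simp add: f_def)
  have bound: "norm (infsum f (A N) - 1) \<le> infsum h UNIV - sum h {..<N}" for N
  proof -
    have 1: "1 \<in> A N" unfolding A_def by auto
    have "infsum f (insert 1 (A N - {1})) = f 1 + infsum f (A N - {1})"
      by (rule infsum_insert) (auto simp: fsm)
    moreover have "f 1 = 1" by (simp add: f_def)
    ultimately have "infsum f (A N) - 1 = infsum f (A N - {1})" using 1 by (simp add: insert_absorb)
    also have "norm \<dots> \<le> infsum h (A N - {1})"
      by (rule norm_infsum_le[OF has_sum_infsum[OF fsm] has_sum_infsum[OF hsm]]) (auto simp: nf)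
    also have "\<dots> \<le> infsum h {N..}"
    proof (rule infsum_mono_neutral[OF hsm hsm])
      fix n assume "n \<in> A N - {1} - {N..}"
      then have n: "n \<in> A N" "n \<noteq> 1" "n < N" by auto
      obtain q where q: "prime q" "q dvd n" using prime_factor_nat n(2) by blast
      moreover have "n > 0" using n(1) by (auto simp: A_def)
      ultimately have "q < N" using n(3) dvd_imp_le[of q n] by linarith
      then show "h n \<le> 0" using q n unfolding A_def by blast
    qed (auto simp: h_def)
    also have "\<dots> = infsum h UNIV - sum h {..<N}"
    proof -
      have "infsum h ({..<N} \<union> {N..}) = infsum h {..<N} + infsum h {N..}"
        by (rule infsum_Un_disjoint[OF hsm hsm]) auto
      moreover have "{..<N} \<union> {N..} = UNIV" by auto
      ultimately show ?thesis by simp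
    qed
    finally show ?thesis .
  qed
  have "(\<lambda>N. infsum h UNIV - sum h {..<N}) \<longlonglongrightarrow> infsum h UNIV - infsum h UNIV"
    using has_sum_imp_sums[OF has_sum_infsum[OF hsm[of UNIV]]] unfolding sums_def by (intro tendsto_intros)
  then have "(\<lambda>N. infsum f (A N) - 1) \<longlonglongrightarrow> 0"
    by (intro Lim_null_comparison[OF always_eventually[OF allI[OF bound]]]) simp
  then show ?thesis unfolding eq by (simp add: LIM_zero_iff)
qed

lemma exp_zeta_log_series:
  assumes s: "Re s > 1" shows "exp (zeta_log_series s) = riemann_zeta s"
proof -
  have "exp (\<Sum>p<N. prime_log s p) * (\<Prod>p | prime p \<and> p < N. 1 - of_nat p powr (- s)) = 1" for N
  proof -
    have nz: "1 - of_nat p powr (- s) \<noteq> (0::complex)" if "prime p" for p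
      using that prime_powr_lt_1[of p "Re s"] prime_gt_0_nat[of p] s norm_nat_powr[of p "- s"]
      by (metis eq_iff_diff_eq_0 less_irrefl norm_one uminus_complex.simps(1) zero_less_one order.strict_trans)
    have "exp (\<Sum>p<N. prime_log s p) = (\<Prod>p<N. exp (prime_log s p))" by (simp add: exp_sum)
    also have "\<dots> = (\<Prod>p\<in>{..<N} \<inter> {p. prime p}. inverse (1 - of_nat p powr (- s)))"
      unfolding prod.inter_restrict[OF finite_lessThan]
      by (intro prod.cong refl) (use exp_Ln[OF nz] in \<open>auto simp: prime_log_def exp_minus\<close>)
    also have "{..<N} \<inter> {p. prime p} = {p. prime p \<and> p < N}" by auto
    finally show ?thesis using left_inverse[OF nz]
      by (simp add: prod.distrib[symmetric] del: left_inverse right_minus_eq)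
  qed
  then have "riemann_zeta s * (\<Prod>p | prime p \<and> p < N. 1 - of_nat p powr (- s)) * exp (\<Sum>p<N. prime_log s p)
     = riemann_zeta s" for N by (simp add: mult.assoc mult.commute[of "prod _ _"])
  moreover have "(\<lambda>N. riemann_zeta s * (\<Prod>p | prime p \<and> p < N. 1 - of_nat p powr (- s)) * exp (\<Sum>p<N. prime_log s p))
     \<longlonglongrightarrow> 1 * exp (zeta_log_series s)"
    using summable_sums[OF summable_prime_log[OF s]] unfolding sums_def zeta_log_series_def
    by (intro tendsto_mult euler_product_limit tendsto_exp s)
  ultimately show ?thesis by (simp only: mult_1 LIMSEQ_const_iff)
qed

section \<open>The logarithm of zeta under the Riemann hypothesis\<close>

text \<open>The difference is continuous with values in the discrete set of multiples of
  \<open>2 * pi * \<i>\<close>. This fixes the branch of the logarithm of zeta, shows that the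
  continuous argument is unique, and compares the logarithm with a local one near the critical
  line.\<close>

lemma exp_eq_imp_diff_constant:
  fixes f g :: "'a::topological_space \<Rightarrow> complex"
  assumes "connected S" "continuous_on S f" "continuous_on S g"
    and eq: "\<And>x. x \<in> S \<Longrightarrow> exp (f x) = exp (g x)"
  obtains c where "exp c = 1" "\<And>x. x \<in> S \<Longrightarrow> f x = g x + c"
proof (cases "S = {}")
  case True then show ?thesis using that[of 0] by auto
next
  case False
  define h where "h x = f x - g x" for x
  have e: "exp (h x) = 1" if "x \<in> S" for x using eq[OF that] by (simp add: h_def exp_diff)
  have "h constant_on S"
  proof (rule continuous_discrete_range_constant)
    show "continuous_on S h" unfolding h_def using assms by (intro continuous_intros) auto
    fix x assume x: "x \<in> S"
    show "\<exists>e>0. \<forall>y. y \<in> S \<and> h y \<noteq> h x \<longrightarrow> e \<le> norm (h y - h x)"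
    proof (intro exI[of _ "2 * pi"] conjI allI impI)
      fix y assume y: "y \<in> S \<and> h y \<noteq> h x"
      have "exp (h y) = exp (h x)" using e x y by simp
      then obtain n :: int where "h y = h x + of_int (2 * n) * of_real pi * \<i>"
        using exp_eq[of "h y" "h x"] by auto
      then have n: "h y - h x = of_int (2 * n) * of_real pi * \<i>" by simp
      then have "n \<noteq> 0" using y by auto
      then have "1 \<le> \<bar>real_of_int n\<bar>" by linarith
      then show "2 * pi \<le> norm (h y - h x)" unfolding n by (simp add: norm_mult)
    qed auto
  qed (use assms in auto)
  then obtain c where c: "\<And>x. x \<in> S \<Longrightarrow> h x = c" unfolding constant_on_def by blast
  show ?thesis
  proof (rule that[of c])
    show "exp c = 1" using False c e by force
  qed (use c in \<open>auto simp: h_def algebra_simps\<close>)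
qed

text \<open>The map \<open>w / (2 * A' - w)\<close> takes the half-plane \<open>Re w < A'\<close>
  into the unit disc and fixes 0, so the Schwarz lemma applies to its composition with the rescaled
  \<open>f - f c\<close>. Subtracting \<open>f c\<close> raises the real part by at most
  \<open>norm (f c)\<close>, which explains \<open>A'\<close>.\<close>

lemma Borel_Caratheodory:
  assumes hol: "f holomorphic_on ball c R" and Re: "\<And>z. z \<in> ball c R \<Longrightarrow> Re (f z) < A"
    and A: "A > 0" and z: "norm (z - c) < R"
  shows "norm (f z) \<le> norm (f c) + 2 * (A + norm (f c)) * norm (z - c) / (R - norm (z - c))"
proof -
  have R: "R > 0" using z norm_ge_zero[of "z - c"] by linarith
  define A' where "A' = A + norm (f c)"
  have A': "A' > 0" using A by (simp add: A'_def add_pos_nonneg)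
  define g where "g w = f (c + of_real R * w) - f c" for w
  have inb: "c + of_real R * w \<in> ball c R" if "norm w < 1" for w
    using that R by (simp add: dist_norm norm_mult)
  have Reg: "Re (g w) < A'" if "norm w < 1" for w
    using Re[OF inb[OF that]] complex_Re_le_cmod[of "- f c"] unfolding g_def A'_def by simp
  have holg: "g holomorphic_on ball 0 1"
  proof -
    have "(f \<circ> (\<lambda>w. c + of_real R * w)) holomorphic_on ball 0 1"
      by (rule holomorphic_on_compose_gen[OF _ hol]) (auto intro!: holomorphic_intros inb)
    then show ?thesis unfolding g_def o_def by (intro holomorphic_intros) auto
  qed
  have ne: "2 * of_real A' - g w \<noteq> 0" if "norm w < 1" for w
  proof
    assume "2 * of_real A' - g w = 0"
    then have "Re (g w) = 2 * A'" by (metis Re_complex_of_real eq_iff_diff_eq_0 of_real_mult of_real_numeral)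
    then show False using Reg[OF that] A' by simp
  qed
  define \<phi> where "\<phi> w = g w / (2 * of_real A' - g w)" for w
  have lt: "norm (g w) < norm (2 * of_real A' - g w)" if "norm w < 1" for w
  proof -
    have "(norm (2 * of_real A' - g w))\<^sup>2 - (norm (g w))\<^sup>2 = 4 * A' * (A' - Re (g w))"
      by (simp only: cmod_power2) (simp add: power2_eq_square algebra_simps)
    moreover have "4 * A' * (A' - Re (g w)) > 0" using A' Reg[OF that] by simp
    ultimately have "(norm (g w))\<^sup>2 < (norm (2 * of_real A' - g w))\<^sup>2" by linarith
    then show ?thesis by (rule power_less_imp_less_base) auto
  qed
  define w where "w = (z - c) / of_real R"
  have w: "norm w < 1" "c + of_real R * w = z" using z R by (auto simp: w_def norm_divide)
  have "norm (\<phi> w) \<le> norm w"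
  proof (rule Schwarz_Lemma(1))
    show "\<phi> holomorphic_on ball 0 1" unfolding \<phi>_def using holg ne by (auto intro!: holomorphic_intros)
    show "\<phi> 0 = 0" by (simp add: \<phi>_def g_def)
    show "norm (\<phi> v) < 1" if "norm v < 1" for v
      using lt[OF that] ne[OF that] unfolding \<phi>_def by (simp add: norm_divide divide_less_eq_1)
  qed (use w in auto)
  then have "norm (g w) \<le> norm w * norm (2 * of_real A' - g w)"
    using ne[OF w(1)] unfolding \<phi>_def by (simp add: norm_divide divide_le_eq)
  also have "\<dots> \<le> norm w * (2 * A' + norm (g w))"
    using norm_triangle_ineq4[of "2 * of_real A'" "g w"] A' by (intro mult_left_mono) (auto simp: norm_mult)
  finally have "norm (g w) * (1 - norm w) \<le> 2 * A' * norm w" by (simp add: algebra_simps)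
  then have "norm (g w) \<le> 2 * A' * norm w / (1 - norm w)" using w by (simp add: le_divide_eq)
  also have "\<dots> = 2 * A' * norm (z - c) / (R - norm (z - c))"
    using R z by (simp add: w_def norm_divide field_simps)
  finally have "norm (f z - f c) \<le> 2 * A' * norm (z - c) / (R - norm (z - c))"
    unfolding g_def w(2) .
  then show ?thesis using norm_triangle_sub[of "f z" "f c"] unfolding A'_def by simp
qed

text \<open>Only large positive heights matter. The condition \<open>Im s > 0\<close> keeps the pole
  outside while the region stays convex, so a logarithm exists without cuts.\<close>

abbreviation quarter_plane :: "complex set" where
  "quarter_plane \<equiv> {s. Re s > 1/2 \<and> Im s > 0}"

lemma quarter_plane: "open quarter_plane" "convex quarter_plane"
proof -
  have "quarter_plane = {s. Re s > 1/2} \<inter> {s. Im s > 0}" by auto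
  then show "open quarter_plane" "convex quarter_plane"
    using open_Int[OF open_halfspace_Re_gt open_halfspace_Im_gt]
      convex_Int[OF convex_halfspace_Re_gt convex_halfspace_Im_gt] by (simp_all only:)
qed

lemma riemann_zeta_nonzero:
  assumes "riemann_hypothesis" "Im s \<noteq> 0" "Re s \<noteq> 1/2"
  shows "riemann_zeta s \<noteq> 0"
proof
  assume "riemann_zeta s = 0"
  then have "zeta_zero s" using assms by (auto simp: zeta_zero_def)
  moreover have "\<not> trivial_zeta_zero s" using assms by (auto simp: trivial_zeta_zero_def)
  ultimately show False using assms by (auto simp: riemann_hypothesis_def)
qed

text \<open>The exponential determines the logarithm only up to multiples of
  \<open>2 * pi * \<i>\<close>; agreement with the prime series selects the branch that vanishes at
  \<sigma> = +\<infinity>, as the definition of the argument demands.\<close>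

definition zeta_log :: "complex \<Rightarrow> complex" where
  "zeta_log = (SOME L. L holomorphic_on quarter_plane \<and> (\<forall>s\<in>quarter_plane. exp (L s) = riemann_zeta s)
     \<and> (\<forall>s. Re s > 1 \<and> Im s > 0 \<longrightarrow> L s = zeta_log_series s))"

lemma zeta_log:
  assumes "riemann_hypothesis"
  shows "zeta_log holomorphic_on quarter_plane"
    and "\<And>s. Re s > 1/2 \<Longrightarrow> Im s > 0 \<Longrightarrow> exp (zeta_log s) = riemann_zeta s"
    and "\<And>s. Re s > 1 \<Longrightarrow> Im s > 0 \<Longrightarrow> zeta_log s = zeta_log_series s"
proof -
  have "\<exists>L. L holomorphic_on quarter_plane \<and> (\<forall>s\<in>quarter_plane. exp (L s) = riemann_zeta s)
     \<and> (\<forall>s. Re s > 1 \<and> Im s > 0 \<longrightarrow> L s = zeta_log_series s)"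
  proof -
    have 1: "riemann_zeta holomorphic_on quarter_plane"
      by (rule holomorphic_on_subset[OF riemann_zeta_holomorphic]) auto
    have 2: "contractible quarter_plane" using quarter_plane(2) by (rule convex_imp_contractible)
    have 3: "riemann_zeta s \<noteq> 0" if "s \<in> quarter_plane" for s
      using that assms by (intro riemann_zeta_nonzero) auto
    obtain L where L: "L holomorphic_on quarter_plane"
        "\<And>s. s \<in> quarter_plane \<Longrightarrow> riemann_zeta s = exp (L s)"
      using contractible_imp_holomorphic_log[OF 1 2 3] by blast
    let ?S = "{s. Re s > 1} \<inter> {s. Im s > 0}"
    have "connected ?S"
      by (intro convex_connected convex_Int convex_halfspace_Re_gt convex_halfspace_Im_gt)
    moreover have "continuous_on ?S L"
      using L(1) by (intro holomorphic_on_imp_continuous_on) (auto intro: holomorphic_on_subset)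
    moreover have "continuous_on ?S zeta_log_series"
      using zeta_log_series_holomorphic
      by (intro holomorphic_on_imp_continuous_on) (auto intro: holomorphic_on_subset)
    moreover have "exp (L s) = exp (zeta_log_series s)" if "s \<in> ?S" for s
      using that exp_zeta_log_series[of s] L(2)[of s] by auto
    ultimately obtain c where c: "exp c = 1" "\<And>s. s \<in> ?S \<Longrightarrow> L s = zeta_log_series s + c"
      by (rule exp_eq_imp_diff_constant) blast+
    show ?thesis
    proof (intro exI[of _ "\<lambda>s. L s - c"] conjI ballI allI impI)
      show "(\<lambda>s. L s - c) holomorphic_on quarter_plane" by (intro holomorphic_intros L)
    qed (use c L(2) in \<open>auto simp: exp_diff\<close>)
  qed
  from someI_ex[OF this]
  show "zeta_log holomorphic_on quarter_plane"
    and "\<And>s. Re s > 1/2 \<Longrightarrow> Im s > 0 \<Longrightarrow> exp (zeta_log s) = riemann_zeta s"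
    and "\<And>s. Re s > 1 \<Longrightarrow> Im s > 0 \<Longrightarrow> zeta_log s = zeta_log_series s"
    unfolding zeta_log_def[symmetric] by auto
qed

text \<open>The real part of the logarithm is \<open>ln\<close> of the modulus of zeta, hence at
  most \<open>ln\<close> of a linear function of the height. The disc about \<open>2 + \<i>t\<close>
  of radius 3/2 touches the critical line, so the denominator \<open>R - norm (z - c)\<close> of
  Borel-Caratheodory is exactly \<open>Re s - 1/2\<close>. To the right of 3/2 the prime series is
  bounded, and \<open>B\<close> controls the factor \<open>Re s - 1/2\<close>.\<close>

lemma norm_zeta_log_le:
  assumes RH: "riemann_hypothesis"
  obtains C where "C > 0"
    "\<And>s. 1/2 < Re s \<Longrightarrow> Re s \<le> B \<Longrightarrow> Im s \<ge> 3 \<Longrightarrow> norm (zeta_log s) * (Re s - 1/2) \<le> C * ln (Im s)"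
proof -
  obtain C0 where C0: "C0 > 0"
    "\<And>s. Re s \<ge> 1/2 \<Longrightarrow> norm (s - 1) \<ge> 1 \<Longrightarrow> norm (riemann_zeta s) \<le> 1 + C0 * norm s"
    using norm_riemann_zeta_le by blast
  define C1 where "C1 = ln (zeta_N 0 (3/2))"
  have C1: "C1 \<ge> 0" unfolding C1_def by (rule ln_zeta_N_nonneg) simp
  have far: "norm (zeta_log s) \<le> C1" if "Re s \<ge> 3/2" "Im s > 0" for s
    using norm_zeta_log_series_le[of "3/2" s] zeta_log(3)[OF RH, of s] that by (simp add: C1_def)
  have lnge1: "ln t \<ge> 1" if "t \<ge> 3" for t :: real
    using that exp_le by (subst ln_ge_iff) auto
  define C2 where "C2 = ln (2 + 3 * C0) + 1"
  have C2: "C2 > 0" unfolding C2_def using C0 by (simp add: add_nonneg_pos)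
  define C where "C = C1 * (\<bar>B\<bar> + 2) + 3 * (C2 + C1)"
  have "C > 0" unfolding C_def using C1 C2 by (simp add: add_nonneg_pos)
  moreover have "norm (zeta_log s) * (Re s - 1/2) \<le> C * ln (Im s)"
    if s: "1/2 < Re s" "Re s \<le> B" "Im s \<ge> 3" for s
  proof (cases "Re s \<ge> 3/2")
    case True
    have "norm (zeta_log s) * (Re s - 1/2) \<le> C1 * (\<bar>B\<bar> + 2)"
      using s True by (intro mult_mono far C1) auto
    also have "\<dots> \<le> C" unfolding C_def using C1 C2 by simp
    also have "\<dots> \<le> C * ln (Im s)" using \<open>C > 0\<close> lnge1[OF s(3)] by simp
    finally show ?thesis .
  next
    case False
    define t where "t = Im s"
    define c where "c = Complex 2 t"
    have t: "t \<ge> 3" using s by (simp add: t_def)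
    have sc: "s - c = of_real (Re s - 2)" by (simp add: complex_eq_iff c_def t_def)
    have nsc: "norm (s - c) = 2 - Re s" unfolding sc norm_of_real using False by simp
    \<comment> \<open>On the disc \<open>norm z < t + 4\<close>, so \<open>exp A\<close> exceeds the
      bound for zeta there.\<close>
    define A where "A = ln (2 + C0 * (t + 4))"
    have A2: "A \<le> C2 * ln t"
    proof -
      have "2 + C0 * (t + 4) \<le> 2 * t + C0 * (3 * t)" using t C0 by (intro add_mono mult_left_mono) auto
      then have "2 + C0 * (t + 4) \<le> (2 + 3 * C0) * t" by (simp add: algebra_simps)
      then have "A \<le> ln ((2 + 3 * C0) * t)" unfolding A_def using t C0 by (subst ln_le_cancel_iff) (auto intro: add_pos_pos)
      also have "\<dots> = ln (2 + 3 * C0) + ln t" using t C0 by (intro ln_mult_pos) (auto intro: add_pos_pos)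
      also have "\<dots> \<le> ln (2 + 3 * C0) * ln t + ln t"
        using lnge1[OF t] C0 by (simp add: mult_le_cancel_left1 )
      finally show ?thesis unfolding C2_def by (simp add: algebra_simps)
    qed
    have "A > 0" unfolding A_def using C0 t by (intro ln_gt_zero) (simp add: add_strict_increasing)
    have inb: "Re z > 1/2 \<and> Im z > 3/2 \<and> norm z < t + 4" if z: "z \<in> ball c (3/2)" for z
    proof -
      have "\<bar>Re (c - z)\<bar> < 3/2" "\<bar>Im (c - z)\<bar> < 3/2"
        using z abs_Re_le_cmod[of "c - z"] abs_Im_le_cmod[of "c - z"] by (auto simp: dist_norm)
      then have "Re z > 1/2" "Im z > 3/2" "\<bar>Re z\<bar> + \<bar>Im z\<bar> < 7/2 + (t + 3/2)"
        using t by (auto simp: c_def abs_if split: if_splits)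
      moreover have "norm c \<le> 2 + t" using cmod_le[of c] t by (simp add: c_def)
      moreover have "norm z \<le> norm c + norm (c - z)" using norm_triangle_sub[of z c] by (simp add: norm_minus_commute)
      ultimately show ?thesis using z by (auto simp: dist_norm)
    qed
    have "norm (zeta_log s) \<le> norm (zeta_log c) + 2 * (A + norm (zeta_log c)) * norm (s - c) / (3/2 - norm (s - c))"
    proof (rule Borel_Caratheodory)
      show "zeta_log holomorphic_on ball c (3/2)"
        using inb by (intro holomorphic_on_subset[OF zeta_log(1)[OF RH]]) force
      show "Re (zeta_log z) < A" if z: "z \<in> ball c (3/2)" for z
      proof -
        have "exp (Re (zeta_log z)) = norm (riemann_zeta z)"
          using zeta_log(2)[OF RH, of z] inb[OF z] by (metis norm_exp_eq_Re less_trans zero_less_divide_iff zero_less_numeral)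
        also have "\<dots> \<le> 1 + C0 * norm z"
          using inb[OF z] abs_Im_le_cmod[of "z - 1"] by (intro C0) auto
        also have "\<dots> < 2 + C0 * (t + 4)" using inb[OF z] C0
          by (intro add_strict_mono mult_strict_left_mono) auto
        also have "\<dots> = exp A" unfolding A_def using t C0 by (subst exp_ln) (auto intro: add_pos_pos)
        finally show ?thesis by simp
      qed
      show "norm (s - c) < 3/2" using nsc s by simp
    qed fact
    then have "norm (zeta_log s) \<le> norm (zeta_log c) + 2 * (A + norm (zeta_log c)) * (2 - Re s) / (Re s - 1/2)"
      unfolding nsc by (simp add: algebra_simps)
    then have "norm (zeta_log s) * (Re s - 1/2) \<le> (norm (zeta_log c) + 2 * (A + norm (zeta_log c)) * (2 - Re s) / (Re s - 1/2)) * (Re s - 1/2)"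
      using s by (intro mult_right_mono) auto
    also have "\<dots> = norm (zeta_log c) * (Re s - 1/2) + 2 * (A + norm (zeta_log c)) * (2 - Re s)"
    proof -
      have "(x + y / d) * d = x * d + y" if "d \<noteq> 0" for x y d :: real
        using that by (simp add: field_simps)
      then show ?thesis using s by (simp only:)
    qed
    also have "\<dots> \<le> C1 * (\<bar>B\<bar> + 2) + 2 * (C2 * ln t + C1) * (3/2)"
      using s t A2 C1 False \<open>A > 0\<close> far[of c] by (intro add_mono mult_mono mult_left_mono) (auto simp: c_def)
    also have "\<dots> \<le> C1 * (\<bar>B\<bar> + 2) * ln t + 2 * (C2 * ln t + C1 * ln t) * (3/2)"
    proof -
      have "C1 * (\<bar>B\<bar> + 2) * 1 \<le> C1 * (\<bar>B\<bar> + 2) * ln t" "C1 * 1 \<le> C1 * ln t"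
        using lnge1[OF t] C1 by (intro mult_left_mono; simp)+
      then show ?thesis by (simp only: mult_1_right) argo
    qed
    also have "\<dots> = C * ln t" by (simp add: C_def algebra_simps)
    finally show ?thesis by (simp add: t_def)
  qed
  ultimately show ?thesis using that by blast
qed

section \<open>Boundary values of the argument\<close>

text \<open>Every prime is at least 2, so each term gains \<open>2 powr (- (x - 2))\<close> over the
  summable weight \<open>p powr (- 2)\<close>. The limit provides the normalisation of the argument
  at +\<infinity>.\<close>

lemma ln_zeta_N_0_tendsto_0: "((\<lambda>x. ln (zeta_N 0 x)) \<longlongrightarrow> 0) at_top"
proof -
  define C where "C = (\<Sum>p. 2 * real p powr (- 2))"
  have sm: "summable (\<lambda>p. 2 * real p powr (- 2))"
    by (intro summable_mult) (simp add: summable_real_powr_iff)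
  have le: "ln (zeta_N 0 x) \<le> C * 2 powr (- (x - 2))" if x: "x \<ge> 2" for x
  proof -
    have "ln (zeta_N 0 x) \<le> (\<Sum>p. 2 * real p powr (- 2) * 2 powr (- (x - 2)))"
      unfolding zeta_N_eq(1)[of x 0, OF less_le_trans[OF _ x], simplified]
    proof (rule suminf_le)
      fix p :: nat
      show "(if 0 < p then prime_ln x p else 0) \<le> 2 * real p powr (- 2) * 2 powr (- (x - 2))"
      proof (cases "prime p")
        case True
        have "prime_ln x p \<le> 2 * real p powr (- x)" using x by (intro prime_ln_le) auto
        also have "real p powr (- x) = real p powr (- 2) * real p powr (- (x - 2))"
          by (simp flip: powr_add)
        also have "2 * \<dots> \<le> 2 * (real p powr (- 2) * 2 powr (- (x - 2)))"
          using x True prime_ge_2_nat by (intro mult_left_mono nat_powr_le_half_powr) auto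
        finally show ?thesis by simp
      qed (auto simp: prime_ln_def)
      show "summable (\<lambda>p. if 0 < p then prime_ln x p else 0)" using x by (intro zeta_N_eq) auto
      show "summable (\<lambda>p. 2 * real p powr (- 2) * 2 powr (- (x - 2)))"
        using sm by (rule summable_mult2)
    qed
    also have "\<dots> = C * 2 powr (- (x - 2))" unfolding C_def using suminf_mult2[OF sm] by simp
    finally show ?thesis .
  qed
  have lim: "((\<lambda>x. C * 2 powr (- (x - 2))) \<longlongrightarrow> 0) at_top" by real_asymp
  show ?thesis
  proof (rule tendsto_sandwich[OF _ _ tendsto_const lim])
    show "\<forall>\<^sub>F x in at_top. 0 \<le> ln (zeta_N 0 x)"
      using eventually_gt_at_top[of "1::real"] by eventually_elim (rule ln_zeta_N_nonneg)
    show "\<forall>\<^sub>F x in at_top. ln (zeta_N 0 x) \<le> C * 2 powr (- (x - 2))"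
      using eventually_ge_at_top[of "2::real"] by eventually_elim (rule le)
  qed
qed

text \<open>The definite description calls for existence and uniqueness. The imaginary part of
  \<open>zeta_log\<close>, extended by its limit at 1/2, is one continuous argument; two arguments
  of a nonvanishing function differ by a constant, and that constant is 0 because both tend to
  0.\<close>

lemma zeta_arg_half_eq:
  assumes RH: "riemann_hypothesis" and t: "t > 0" and nz: "riemann_zeta (Complex (1/2) t) \<noteq> 0"
    and lim: "((\<lambda>\<sigma>. Im (zeta_log (Complex \<sigma> t))) \<longlongrightarrow> y) (at_right (1/2))"
  shows "zeta_arg_half t = y"
proof -
  define \<phi> where "\<phi> = (\<lambda>\<sigma>. if \<sigma> \<le> 1/2 then y else Im (zeta_log (Complex \<sigma> t)))"
  have nz': "riemann_zeta (Complex \<sigma> t) \<noteq> 0" for \<sigma>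
  proof (cases "\<sigma> = 1/2")
    case True then show ?thesis using nz by blast
  next
    case False then show ?thesis using riemann_zeta_nonzero[OF RH, of "Complex \<sigma> t"] t by auto
  qed
  have contL: "isCont (\<lambda>\<sigma>. Im (zeta_log (Complex \<sigma> t))) \<sigma>" if "\<sigma> > 1/2" for \<sigma>
  proof -
    have "isCont zeta_log (Complex \<sigma> t)"
      using zeta_log(1)[OF RH] that t quarter_plane(1)
      by (metis (mono_tags, lifting) complex.sel continuous_on_eq_continuous_at holomorphic_on_imp_continuous_on mem_Collect_eq)
    moreover have "isCont (\<lambda>\<sigma>. Complex \<sigma> t) \<sigma>"
      unfolding Complex_eq by (intro continuous_intros)
    ultimately have "isCont (\<lambda>\<sigma>. zeta_log (Complex \<sigma> t)) \<sigma>" by (intro isCont_o2[of \<sigma> _ zeta_log])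
    then show ?thesis by (rule continuous_Im)
  qed
  have lim\<phi>: "(\<phi> \<longlongrightarrow> y) (at_right (1/2))"
    using lim by (rule Lim_transform_eventually)
       (auto simp: \<phi>_def eventually_at_right_field intro!: exI[of _ "1"])
  have cont: "continuous_on {1/2..} \<phi>"
    unfolding continuous_on_def
  proof
    fix \<sigma> :: real assume s: "\<sigma> \<in> {1/2..}"
    show "(\<phi> \<longlongrightarrow> \<phi> \<sigma>) (at \<sigma> within {1/2..})"
    proof (cases "\<sigma> = 1/2")
      case True
      have "\<phi> (1/2) = y" by (simp add: \<phi>_def)
      then show ?thesis using lim\<phi> unfolding True by (simp only: at_within_Ici_at_right)
    next
      case False
      then have s2: "\<sigma> > 1/2" using s by simp
      have "((\<lambda>\<sigma>. Im (zeta_log (Complex \<sigma> t))) \<longlongrightarrow> \<phi> \<sigma>) (at \<sigma>)"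
        using contL[OF s2] s2 by (simp add: isCont_def \<phi>_def)
      then have "(\<phi> \<longlongrightarrow> \<phi> \<sigma>) (at \<sigma>)"
      proof (rule Lim_transform_eventually)
        have "eventually (\<lambda>x. x > 1/2) (at \<sigma>)" using order_tendstoD(1)[OF tendsto_ident_at s2] .
        then show "\<forall>\<^sub>F x in at \<sigma>. Im (zeta_log (Complex x t)) = \<phi> x"
          by eventually_elim (auto simp: \<phi>_def)
      qed
      then show ?thesis by (rule tendsto_within_subset) auto
    qed
  qed
  have arg1: "is_Arg (riemann_zeta (Complex \<sigma> t)) (\<phi> \<sigma>)" if "\<sigma> > 1/2" for \<sigma>
  proof -
    have "riemann_zeta (Complex \<sigma> t) = exp (zeta_log (Complex \<sigma> t))"
      using zeta_log(2)[OF RH, of "Complex \<sigma> t"] that t by simp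
    then show ?thesis using that is_Arg_exp_Im[of "zeta_log (Complex \<sigma> t)"]
      unfolding \<phi>_def by simp
  qed
  \<comment> \<open>At the endpoint \<open>zeta_log\<close> is not controlled; the polar form
    survives the limit by continuity of zeta.\<close>
  have arg2: "is_Arg (riemann_zeta (Complex (1/2) t)) (\<phi> (1/2))"
  proof -
    have c: "((\<lambda>\<sigma>. riemann_zeta (Complex \<sigma> t)) \<longlongrightarrow> riemann_zeta (Complex (1/2) t)) (at_right (1/2))"
    proof -
      have "isCont riemann_zeta (Complex (1/2) t)"
        using holomorphic_on_imp_continuous_on[OF riemann_zeta_holomorphic] t
          continuous_on_eq_continuous_at[of "- {1}" riemann_zeta]
        by (auto simp: complex_eq_iff open_Compl)
      moreover have "((\<lambda>\<sigma>. Complex \<sigma> t) \<longlongrightarrow> Complex (1/2) t) (at_right (1/2))"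
        unfolding Complex_eq by (intro tendsto_intros)
      ultimately show ?thesis by (rule isCont_tendsto_compose)
    qed
    have "((\<lambda>\<sigma>. of_real (norm (riemann_zeta (Complex \<sigma> t))) * exp (\<i> * of_real (\<phi> \<sigma>))) \<longlongrightarrow>
        of_real (norm (riemann_zeta (Complex (1/2) t))) * exp (\<i> * of_real y)) (at_right (1/2))"
      by (intro tendsto_intros c lim\<phi>)
    moreover have "((\<lambda>\<sigma>. of_real (norm (riemann_zeta (Complex \<sigma> t))) * exp (\<i> * of_real (\<phi> \<sigma>))) \<longlongrightarrow>
        riemann_zeta (Complex (1/2) t)) (at_right (1/2))"
      using c
    proof (rule Lim_transform_eventually)
      show "\<forall>\<^sub>F x in at_right (1/2). riemann_zeta (Complex x t) =
          of_real (norm (riemann_zeta (Complex x t))) * exp (\<i> * of_real (\<phi> x))"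
        using arg1 unfolding is_Arg_def eventually_at_right_field by (intro exI[of _ 1]) auto
    qed
    ultimately have "riemann_zeta (Complex (1/2) t) = of_real (norm (riemann_zeta (Complex (1/2) t))) * exp (\<i> * of_real y)"
      using tendsto_unique trivial_limit_at_right_real by blast
    then show ?thesis unfolding is_Arg_def \<phi>_def by simp
  qed
  have arg: "is_Arg (riemann_zeta (Complex \<sigma> t)) (\<phi> \<sigma>)" if "\<sigma> \<ge> 1/2" for \<sigma>
    using arg1[of \<sigma>] arg2 that by (cases "\<sigma> > 1/2") (blast, metis antisym not_le)
  have lim0: "(\<phi> \<longlongrightarrow> 0) at_top"
  proof (rule Lim_null_comparison[OF _ ln_zeta_N_0_tendsto_0])
    show "\<forall>\<^sub>F x in at_top. norm (\<phi> x) \<le> ln (zeta_N 0 x)"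
      using eventually_gt_at_top[of "1::real"]
    proof eventually_elim
      fix x :: real assume x: "x > 1"
      have "norm (\<phi> x) \<le> norm (zeta_log (Complex x t))" using x by (simp add: \<phi>_def abs_Im_le_cmod)
      also have "\<dots> \<le> ln (zeta_N 0 x)"
        using x t zeta_log(3)[OF RH, of "Complex x t"] norm_zeta_log_series_le[of x "Complex x t"] by simp
      finally show "norm (\<phi> x) \<le> ln (zeta_N 0 x)" .
    qed
  qed
  have uniq: "\<psi> (1/2) = y" if \<psi>: "continuous_on {1/2..} \<psi>" "\<forall>\<sigma>\<ge>1/2. is_Arg (riemann_zeta (Complex \<sigma> t)) (\<psi> \<sigma>)"
      "(\<psi> \<longlongrightarrow> 0) at_top" for \<psi>
  proof -
    obtain c where c: "exp c = 1" "\<And>\<sigma>. \<sigma> \<in> {1/2..} \<Longrightarrow> \<i> * of_real (\<psi> \<sigma>) = \<i> * of_real (\<phi> \<sigma>) + c"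
    proof (rule exp_eq_imp_diff_constant[of "{1/2..}" "\<lambda>\<sigma>. \<i> * of_real (\<psi> \<sigma>)" "\<lambda>\<sigma>. \<i> * of_real (\<phi> \<sigma>)"])
      fix \<sigma> :: real assume "\<sigma> \<in> {1/2..}"
      then have "of_real (norm (riemann_zeta (Complex \<sigma> t))) * exp (\<i> * of_real (\<psi> \<sigma>)) =
        of_real (norm (riemann_zeta (Complex \<sigma> t))) * exp (\<i> * of_real (\<phi> \<sigma>))"
        using arg \<psi>(2) unfolding is_Arg_def by (metis atLeast_iff)
      then show "exp (\<i> * of_real (\<psi> \<sigma>)) = exp (\<i> * of_real (\<phi> \<sigma>))" using nz'[of \<sigma>] by simp
    qed (use \<psi>(1) cont in \<open>auto intro!: continuous_intros\<close>)
    have "((\<lambda>\<sigma>. \<i> * of_real (\<psi> \<sigma>) - \<i> * of_real (\<phi> \<sigma>)) \<longlongrightarrow> \<i> * of_real 0 - \<i> * of_real 0) at_top"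
      by (intro tendsto_intros \<psi> lim0)
    then have "((\<lambda>\<sigma>. \<i> * of_real (\<psi> \<sigma>) - \<i> * of_real (\<phi> \<sigma>)) \<longlongrightarrow> 0) at_top" by simp
    moreover have "((\<lambda>\<sigma>. \<i> * of_real (\<psi> \<sigma>) - \<i> * of_real (\<phi> \<sigma>)) \<longlongrightarrow> c) at_top"
    proof (rule Lim_transform_eventually[OF tendsto_const])
      show "\<forall>\<^sub>F \<sigma> in at_top. c = \<i> * of_real (\<psi> \<sigma>) - \<i> * of_real (\<phi> \<sigma>)"
        using eventually_ge_at_top[of "1/2::real"] by eventually_elim (simp add: c)
    qed
    ultimately have "c = 0" using tendsto_unique trivial_limit_at_top_linorder by blast
    then have "\<psi> (1/2) = \<phi> (1/2)" using c(2)[of "1/2"] by simp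
    then show ?thesis by (simp add: \<phi>_def)
  qed
  show ?thesis unfolding zeta_arg_half_def
  proof (rule the_equality)
    show "\<exists>\<phi>. continuous_on {1/2..} \<phi> \<and> (\<forall>\<sigma>\<ge>1/2. is_Arg (riemann_zeta (Complex \<sigma> t)) (\<phi> \<sigma>)) \<and>
        (\<phi> \<longlongrightarrow> 0) at_top \<and> y = \<phi> (1/2)"
      using cont arg lim0 by (intro exI[of _ \<phi>]) (auto simp: \<phi>_def)
  qed (use uniq in blast)
qed

lemma not_zeta_ordinate:
  assumes "riemann_hypothesis" "t > 0" "riemann_zeta (Complex (1/2) t) \<noteq> 0"
  shows "\<not> zeta_ordinate t"
proof
  assume "zeta_ordinate t"
  then obtain s where s: "riemann_zeta s = 0" "Im s = t" by (auto simp: zeta_ordinate_def zeta_zero_def)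
  then have "Re s = 1/2" using riemann_zeta_nonzero[OF assms(1), of s] assms(2) by auto
  then have "s = Complex (1/2) t" using s by (simp add: complex_eq_iff)
  then show False using s assms by simp
qed

text \<open>Approaching a zero \<open>1/2 + \<i>t\<^sub>0\<close> from the right, the argument of \<open>\<zeta>\<close> stays below its limit
  along the critical line from above and above its limit from below, as \<open>Arg (s - \<rho>)\<close> lies between
  \<open>-\<pi>/2\<close> and \<open>\<pi>/2\<close>.\<close>

lemma zeta_S_near_limit_point:
  fixes e :: real
  assumes RH: "riemann_hypothesis" and e: "e = 1 \<or> e = - 1" and t0: "t0 > 0" and \<eta>: "\<eta> > 0"
    and s: "s \<longlonglongrightarrow> Complex (1/2) t0" "\<And>n. Re (s n) > 1/2" "\<And>n. e * Im (zeta_log (s n)) \<ge> X"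
  shows "\<exists>t. \<bar>t - t0\<bar> < \<eta> \<and> e * zeta_S t \<ge> (X - \<eta>) / pi"
proof -
  define \<rho> where "\<rho> = Complex (1/2) t0"
  let ?S = "{s. Im s > 0}"
  have hol: "riemann_zeta holomorphic_on ?S"
    by (rule holomorphic_on_subset[OF riemann_zeta_holomorphic]) auto
  have nc: "\<exists>w\<in>?S. riemann_zeta w \<noteq> 0"
    using riemann_zeta_nonzero[OF RH, of "Complex 2 1"] by (intro bexI[of _ "Complex 2 1"]) auto
  have "open ?S" "connected ?S" "\<rho> \<in> ?S"
    using t0 by (auto simp: open_halfspace_Im_gt convex_connected convex_halfspace_Im_gt \<rho>_def)
  from zorder_exist_zero[OF hol this nc]
  \<comment> \<open>The order \<open>m\<close> may be 0: the limit point need not be a zero.\<close>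
  obtain g r m where r: "r > 0" "cball \<rho> r \<subseteq> ?S" "g holomorphic_on cball \<rho> r"
      and g: "\<And>w. w \<in> cball \<rho> r \<Longrightarrow> riemann_zeta w = g w * (w - \<rho>) ^ m \<and> g w \<noteq> 0"
    by blast
  obtain G where G: "G holomorphic_on cball \<rho> r" "\<And>w. w \<in> cball \<rho> r \<Longrightarrow> g w = exp (G w)"
    using contractible_imp_holomorphic_log[OF r(3) convex_imp_contractible[OF convex_cball]] g by metis
  have contG: "continuous_on (cball \<rho> r) G" using G(1) holomorphic_on_imp_continuous_on by blast
  have iG: "isCont G z" if "z \<in> ball \<rho> r" for z
    using continuous_on_subset[OF contG ball_subset_cball] that by (simp add: continuous_on_eq_continuous_at)
  let ?H = "ball \<rho> r \<inter> {s. Re s > 1/2}"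
  have nl: "w - \<rho> \<notin> \<real>\<^sub>\<le>\<^sub>0" if "w \<in> ?H" for w
    using that by (auto simp: complex_nonpos_Reals_iff \<rho>_def)
  obtain c where c: "\<And>w. w \<in> ?H \<Longrightarrow> zeta_log w = (of_nat m * Ln (w - \<rho>) + G w) + c"
  proof (rule exp_eq_imp_diff_constant[of ?H zeta_log "\<lambda>w. of_nat m * Ln (w - \<rho>) + G w"])
    show "connected ?H" by (intro convex_connected convex_Int convex_ball convex_halfspace_Re_gt)
    have "?H \<subseteq> quarter_plane" using subset_trans[OF ball_subset_cball r(2)] by blast
    then show "continuous_on ?H zeta_log"
      using zeta_log(1)[OF RH] holomorphic_on_imp_continuous_on continuous_on_subset by blast
    show "continuous_on ?H (\<lambda>w. of_nat m * Ln (w - \<rho>) + G w)"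
      using nl continuous_on_subset[OF contG, of ?H] ball_subset_cball by (intro continuous_intros) blast+
    fix w assume w: "w \<in> ?H"
    have ne: "w - \<rho> \<noteq> 0" using nl[OF w] by auto
    have "w \<in> cball \<rho> r" using w by auto
    moreover from this have "Im w > 0" using r(2) by blast
    ultimately have "exp (zeta_log w) = exp (G w) * (w - \<rho>) ^ m"
      using zeta_log(2)[OF RH, of w] g G(2) w by auto
    also have "(w - \<rho>) ^ m = exp (of_nat m * Ln (w - \<rho>))" using ne by (simp add: exp_of_nat_mult)
    finally show "exp (zeta_log w) = exp (of_nat m * Ln (w - \<rho>) + G w)" by (simp add: exp_add mult.commute)
  qed blast
  have eabs: "\<bar>e\<bar> = 1" "e * e = 1" using e by auto
  \<comment> \<open>In the right half-plane the angle of \<open>w - \<rho>\<close> stays below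
    \<pi>/2 in modulus, so \<open>Y\<close> bounds every limit of \<open>e * Im (zeta_log w)\<close>
    as \<open>w\<close> tends to \<rho> from there.\<close>
  define Y where "Y = real m * (pi / 2) + e * Im (G \<rho>) + e * Im c"
  have XY: "X \<le> Y"
  proof (rule tendsto_lowerbound)
    show "((\<lambda>n. real m * (pi / 2) + e * Im (G (s n)) + e * Im c) \<longlonglongrightarrow> Y)"
      unfolding Y_def using s(1) r(1)
      by (intro tendsto_intros isCont_tendsto_compose[OF iG]) (auto simp: \<rho>_def)
    have "\<forall>\<^sub>F n in sequentially. s n \<in> ball \<rho> r"
      using s(1) r(1) unfolding \<rho>_def[symmetric] by (intro topological_tendstoD) auto
    then show "\<forall>\<^sub>F n in sequentially. X \<le> real m * (pi / 2) + e * Im (G (s n)) + e * Im c"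
    proof eventually_elim
      case (elim n)
      then have h: "s n \<in> ?H" using s(2) by auto
      have "\<bar>Im (Ln (s n - \<rho>))\<bar> < pi / 2"
      proof -
        have "0 < Re (s n - \<rho>)" using s(2)[of n] by (simp add: \<rho>_def)
        moreover from this have "s n - \<rho> \<noteq> 0" by auto
        ultimately show ?thesis using Re_Ln_pos_lt[of "s n - \<rho>"] by blast
      qed
      then have "e * Im (Ln (s n - \<rho>)) \<le> pi / 2" using e by auto
      then have "real m * (e * Im (Ln (s n - \<rho>))) \<le> real m * (pi / 2)" by (intro mult_left_mono) auto
      moreover have "e * Im (zeta_log (s n)) = real m * (e * Im (Ln (s n - \<rho>))) + e * Im (G (s n)) + e * Im c"
        unfolding c[OF h] by (simp add: algebra_simps)
      ultimately show ?case using s(3)[of n] by linarith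
    qed
  qed auto
  have "\<forall>\<^sub>F w in nhds \<rho>. norm (G w - G \<rho>) < \<eta>"
    using iG[of \<rho>] r(1) \<eta> unfolding isCont_def tendsto_iff dist_norm eventually_at_filter
    by (auto elim!: eventually_mono)
  then obtain d where d: "d > 0" "\<And>w. dist w \<rho> < d \<Longrightarrow> norm (G w - G \<rho>) < \<eta>"
    unfolding eventually_nhds_metric by blast
  define h where "h = min (min (r / 2) (d / 2)) (\<eta> / 2)"
  have h: "h > 0" "h < r" "h < d" "h < \<eta>" using r d \<eta> by (auto simp: h_def)
  \<comment> \<open>The step along the critical line goes up for \<open>e = 1\<close> and down for
    \<open>e = - 1\<close>; either way \<open>e\<close> times the angle of \<open>z - \<rho>\<close>
    is exactly \<pi>/2, so \<open>Y\<close> is reached up to \<eta>.\<close>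
  define t where "t = t0 + e * h"
  define z where "z = Complex (1/2) t"
  have zr: "z - \<rho> = \<i> * of_real (e * h)" by (simp add: z_def \<rho>_def t_def complex_eq_iff)
  have dz: "dist z \<rho> = h" unfolding dist_norm zr using h eabs by (simp add: norm_mult abs_mult)
  have zb: "z \<in> ball \<rho> r" using dz h by (simp add: dist_commute)
  then have "z \<in> ?S" using r(2) ball_subset_cball by blast
  then have tpos: "t > 0" by (simp add: z_def)
  have ehn: "e * h \<noteq> 0" using e h by auto
  have nz: "riemann_zeta z \<noteq> 0" using g[of z] zb ehn zr by auto
  have lim: "((\<lambda>\<sigma>. Im (zeta_log (Complex \<sigma> t))) \<longlongrightarrow> real m * Im (Ln (z - \<rho>)) + Im (G z) + Im c) (at_right (1/2))"
  proof -
    have a: "((\<lambda>\<sigma>. Complex \<sigma> t) \<longlongrightarrow> z) (at_right (1/2))"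
      unfolding z_def Complex_eq by (intro tendsto_intros)
    have nlz: "z - \<rho> \<notin> \<real>\<^sub>\<le>\<^sub>0" unfolding zr using ehn by (auto simp: complex_nonpos_Reals_iff)
    have "((\<lambda>\<sigma>. real m * Im (Ln (Complex \<sigma> t - \<rho>)) + Im (G (Complex \<sigma> t)) + Im c) \<longlongrightarrow>
        real m * Im (Ln (z - \<rho>)) + Im (G z) + Im c) (at_right (1/2))"
      using nlz by (intro tendsto_intros a isCont_tendsto_compose[OF iG[OF zb]])
    then show ?thesis
    proof (rule Lim_transform_eventually)
      have "\<forall>\<^sub>F \<sigma> in at_right (1/2). Complex \<sigma> t \<in> ball \<rho> r"
        using a zb by (intro topological_tendstoD) auto
      moreover have "\<forall>\<^sub>F \<sigma> in at_right (1/2). \<sigma> > (1/2::real)"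
        by (auto simp: eventually_at_right_field intro!: exI[of _ 1])
      ultimately show "\<forall>\<^sub>F \<sigma> in at_right (1/2). real m * Im (Ln (Complex \<sigma> t - \<rho>)) + Im (G (Complex \<sigma> t)) + Im c
          = Im (zeta_log (Complex \<sigma> t))"
      proof eventually_elim
        case (elim \<sigma>)
        then show ?case using c[of "Complex \<sigma> t"] by simp
      qed
    qed
  qed
  have "zeta_S t = (real m * Im (Ln (z - \<rho>)) + Im (G z) + Im c) / pi"
    using zeta_arg_half_eq[OF RH tpos _ lim] not_zeta_ordinate[OF RH tpos] nz
    unfolding zeta_S_def z_def by simp
  then have "e * zeta_S t = (real m * (e * Im (Ln (z - \<rho>))) + e * Im (G z) + e * Im c) / pi"
    by (simp add: algebra_simps)
  moreover have "e * Im (Ln (z - \<rho>)) = pi / 2"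
  proof -
    have "Ln (\<i> * of_real (e * h)) = of_real (ln h) + \<i> * of_real (e * pi / 2)"
    proof (rule Ln_unique)
      have "exp (of_real (ln h) + \<i> * of_real (e * pi / 2)) = of_real h * (cis (e * pi / 2))"
        using h by (simp add: exp_add cis_conv_exp exp_of_real)
      also have "cis (e * pi / 2) = \<i> * of_real e" using e by (auto simp: complex_eq_iff)
      finally show "exp (of_real (ln h) + \<i> * of_real (e * pi / 2)) = \<i> * of_real (e * h)" by simp
    qed (use e pi_gt_zero in auto)
    then show ?thesis unfolding zr using eabs by simp
  qed
  moreover have "e * Im (G z) \<ge> e * Im (G \<rho>) - \<eta>"
  proof -
    have "\<bar>Im (G z) - Im (G \<rho>)\<bar> < \<eta>"
      using d(2)[of z] dz h abs_Im_le_cmod[of "G z - G \<rho>"] by simp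
    then show ?thesis using e by auto
  qed
  ultimately have "e * zeta_S t \<ge> (Y - \<eta>) / pi"
    by (simp add: Y_def divide_right_mono)
  moreover have "(Y - \<eta>) / pi \<ge> (X - \<eta>) / pi" using XY by (simp add: divide_right_mono)
  moreover have "\<bar>t - t0\<bar> < \<eta>" using h eabs by (simp add: t_def abs_mult)
  ultimately show ?thesis by (intro exI[of _ t]) auto
qed

section \<open>Shifting the line of integration\<close>

lemma cosh_ge_exp: "cosh (x::real) \<ge> exp \<bar>x\<bar> / 2"
  by (auto simp: cosh_field_def abs_if)

lemma integrable_exp_cosh:
  assumes \<alpha>: "\<alpha> > 0" shows "integrable lborel (\<lambda>x::real. exp (- \<alpha> * cosh x))"
proof -
  define g where "g = (\<lambda>x::real. indicator {0..} x *\<^sub>R exp (- (\<alpha>/2) * x))"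
  have "(\<lambda>x::real. exp (- (\<alpha>/2) * x)) absolutely_integrable_on {0..}"
    using \<alpha> integrable_on_exp_minus_to_infinity[of "\<alpha>/2" 0] by (intro nonnegative_absolutely_integrable_1) auto
  then have "integrable lebesgue g" unfolding g_def set_integrable_def .
  moreover have "g \<in> borel_measurable lborel" unfolding g_def by simp
  ultimately have g: "integrable lborel g" using integrable_completion by blast
  have "integrable lborel (\<lambda>x. g (0 + (- 1) * x))" by (rule lborel_integrable_real_affine[OF g]) simp
  then have s: "integrable lborel (\<lambda>x. g x + g (- x))" using g by simp
  show ?thesis
  proof (rule Bochner_Integration.integrable_bound[OF s])
    show "AE x in lborel. norm (exp (- \<alpha> * cosh x)) \<le> norm (g x + g (- x))"
    proof (rule AE_I2)
      fix x :: real
      have "\<bar>x\<bar> \<le> exp \<bar>x\<bar>" using exp_ge_add_one_self[of "\<bar>x\<bar>"] by linarith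
      then have "cosh x \<ge> \<bar>x\<bar> / 2" using cosh_ge_exp[of x] by linarith
      then have "exp (- \<alpha> * cosh x) \<le> exp (- (\<alpha>/2) * \<bar>x\<bar>)"
        using \<alpha> mult_left_mono[of "\<bar>x\<bar> / 2" "cosh x" \<alpha>] by simp
      also have "\<dots> \<le> g x + g (- x)" by (auto simp: g_def indicator_def abs_if)
      finally show "norm (exp (- \<alpha> * cosh x)) \<le> norm (g x + g (- x))" by simp
    qed
  qed (auto intro!: borel_measurable_continuous_onI continuous_intros)
qed

text \<open>Links the half-line integrals of the statement with the whole-line integrals of the
  contour argument.\<close>

lemma integral_fold_half_line:
  fixes f :: "real \<Rightarrow> 'a::euclidean_space"
  assumes f: "integrable lborel f"
  shows "(LBINT x. f x) = (LBINT x:{0..}. f x + f (- x))"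
    and "set_integrable lborel {0..} (\<lambda>x. f x + f (- x))"
proof -
  have s: "set_integrable lborel A f" if "A \<in> sets borel" for A
    unfolding set_integrable_def using f that by (intro integrable_mult_indicator) auto
  have f': "integrable lborel (\<lambda>x. f (- x))"
    using lborel_integrable_real_affine[OF f, of "-1" 0] by simp
  have s': "set_integrable lborel A (\<lambda>x. f (- x))" if "A \<in> sets borel" for A
    unfolding set_integrable_def using f' that by (intro integrable_mult_indicator) auto
  show "set_integrable lborel {0..} (\<lambda>x. f x + f (- x))"
    by (intro set_integral_add s s') auto
  have "(LBINT x. f x) = (LBINT x:{..0} \<union> {0..}. f x)"
  proof -
    have "{..0} \<union> {0..} = (UNIV :: real set)" by auto
    then show ?thesis by (simp add: set_lebesgue_integral_def)
  qed
  also have "\<dots> = (LBINT x:{..0}. f x) + (LBINT x:{0..}. f x)"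
  proof (rule set_integral_Un_AE)
    show "AE x in lborel. \<not> (x \<in> {..0} \<and> x \<in> {0::real..})"
      using AE_lborel_singleton[of "0::real"] by eventually_elim auto
  qed (auto intro!: s)
  also have "(LBINT x:{..0}. f x) = (LBINT x:{0..}. f (- x))"
    using set_integral_reflect[of "{..0::real}" f] by (simp add: Collect_conv_if atLeast_def)
  finally show "(LBINT x. f x) = (LBINT x:{0..}. f x + f (- x))"
    using set_integral_add(2)[OF s[of "{0..}"] s'[of "{0..}"]] by simp
qed

lemma kappa_eq:
  assumes "a > 0" "0 < b" "b < pi / 2"
  shows "kappa a b = (LBINT x. exp (- (a * cos b) * cosh x))"
proof -
  have "a * cos b > 0" using assms by (intro mult_pos_pos cos_gt_zero_pi) auto
  from integral_fold_half_line(1)[OF integrable_exp_cosh[OF this]]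
  show ?thesis unfolding kappa_def by (simp add: set_lebesgue_integral_def)
qed

text \<open>While \<open>\<bar>y\<bar> < pi / 2\<close> the factor \<open>cos y\<close> is positive
  and the kernel keeps its double exponential decay; at \<open>y = - b\<close> this modulus is the
  integrand of \<open>kappa\<close>.\<close>

lemma norm_exp_cosh: "norm (exp (- of_real a * cosh (Complex x y))) = exp (- a * (cosh x * cos y))"
proof -
  have "Re (cosh (Complex x y)) = cosh x * cos y"
    by (simp add: cosh_field_def Re_exp algebra_simps)
  then show ?thesis by simp
qed

text \<open>A primitive on the convex set replaces the contour theorem: both horizontal integrals
  are increments of \<open>G\<close>, and their difference is made of its increments along the two
  vertical sides of length \<open>b\<close>.\<close>

lemma rectangle_shift:
  assumes S: "open S" "convex S" and g: "g holomorphic_on S" and Ub: "U \<ge> 0" "b \<ge> 0"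
    and rect: "\<And>u v. \<bar>u\<bar> \<le> U \<Longrightarrow> 0 \<le> v \<Longrightarrow> v \<le> b \<Longrightarrow> Complex u (- v) \<in> S"
    and edge: "\<And>u v. \<bar>u\<bar> = U \<Longrightarrow> 0 \<le> v \<Longrightarrow> v \<le> b \<Longrightarrow> norm (g (Complex u (- v))) \<le> B"
  shows "norm ((LBINT u:{-U..U}. g (of_real u)) - (LBINT u:{-U..U}. g (Complex u (- b)))) \<le> 2 * b * B"
proof -
  obtain G where "\<And>x. x \<in> S \<Longrightarrow> (G has_field_derivative g x) (at x within S)"
    using holomorphic_convex_primitive'[OF S(2,1) g] by blast
  then have G: "(G has_field_derivative g x) (at x)" if "x \<in> S" for x
    using that S(1) by (metis at_within_open)
  have contg: "continuous_on S g" using g holomorphic_on_imp_continuous_on by blast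
  have int: "(LBINT u:{-U..U}. g (Complex u (- v))) = G (Complex U (- v)) - G (Complex (- U) (- v))"
    if v: "0 \<le> v" "v \<le> b" for v
    unfolding set_lebesgue_integral_def
  proof (rule integral_FTC_atLeastAtMost)
    have c: "continuous_on {-U..U} (\<lambda>u. Complex u (- v))"
      unfolding Complex_eq by (intro continuous_intros)
    show "continuous_on {-U..U} (\<lambda>u. g (Complex u (- v)))"
      by (rule continuous_on_compose2[OF contg c]) (auto intro!: rect v)
    fix u assume u: "- U \<le> u" "u \<le> U"
    have "Complex u (- v) \<in> S" using u v by (intro rect) auto
    then have "(G has_field_derivative g (Complex u (- v))) (at (Complex u (- v)))" by (rule G)
    moreover have "((\<lambda>u. Complex u (- v)) has_vector_derivative 1) (at u within {-U..U})"
      unfolding Complex_eq by (auto intro!: derivative_eq_intros)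
    ultimately show "((\<lambda>u. G (Complex u (- v))) has_vector_derivative g (Complex u (- v))) (at u within {-U..U})"
      using field_vector_diff_chain_within[of "\<lambda>u. Complex u (- v)" 1 u "{-U..U}" G "g (Complex u (- v))"]
      by (simp add: o_def has_field_derivative_at_within)
  qed (use Ub in auto)
  have side: "norm (G (Complex u 0) - G (Complex u (- b))) \<le> B * b" if u: "\<bar>u\<bar> = U" for u
  proof -
    let ?T = "closed_segment (Complex u (- b)) (Complex u 0)"
    have T: "\<exists>v. 0 \<le> v \<and> v \<le> b \<and> x = Complex u (- v)" if x: "x \<in> ?T" for x
    proof -
      obtain r where r: "0 \<le> r" "r \<le> 1" "x = (1 - r) *\<^sub>R Complex u (- b) + r *\<^sub>R Complex u 0"
        using x unfolding closed_segment_def by blast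
      then show ?thesis using Ub
        by (intro exI[of _ "(1 - r) * b"]) (auto simp: complex_eq_iff algebra_simps intro: mult_left_le)
    qed
    have "norm (G (Complex u 0) - G (Complex u (- b))) \<le> B * norm (Complex u 0 - Complex u (- b))"
    proof (rule field_differentiable_bound[where S = ?T and f' = g])
      fix x assume x: "x \<in> ?T"
      then obtain v where v: "0 \<le> v" "v \<le> b" "x = Complex u (- v)" using T by blast
      show "(G has_field_derivative g x) (at x within ?T)"
        using v u by (auto intro!: has_field_derivative_at_within[OF G] rect)
      show "norm (g x) \<le> B" using v u edge by auto
    qed auto
    moreover have "norm (Complex u 0 - Complex u (- b)) = b"
    proof -
      have "Complex u 0 - Complex u (- b) = \<i> * of_real b" by (simp add: complex_eq_iff)
      then show ?thesis using Ub by (simp add: norm_mult)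
    qed
    ultimately show ?thesis by simp
  qed
  have "(LBINT u:{-U..U}. g (of_real u)) - (LBINT u:{-U..U}. g (Complex u (- b))) =
     (G (Complex U 0) - G (Complex U (- b))) - (G (Complex (- U) 0) - G (Complex (- U) (- b)))"
    using int[of 0] int[of b] Ub by (simp add: complex_of_real_def)
  also have "norm \<dots> \<le> B * b + B * b"
    using side[of U] side[of "- U"] Ub norm_triangle_ineq4 order_trans add_mono by (smt (verit))
  finally show ?thesis by (simp add: algebra_simps)
qed

text \<open>The hypothesis on the vertical sides allows \<open>F\<close> to blow up like \<open>1/v\<close> at the upper corners,
  where the weight \<open>1 - z\<^sup>2/U\<^sup>2\<close> is \<open>O(v)\<close>.\<close>

lemma kernel_shift:
  assumes S: "open S" "convex S" and F: "F holomorphic_on S"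
    and ab: "a > 0" "0 < b" "b < pi / 2" and U: "U \<ge> 1"
    and rect: "\<And>u v. \<bar>u\<bar> \<le> U \<Longrightarrow> 0 \<le> v \<Longrightarrow> v \<le> b \<Longrightarrow> Complex u (- v) \<in> S"
    and edge: "\<And>u v. \<bar>u\<bar> = U \<Longrightarrow> 0 \<le> v \<Longrightarrow> v \<le> b \<Longrightarrow> v * norm (F (Complex u (- v))) \<le> B"
    and bottom: "\<And>u. \<bar>u\<bar> \<le> U \<Longrightarrow> norm (F (Complex u (- b))) \<le> \<beta>"
  shows "norm (LBINT u:{-U..U}. (K a u * (1 - u\<^sup>2 / U\<^sup>2)) *\<^sub>R F (of_real u)) \<le>
     kappa a b * (1 + (b\<^sup>2 + 2 * b) / U) * \<beta> + 2 * b * ((b + 2) * B * exp (- (a * cos b) * cosh U))"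
proof -
  define w where "w = (\<lambda>z::complex. 1 - z\<^sup>2 / of_real (U\<^sup>2))"
  define g where "g = (\<lambda>z. exp (- of_real a * cosh z) * w z * F z)"
  have cb: "cos b > 0" using ab by (intro cos_gt_zero_pi) auto
  have \<alpha>: "a * cos b > 0" using ab cb by simp
  have \<beta>: "\<beta> \<ge> 0" using bottom[of 0] U norm_ge_zero order_trans by (metis abs_zero zero_le_one)
  have "v * norm (F (Complex U (- v))) \<ge> 0" if "v \<ge> 0" for v using that by simp
  then have B: "B \<ge> 0" using edge[of U b] ab U by (smt (verit))
  have gh: "g holomorphic_on S" unfolding g_def w_def cosh_field_def using F U by (intro holomorphic_intros) auto
  have "norm ((LBINT u:{-U..U}. g (of_real u)) - (LBINT u:{-U..U}. g (Complex u (- b)))) \<le>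
      2 * b * ((b + 2) * B * exp (- (a * cos b) * cosh U))"
  proof (rule rectangle_shift[OF S gh])
    fix u v assume uv: "\<bar>u\<bar> = U" "0 \<le> v" "v \<le> b"
    have u2: "u\<^sup>2 = U\<^sup>2" using uv(1) by (metis power2_abs)
    have e: "exp (- a * (cosh u * cos v)) \<le> exp (- (a * cos b) * cosh U)"
    proof -
      have "cos b \<le> cos v" using uv ab by (intro cos_monotone_0_pi_le) auto
      then have "a * cosh U * cos b \<le> a * cosh U * cos v" using ab by (intro mult_left_mono) auto
      moreover have ch: "cosh u = cosh U" using uv(1) cosh_real_abs by metis
      ultimately show ?thesis unfolding ch by (simp add: mult_ac)
    qed
    \<comment> \<open>On the sides \<open>U\<^sup>2 - u\<^sup>2\<close> cancels; what is left is at
      most \<open>(b + 2) * v\<close>, and this \<open>v\<close> is the one demanded by the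
      hypothesis on the sides.\<close>
    have "w (Complex u (- v)) = of_real (v\<^sup>2 / U\<^sup>2) + \<i> * of_real (2 * u * v / U\<^sup>2)"
      using U u2 unfolding w_def by (auto simp: complex_eq_iff power2_eq_square field_simps)
    then have "norm (w (Complex u (- v))) \<le> v\<^sup>2 / U\<^sup>2 + \<bar>2 * u * v / U\<^sup>2\<bar>"
      using norm_triangle_ineq[of "of_real (v\<^sup>2 / U\<^sup>2) :: complex" "\<i> * of_real (2 * u * v / U\<^sup>2)"]
      by (simp only: norm_mult norm_of_real) (simp add: norm_mult)
    also have "v\<^sup>2 / U\<^sup>2 \<le> v * b"
    proof -
      have "v\<^sup>2 / U\<^sup>2 \<le> v\<^sup>2 / 1" using U by (intro divide_left_mono) (auto simp: one_le_power)
      also have "\<dots> \<le> v * b" using uv by (simp add: power2_eq_square mult_left_mono)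
      finally show ?thesis .
    qed
    also have "\<bar>2 * u * v / U\<^sup>2\<bar> \<le> 2 * v"
    proof -
      have "\<bar>2 * u * v / U\<^sup>2\<bar> = 2 * v / U" using uv U by (simp add: abs_mult power2_eq_square)
      also have "\<dots> \<le> 2 * v / 1" using uv U by (intro divide_left_mono) auto
      finally show ?thesis by simp
    qed
    finally have w: "norm (w (Complex u (- v))) \<le> (b + 2) * v" by (simp add: algebra_simps)
    have "norm (g (Complex u (- v))) = exp (- a * (cosh u * cos v)) * norm (w (Complex u (- v))) * norm (F (Complex u (- v)))"
      unfolding g_def norm_mult norm_exp_cosh by simp
    also have "\<dots> \<le> exp (- (a * cos b) * cosh U) * ((b + 2) * v) * norm (F (Complex u (- v)))"
      using e w uv ab by (intro mult_mono mult_right_mono) auto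
    also have "\<dots> = exp (- (a * cos b) * cosh U) * (b + 2) * (v * norm (F (Complex u (- v))))" by simp
    also have "\<dots> \<le> exp (- (a * cos b) * cosh U) * (b + 2) * B"
      using edge[OF uv] ab by (intro mult_left_mono) auto
    finally show "norm (g (Complex u (- v))) \<le> (b + 2) * B * exp (- (a * cos b) * cosh U)"
      by (simp add: mult_ac)
  qed (use U ab rect in auto)
  moreover have "norm (LBINT u:{-U..U}. g (Complex u (- b))) \<le> kappa a b * (1 + (b\<^sup>2 + 2 * b) / U) * \<beta>"
  proof -
    define C where "C = (1 + (b\<^sup>2 + 2 * b) / U) * \<beta>"
    have bd: "norm (g (Complex u (- b))) \<le> exp (- (a * cos b) * cosh u) * C" if u: "\<bar>u\<bar> \<le> U" for u
    proof -
      \<comment> \<open>On the lower side the weight may exceed 1 in modulus, but only by an amount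
        of order \<open>1 / U\<close>.\<close>
      have "w (Complex u (- b)) = of_real (1 - u\<^sup>2 / U\<^sup>2) + (of_real (b\<^sup>2 / U\<^sup>2) + \<i> * of_real (2 * u * b / U\<^sup>2))"
        using U unfolding w_def by (auto simp: complex_eq_iff power2_eq_square field_simps)
      then have "norm (w (Complex u (- b))) \<le> \<bar>1 - u\<^sup>2 / U\<^sup>2\<bar> + (\<bar>b\<^sup>2 / U\<^sup>2\<bar> + \<bar>2 * u * b / U\<^sup>2\<bar>)"
        by (metis (no_types, lifting) norm_triangle_le norm_of_real norm_ii norm_mult mult_1 add_left_mono norm_triangle_ineq order_refl)
      also have "\<bar>1 - u\<^sup>2 / U\<^sup>2\<bar> \<le> 1"
      proof -
        have "u\<^sup>2 \<le> U\<^sup>2" using u U by (metis abs_ge_zero power2_abs power_mono)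
        then show ?thesis using U by (simp add: divide_le_eq)
      qed
      also have "\<bar>b\<^sup>2 / U\<^sup>2\<bar> \<le> b\<^sup>2 / U"
      proof -
        have "U * 1 \<le> U * U" using U by (intro mult_left_mono) auto
        then have "b\<^sup>2 / U\<^sup>2 \<le> b\<^sup>2 / U" using U by (intro divide_left_mono) (auto simp: power2_eq_square)
        then show ?thesis by simp
      qed
      also have "\<bar>2 * u * b / U\<^sup>2\<bar> \<le> 2 * b / U"
      proof -
        have "\<bar>2 * u * b / U\<^sup>2\<bar> = 2 * b * \<bar>u\<bar> / U\<^sup>2" using ab by (simp add: abs_mult)
        also have "\<dots> \<le> 2 * b * U / U\<^sup>2" using ab u by (intro divide_right_mono mult_left_mono) auto
        finally show ?thesis using U by (simp add: power2_eq_square)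
      qed
      finally have w: "norm (w (Complex u (- b))) \<le> 1 + (b\<^sup>2 + 2 * b) / U" by (simp add: add_divide_distrib)
      have "norm (g (Complex u (- b))) = exp (- a * (cosh u * cos b)) * norm (w (Complex u (- b))) * norm (F (Complex u (- b)))"
        unfolding g_def norm_mult norm_exp_cosh by simp
      also have "\<dots> \<le> exp (- a * (cosh u * cos b)) * (1 + (b\<^sup>2 + 2 * b) / U) * \<beta>"
        using w bottom[OF u] \<beta> U ab by (intro mult_mono mult_left_mono) (auto intro!: mult_nonneg_nonneg)
      finally show ?thesis unfolding C_def by (simp add: mult_ac)
    qed
    have "norm (LBINT u:{-U..U}. g (Complex u (- b))) \<le> (LBINT u. exp (- (a * cos b) * cosh u) * C)"
      unfolding set_lebesgue_integral_def
    proof (rule Bochner_Integration.integral_norm_bound_integral)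
      show "integrable lborel (\<lambda>u. exp (- (a * cos b) * cosh u) * C)"
        using integrable_exp_cosh[OF \<alpha>] by simp
      have "continuous_on {-U..U} (\<lambda>u. g (Complex u (- b)))"
      proof (rule continuous_on_compose2[OF holomorphic_on_imp_continuous_on[OF gh]])
        show "continuous_on {-U..U} (\<lambda>u. Complex u (- b))" unfolding Complex_eq by (intro continuous_intros)
      qed (use rect ab in auto)
      then show "integrable lborel (\<lambda>u. indicator {-U..U} u *\<^sub>R g (Complex u (- b)))"
        using borel_integrable_atLeastAtMost' unfolding set_integrable_def by blast
      show "norm (indicator {-U..U} u *\<^sub>R g (Complex u (- b))) \<le> exp (- (a * cos b) * cosh u) * C" for u
      proof (cases "\<bar>u\<bar> \<le> U")
        case True then show ?thesis using bd[OF True] by (auto simp: indicator_def)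
      next
        case False
        moreover have "C \<ge> 0" unfolding C_def using \<beta> U ab by simp
        ultimately show ?thesis by (auto simp: indicator_def)
      qed
    qed
    also have "\<dots> = kappa a b * C" using kappa_eq[OF ab] by simp
    finally show ?thesis by (simp add: C_def mult.assoc)
  qed
  moreover have "(LBINT u:{-U..U}. (K a u * (1 - u\<^sup>2 / U\<^sup>2)) *\<^sub>R F (of_real u)) = (LBINT u:{-U..U}. g (of_real u))"
  proof -
    have "(K a u * (1 - u\<^sup>2 / U\<^sup>2)) *\<^sub>R F (of_real u) = g (of_real u)" for u
    proof -
      have "cosh (of_real u :: complex) = of_real (cosh u)" by (simp add: cosh_field_def exp_of_real flip: of_real_minus)
      then have "exp (- of_real a * cosh (of_real u :: complex)) = of_real (K a u)"
        unfolding K_def by (simp flip: exp_of_real)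
      then show ?thesis unfolding g_def w_def by (simp add: scaleR_conv_of_real)
    qed
    then show ?thesis by simp
  qed
  ultimately show ?thesis
    using norm_triangle_sub[of "LBINT u:{-U..U}. g (of_real u)" "LBINT u:{-U..U}. g (Complex u (- b))"] by simp
qed

section \<open>The contribution of small primes\<close>

text \<open>The coefficients \<omega> absorb a vertical shift by \<open>t0\<close> as
  \<open>p powr (- \<i> t0)\<close>. The original product (\<omega> = 1), the shifted one and the
  ideal one (\<omega> = \<i> or -\<i>) become instances of one function.\<close>

definition euler_log :: "(nat \<Rightarrow> complex) \<Rightarrow> nat \<Rightarrow> complex \<Rightarrow> complex" where
  "euler_log \<omega> N s = (\<Sum>p\<le>N. if prime p then - Ln (1 - \<omega> p * of_nat p powr (- s)) else 0)"

lemma sum_prime_log_eq: "(\<Sum>p\<le>N. prime_log s p) = euler_log (\<lambda>_. 1) N s"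
  unfolding euler_log_def prime_log_def by (intro sum.cong) auto

lemma euler_log_add: "euler_log (\<lambda>_. 1) N (s + w) = euler_log (\<lambda>p. of_nat p powr (- w)) N s"
  unfolding euler_log_def by (intro sum.cong refl if_cong) (simp add: powr_add[symmetric] add.commute)

lemma norm_twisted_powr:
  assumes "prime p" "norm \<omega> \<le> 1"
  shows "norm (\<omega> * (of_nat p :: complex) powr (- s)) \<le> real p powr (- Re s)"
  using assms prime_gt_0_nat[of p] by (simp add: norm_mult norm_nat_powr mult_left_le_one_le)

lemma norm_euler_log_le:
  assumes \<omega>: "\<And>p. norm (\<omega> p) \<le> 1" and s: "Re s \<ge> x" "x > 0"
  shows "norm (euler_log \<omega> N s) \<le> (\<Sum>p\<le>N. prime_ln x p)"
  unfolding euler_log_def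
proof (rule sum_norm_le)
  fix p
  show "norm (if prime p then - Ln (1 - \<omega> p * of_nat p powr (- s)) else 0) \<le> prime_ln x p"
  proof (cases "prime p")
    case True
    have 1: "norm (\<omega> p * of_nat p powr (- s)) \<le> real p powr (- Re s)" using True \<omega> by (rule norm_twisted_powr)
    also have 2: "\<dots> \<le> real p powr (- x)" using s True prime_gt_1_nat[of p] by (intro powr_mono) auto
    finally have 3: "norm (\<omega> p * of_nat p powr (- s)) \<le> real p powr (- x)" .
    have 4: "real p powr (- x) < 1" using True s by (intro prime_powr_lt_1) auto
    have "norm (Ln (1 - \<omega> p * of_nat p powr (- s))) \<le> - ln (1 - norm (\<omega> p * of_nat p powr (- s)))"
      using 3 4 by (intro norm_Ln_one_minus_le) auto
    also have "\<dots> \<le> - ln (1 - real p powr (- x))" using 3 4 by simp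
    finally show ?thesis using True by (simp add: prime_ln_def)
  qed (simp add: prime_ln_def)
qed

lemma holomorphic_euler_log:
  assumes \<omega>: "\<And>p. norm (\<omega> p) \<le> 1" shows "euler_log \<omega> N holomorphic_on {s. Re s > 0}"
  unfolding euler_log_def
proof (intro holomorphic_on_sum)
  fix p
  show "(\<lambda>s. if prime p then - Ln (1 - \<omega> p * of_nat p powr (- s)) else 0) holomorphic_on {s. Re s > 0}"
  proof (cases "prime p")
    case True
    have "1 - \<omega> p * of_nat p powr (- s) \<notin> \<real>\<^sub>\<le>\<^sub>0" if "Re s > 0" for s
    proof -
      have "norm (\<omega> p * of_nat p powr (- s)) < 1"
        using norm_twisted_powr[OF True \<omega>] prime_powr_lt_1[OF True that] by (rule order_le_less_trans)
      then have "Re (\<omega> p * of_nat p powr (- s)) < 1" using complex_Re_le_cmod order_le_less_trans by blast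
      then show ?thesis by (simp add: complex_nonpos_Reals_iff)
    qed
    then show ?thesis using True prime_gt_0_nat[of p] by (auto intro!: holomorphic_intros)
  qed auto
qed

text \<open>The displacement by \<delta> multiplies each coefficient by
  \<open>p powr (- \<delta>)\<close>, which lies between \<open>N powr (- \<delta>)\<close> and 1;
  together both changes move it by at most \<open>2 * \<eta>\<close>. As
  \<open>1 / sqrt 2 < 3/4\<close>, the logarithm is Lipschitz with constant 4 on the disc in
  question, and there are \<open>N + 1\<close> terms.\<close>

lemma euler_log_diff:
  assumes \<omega>: "\<And>p. norm (\<omega> p) \<le> 1" "\<And>p. norm (\<omega>' p) \<le> 1" and \<delta>: "\<delta> \<ge> 0"
    and \<eta>: "\<And>p. prime p \<Longrightarrow> p \<le> N \<Longrightarrow> norm (\<omega> p - \<omega>' p) \<le> \<eta>"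
      "1 - real N powr (- \<delta>) \<le> \<eta>" "N \<ge> 1"
  shows "norm (euler_log \<omega> N (Complex (1/2 + \<delta>) y) - euler_log \<omega>' N (Complex (1/2) y)) \<le> 8 * (real N + 1) * \<eta>"
proof -
  have \<eta>0: "\<eta> \<ge> 0"
  proof -
    have "real N powr (- \<delta>) \<le> real N powr 0" using \<delta> \<eta>(3) by (intro powr_mono) auto
    then show ?thesis using \<eta>(2,3) by simp
  qed
  define f where "f = (\<lambda>\<omega> s p. if prime p then - Ln (1 - \<omega> p * of_nat p powr (- s)) else 0 :: complex)"
  define s s' where "s = Complex (1/2 + \<delta>) y" and "s' = Complex (1/2) y"
  have "norm (f \<omega> s p - f \<omega>' s' p) \<le> 8 * \<eta>" if p: "p \<le> N" for p
  proof (cases "prime p")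
    case True
    let ?z = "\<omega> p * of_nat p powr (- s)" and ?w = "\<omega>' p * of_nat p powr (- s')"
    have p1: "real p powr (- x) \<le> 3/4" if "x \<ge> 1/2" for x
    proof -
      have "real p powr (- x) \<le> 2 powr (- x)" using True prime_ge_2_nat that by (intro nat_powr_le_half_powr) auto
      also have "\<dots> \<le> 2 powr (- (1/2))" using that by (intro powr_mono) auto
      also have "\<dots> = 1 / sqrt 2" by (simp add: powr_minus_divide powr_half_sqrt)
      also have "\<dots> \<le> 3/4"
      proof -
        have "4/3 \<le> sqrt 2" by (rule real_le_rsqrt) (simp add: power2_eq_square)
        then show ?thesis by (simp add: field_simps)
      qed
      finally show ?thesis .
    qed
    have z: "norm ?z \<le> 3/4" "norm ?w \<le> 3/4"
    proof -
      have "1/2 \<le> Re s" "1/2 \<le> Re s'" using \<delta> by (auto simp: s_def s'_def)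
      then show "norm ?z \<le> 3/4" "norm ?w \<le> 3/4"
        using order_trans[OF norm_twisted_powr[OF True \<omega>(1)[of p], of s] p1]
          order_trans[OF norm_twisted_powr[OF True \<omega>(2)[of p], of s'] p1] by blast+
    qed
    have "norm (f \<omega> s p - f \<omega>' s' p) = norm (Ln (1 - ?z) - Ln (1 - ?w))"
      using True by (simp add: f_def norm_minus_commute)
    also have "\<dots> \<le> norm (?z - ?w) / (1 - 3/4)" by (rule Ln_one_minus_lipschitz[OF z]) simp
    also have "?z - ?w = (\<omega> p * of_real (real p powr (- \<delta>)) - \<omega>' p) * of_nat p powr (- s')"
    proof -
      have "- s = of_real (- \<delta>) + (- s')" by (simp add: s_def s'_def complex_eq_iff)
      then have "of_nat p powr (- s) = of_nat p powr (of_real (- \<delta>)) * (of_nat p powr (- s') :: complex)"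
        by (metis powr_add)
      also have "(of_nat p :: complex) powr (of_real (- \<delta>)) = of_real (real p powr (- \<delta>))"
        by (metis of_nat_0_le_iff of_real_of_nat_eq powr_of_real)
      finally show ?thesis by (simp add: algebra_simps)
    qed
    also have "norm \<dots> / (1 - 3/4) \<le> (2 * \<eta>) * 1 / (1 - 3/4)"
    proof (intro divide_right_mono)
      have "\<omega> p * of_real (real p powr (- \<delta>)) - \<omega>' p = (\<omega> p - \<omega>' p) + \<omega> p * of_real (real p powr (- \<delta>) - 1)"
        by (simp add: algebra_simps)
      also have "norm \<dots> \<le> norm (\<omega> p - \<omega>' p) + norm (\<omega> p) * \<bar>real p powr (- \<delta>) - 1\<bar>"
        by (metis norm_mult norm_of_real norm_triangle_ineq)
      also have "\<dots> \<le> \<eta> + 1 * \<eta>"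
      proof (intro add_mono mult_mono)
        have "real p powr (- \<delta>) \<le> real p powr 0" using \<delta> True prime_gt_1_nat[of p] by (intro powr_mono) auto
        moreover have "real N powr (- \<delta>) \<le> real p powr (- \<delta>)"
          using p \<delta> True prime_gt_0_nat[of p] by (intro powr_mono2') auto
        ultimately show "\<bar>real p powr (- \<delta>) - 1\<bar> \<le> \<eta>"
          using \<eta>(2) True prime_gt_0_nat[of p] by simp
      qed (use \<eta> \<eta>0 \<omega> True p in auto)
      finally have "norm (\<omega> p * of_real (real p powr (- \<delta>)) - \<omega>' p) \<le> 2 * \<eta>" by simp
      moreover have "norm ((of_nat p :: complex) powr (- s')) \<le> 1"
        using p1[of "Re s'"] True prime_gt_0_nat[of p] by (simp add: norm_nat_powr s'_def)
      ultimately show "norm ((\<omega> p * of_real (real p powr (- \<delta>)) - \<omega>' p) * of_nat p powr (- s')) \<le> 2 * \<eta> * 1"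
        unfolding norm_mult using \<eta>0 by (intro mult_mono) auto
    qed simp
    finally show ?thesis by simp
  qed (use \<eta>0 in \<open>simp add: f_def\<close>)
  then have "norm (\<Sum>p\<le>N. f \<omega> s p - f \<omega>' s' p) \<le> (\<Sum>p\<le>N. 8 * \<eta>)" by (intro sum_norm_le) auto
  then show ?thesis unfolding euler_log_def f_def s_def s'_def sum_subtractf by (simp add: algebra_simps)
qed

text \<open>The two factors multiply to
  \<open>1 - x\<^sup>2 - 2 * \<i> * e * x * cos \<phi>\<close>, and both have positive real part, so
  the principal logarithms add. With \<open>x = 1 / sqrt p\<close> the quotient
  \<open>2 * x / (1 - x\<^sup>2)\<close> is the coefficient in \<open>S_N\<close>.\<close>

lemma Im_Ln_pair_eq_arctan:
  fixes e x \<phi> :: real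
  assumes e: "e = 1 \<or> e = - 1" and x: "0 < x" "x < 1"
  shows "e * Im (- Ln (1 - \<i> * of_real e * (of_real x * cis (- \<phi>))) - Ln (1 - \<i> * of_real e * (of_real x * cis \<phi>)))
     = arctan (2 * x / (1 - x\<^sup>2) * cos \<phi>)"
proof -
  define A B where "A = 1 - \<i> * of_real e * (of_real x * cis (- \<phi>))" and "B = 1 - \<i> * of_real e * (of_real x * cis \<phi>)"
  have lt: "\<bar>x * sin \<phi>\<bar> < 1"
  proof -
    have "\<bar>x * sin \<phi>\<bar> \<le> x * 1" using x abs_sin_le_one[of \<phi>] by (simp add: abs_mult mult_left_mono)
    then show ?thesis using x by simp
  qed
  have A: "Re A > 0" "Re B > 0" using e lt by (auto simp: A_def B_def abs_less_iff)
  then have nz: "A \<noteq> 0" "B \<noteq> 0" by auto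
  have "\<bar>Im (Ln A)\<bar> < pi / 2" "\<bar>Im (Ln B)\<bar> < pi / 2" using A nz Re_Ln_pos_lt by auto
  then have "Ln (A * B) = Ln A + Ln B" using nz by (intro Ln_times_simple) auto
  moreover have AB: "A * B = Complex (1 - x\<^sup>2) (- 2 * e * x * cos \<phi>)"
  proof -
    have "A * B = 1 - \<i> * of_real e * of_real x * (cis (- \<phi>) + cis \<phi>) + (\<i> * of_real e * of_real x)\<^sup>2 * (cis (- \<phi>) * cis \<phi>)"
      unfolding A_def B_def by (simp add: algebra_simps power2_eq_square)
    also have "cis (- \<phi>) * cis \<phi> = 1" by (simp add: cis_mult)
    also have "(\<i> * of_real e * of_real x)\<^sup>2 = - of_real (x\<^sup>2)" using e by (auto simp: power_mult_distrib)
    also have "cis (- \<phi>) + cis \<phi> = of_real (2 * cos \<phi>)" by (simp add: complex_eq_iff)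
    finally show ?thesis by (simp add: complex_eq_iff)
  qed
  moreover have "Im (Ln (A * B)) = arctan (Im (A * B) / Re (A * B))"
  proof -
    have "1 - x\<^sup>2 > 0" using x by (simp add: power_less_one_iff)
    moreover have "A * B \<noteq> 0" using nz by simp
    ultimately show ?thesis using Im_Ln_eq[of "A * B"] unfolding AB by simp
  qed
  ultimately have "Im (Ln A) + Im (Ln B) = arctan (- e * (2 * x / (1 - x\<^sup>2) * cos \<phi>))" by (simp add: algebra_simps)
  then have "e * Im (- Ln A - Ln B) = arctan (2 * x / (1 - x\<^sup>2) * cos \<phi>)"
    using e by (auto simp: arctan_minus algebra_simps)
  then show ?thesis unfolding A_def B_def .
qed

lemma nat_powr_Complex:
  assumes "p > 0"
  shows "(of_nat p :: complex) powr (- Complex x y) = of_real (real p powr (- x)) * cis (- (y * ln (real p)))"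
proof -
  have "(of_nat p :: complex) powr (- Complex x y) = exp (- Complex x y * of_real (ln (real p)))"
    using assms by (simp add: powr_def flip: Ln_of_nat Ln_of_real)
  also have "- Complex x y * of_real (ln (real p)) = of_real (- x * ln (real p)) + \<i> * of_real (- (y * ln (real p)))"
    by (simp add: complex_eq_iff)
  finally show ?thesis using assms by (simp add: exp_add cis_conv_exp powr_def exp_of_real flip: of_real_minus of_real_mult)
qed

lemma euler_log_pair_eq_S_N:
  assumes e: "e = 1 \<or> e = - 1"
  shows "e * Im (euler_log (\<lambda>_. \<i> * of_real e) N (Complex (1/2) (\<tau> * u)) + euler_log (\<lambda>_. \<i> * of_real e) N (Complex (1/2) (\<tau> * (- u))))
    = S_N \<tau> N u"
proof -
  have "e * Im ((if prime p then - Ln (1 - \<i> * of_real e * of_nat p powr (- Complex (1/2) (\<tau> * u))) else 0) +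
       (if prime p then - Ln (1 - \<i> * of_real e * of_nat p powr (- Complex (1/2) (\<tau> * (- u)))) else 0)) =
     (if prime p then arctan (2 * sqrt (real p) / (real p - 1) * cos (u * \<tau> * ln (real p))) else 0)" for p
  proof (cases "prime p")
    case True
    define x where "x = real p powr (- (1/2))"
    have x: "0 < x" "x < 1" using True prime_powr_lt_1[of p "1/2"] prime_gt_0_nat[of p] by (auto simp: x_def)
    have xs: "x = 1 / sqrt (real p)" by (simp add: x_def powr_minus_divide powr_half_sqrt)
    have c: "2 * x / (1 - x\<^sup>2) = 2 * sqrt (real p) / (real p - 1)"
    proof -
      have p: "real p > 1" using True prime_gt_1_nat[of p] by simp
      have x2: "x\<^sup>2 = 1 / real p" using p by (simp add: xs power_divide)
      have "2 * x / (1 - x\<^sup>2) = 2 * (x * real p) / (real p - 1)" unfolding x2 using p by (simp add: field_simps)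
      also have "x * real p = sqrt (real p)" using p by (simp add: xs real_div_sqrt)
      finally show ?thesis .
    qed
    have "of_nat p powr (- Complex (1/2) (\<tau> * u)) = (of_real x * cis (- (u * \<tau> * ln (real p))) :: complex)"
      "of_nat p powr (- Complex (1/2) (\<tau> * (- u))) = (of_real x * cis (u * \<tau> * ln (real p)) :: complex)"
      using True prime_gt_0_nat[of p] unfolding x_def by (subst nat_powr_Complex; simp add: mult_ac)+
    then show ?thesis using True Im_Ln_pair_eq_arctan[OF e x, of "u * \<tau> * ln (real p)"] unfolding c
      by (simp only: if_True) (simp add: algebra_simps)
  qed simp
  then have "e * Im (euler_log (\<lambda>_. \<i> * of_real e) N (Complex (1/2) (\<tau> * u)) + euler_log (\<lambda>_. \<i> * of_real e) N (Complex (1/2) (\<tau> * (- u))))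
    = (\<Sum>p\<le>N. if prime p then arctan (2 * sqrt (real p) / (real p - 1) * cos (u * \<tau> * ln (real p))) else 0)"
    unfolding euler_log_def sum.distrib[symmetric] Im_sum sum_distrib_left by (intro sum.cong refl)
  also have "\<dots> = S_N \<tau> N u"
    unfolding S_N_def by (subst sum.inter_filter[symmetric]) (auto intro!: sum.cong)
  finally show ?thesis .
qed

section \<open>Integrals of finite Euler products against the kernel\<close>

lemma K_pos: "K a u > 0" by (simp add: K_def)

lemma integrable_K: "a > 0 \<Longrightarrow> integrable lborel (K a)"
  unfolding K_def using integrable_exp_cosh by simp

lemma borel_measurable_K [measurable]: "K a \<in> borel_measurable borel"
  unfolding K_def by (intro borel_measurable_continuous_onI continuous_intros)

lemma integrable_K_scaleR:
  fixes E :: "real \<Rightarrow> complex"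
  assumes "a > 0" "E \<in> borel_measurable borel" "\<And>u. norm (E u) \<le> C"
  shows "integrable lborel (\<lambda>u. K a u *\<^sub>R E u)"
proof (rule Bochner_Integration.integrable_bound)
  show "integrable lborel (\<lambda>u. K a u * C)" using integrable_K[OF assms(1)] by simp
  show "AE u in lborel. norm (K a u *\<^sub>R E u) \<le> norm (K a u * C)"
  proof (rule AE_I2)
    fix u
    have "K a u * norm (E u) \<le> K a u * C" using K_pos[of a u] assms(3)[of u] by (intro mult_left_mono) auto
    then have "K a u * norm (E u) \<le> \<bar>K a u * C\<bar>" by linarith
    then show "norm (K a u *\<^sub>R E u) \<le> norm (K a u * C)" using K_pos[of a u] by simp
  qed
qed (use assms(2) in measurable)

lemma euler_log_line:
  assumes "\<And>p. norm (\<omega> p) \<le> 1"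
  shows "(\<lambda>u. euler_log \<omega> N (Complex (1/2) (\<tau> * u))) \<in> borel_measurable borel"
    and "norm (euler_log \<omega> N (Complex (1/2) (\<tau> * u))) \<le> (\<Sum>p\<le>N. prime_ln (1/2) p)"
proof -
  have "continuous_on UNIV (\<lambda>u. euler_log \<omega> N (Complex (1/2) (\<tau> * u)))"
  proof (rule continuous_on_compose2[OF holomorphic_on_imp_continuous_on[OF holomorphic_euler_log[OF assms]]])
    show "continuous_on UNIV (\<lambda>u. Complex (1/2) (\<tau> * u))" unfolding Complex_eq by (intro continuous_intros)
  qed auto
  then show "(\<lambda>u. euler_log \<omega> N (Complex (1/2) (\<tau> * u))) \<in> borel_measurable borel"
    by (rule borel_measurable_continuous_onI)
  show "norm (euler_log \<omega> N (Complex (1/2) (\<tau> * u))) \<le> (\<Sum>p\<le>N. prime_ln (1/2) p)"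
    by (rule norm_euler_log_le[OF assms]) auto
qed

text \<open>The kernel is even, and folding pairs \<open>u\<close> with \<open>- u\<close>, the very
  pairing that yields one arctangent for each prime.\<close>

lemma integral_K_S_N:
  assumes a: "a > 0" and e: "e = 1 \<or> e = - 1"
  shows "e * Im (LBINT u. K a u *\<^sub>R euler_log (\<lambda>_. \<i> * of_real e) N (Complex (1/2) (\<tau> * u)))
    = (LBINT u:{0..}. K a u * S_N \<tau> N u)"
proof -
  define E where "E = (\<lambda>u. euler_log (\<lambda>_. \<i> * of_real e) N (Complex (1/2) (\<tau> * u)))"
  have "norm (\<i> * of_real e) \<le> 1" using e by (auto simp: norm_mult)
  note E = euler_log_line[OF this, of N \<tau>, folded E_def]
  have i: "integrable lborel (\<lambda>u. K a u *\<^sub>R E u)"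
    using integrable_K_scaleR[OF a] E unfolding E_def by blast
  note f = integral_fold_half_line[OF i]
  have "e * Im (LBINT u. K a u *\<^sub>R E u) = e * (LBINT u. Im (indicator {0..} u *\<^sub>R (K a u *\<^sub>R E u + K a (- u) *\<^sub>R E (- u))))"
    unfolding f(1) using f(2) unfolding set_lebesgue_integral_def set_integrable_def by (simp only: integral_Im)
  also have "\<dots> = (LBINT u. e * Im (indicator {0..} u *\<^sub>R (K a u *\<^sub>R E u + K a (- u) *\<^sub>R E (- u))))"
    by simp
  also have "(\<lambda>u. e * Im (indicator {0..} u *\<^sub>R (K a u *\<^sub>R E u + K a (- u) *\<^sub>R E (- u)))) =
     (\<lambda>u. indicator {0..} u *\<^sub>R (K a u * S_N \<tau> N u))"
  proof
    fix u
    have Km: "K a (- u) = K a u" by (simp add: K_def)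
    have "e * Im (E u + E (- u)) = S_N \<tau> N u" unfolding E_def by (rule euler_log_pair_eq_S_N[OF e])
    then show "e * Im (indicator {0..} u *\<^sub>R (K a u *\<^sub>R E u + K a (- u) *\<^sub>R E (- u))) =
        indicator {0..} u *\<^sub>R (K a u * S_N \<tau> N u)"
      unfolding Km scaleR_add_right[symmetric] scaleR_complex.simps real_scaleR_def by (metis mult.left_commute)
  qed
  finally show ?thesis unfolding E_def set_lebesgue_integral_def .
qed

lemma truncated_kernel_tendsto:
  fixes E :: "real \<Rightarrow> complex"
  assumes a: "a > 0" and E: "E \<in> borel_measurable borel" "\<And>u. norm (E u) \<le> C"
  shows "((\<lambda>U. LBINT u:{-U..U}. (K a u * (1 - u\<^sup>2 / U\<^sup>2)) *\<^sub>R E u) \<longlongrightarrow> (LBINT u. K a u *\<^sub>R E u)) at_top"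
  unfolding set_lebesgue_integral_def
proof (rule integral_dominated_convergence_at_top[where w = "\<lambda>u. K a u * C"])
  show "(\<lambda>u. K a u *\<^sub>R E u) \<in> borel_measurable lborel" using E(1) by measurable
  show "(\<lambda>u. indicator {-U..U} u *\<^sub>R (K a u * (1 - u\<^sup>2 / U\<^sup>2)) *\<^sub>R E u) \<in> borel_measurable lborel" for U
    using E(1) by measurable
  show "integrable lborel (\<lambda>u. K a u * C)" using integrable_K[OF a] by simp
  show "AE u in lborel. ((\<lambda>U. indicator {-U..U} u *\<^sub>R (K a u * (1 - u\<^sup>2 / U\<^sup>2)) *\<^sub>R E u) \<longlongrightarrow> K a u *\<^sub>R E u) at_top"
  proof (rule AE_I2)
    fix u :: real
    have "((\<lambda>U. 1 - u\<^sup>2 / U\<^sup>2) \<longlongrightarrow> 1) at_top" by real_asymp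
    then have "((\<lambda>U. (K a u * (1 - u\<^sup>2 / U\<^sup>2)) *\<^sub>R E u) \<longlongrightarrow> (K a u * 1) *\<^sub>R E u) at_top"
      by (intro tendsto_intros)
    then have "((\<lambda>U. (K a u * (1 - u\<^sup>2 / U\<^sup>2)) *\<^sub>R E u) \<longlongrightarrow> K a u *\<^sub>R E u) at_top" by simp
    then show "((\<lambda>U. indicator {-U..U} u *\<^sub>R (K a u * (1 - u\<^sup>2 / U\<^sup>2)) *\<^sub>R E u) \<longlongrightarrow> K a u *\<^sub>R E u) at_top"
    proof (rule Lim_transform_eventually)
      show "\<forall>\<^sub>F U in at_top. (K a u * (1 - u\<^sup>2 / U\<^sup>2)) *\<^sub>R E u = indicator {-U..U} u *\<^sub>R (K a u * (1 - u\<^sup>2 / U\<^sup>2)) *\<^sub>R E u"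
        using eventually_ge_at_top[of "\<bar>u\<bar>"] by eventually_elim (auto simp: indicator_def)
    qed
  qed
  show "\<forall>\<^sub>F U in at_top. AE u in lborel. norm (indicator {-U..U} u *\<^sub>R (K a u * (1 - u\<^sup>2 / U\<^sup>2)) *\<^sub>R E u) \<le> K a u * C"
    using eventually_gt_at_top[of 0]
  proof eventually_elim
    case (elim U)
    show ?case
    proof (rule AE_I2)
      fix u :: real
      have C: "C \<ge> 0" using E(2)[of 0] norm_ge_zero order_trans by blast
      show "norm (indicator {-U..U} u *\<^sub>R (K a u * (1 - u\<^sup>2 / U\<^sup>2)) *\<^sub>R E u) \<le> K a u * C"
      proof (cases "\<bar>u\<bar> \<le> U")
        case True
        have "u\<^sup>2 \<le> U\<^sup>2" using True elim by (metis abs_ge_zero power2_abs power_mono)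
        then have "0 \<le> 1 - u\<^sup>2 / U\<^sup>2" "1 - u\<^sup>2 / U\<^sup>2 \<le> 1" using elim by (auto simp: divide_le_eq)
        then have "K a u * (1 - u\<^sup>2 / U\<^sup>2) * norm (E u) \<le> K a u * 1 * C"
          using E(2)[of u] K_pos[of a u] C by (intro mult_mono) auto
        then show ?thesis using True K_pos[of a u] \<open>0 \<le> 1 - u\<^sup>2 / U\<^sup>2\<close> by (auto simp: abs_mult indicator_def)
      next
        case False
        then show ?thesis using C K_pos[of a u] by (auto simp: indicator_def)
      qed
    qed
  qed
qed

lemma kappa_nonneg: "kappa a b \<ge> 0"
  unfolding kappa_def set_lebesgue_integral_def by (auto intro!: Bochner_Integration.integral_nonneg)

text \<open>Termwise estimates of the arctangents would grow with \<open>N\<close>. Shifting to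
  height \<open>- b\<close> yields a partial sum of a convergent series instead; a finite Euler
  product is bounded up to the critical line, so \<open>U\<close> can tend to infinity, which
  removes the errors from the sides and from the weight.\<close>

lemma integral_K_S_N_bound:
  assumes ab: "a > 0" "0 < b" "b < pi / 2" and \<tau>: "\<tau> > 0"
  shows "(LBINT u:{0..}. K a u * S_N \<tau> N u) \<le> kappa a b * (\<Sum>p\<le>N. prime_ln (b * \<tau> + 1/2) p)"
proof -
  define F where "F = (\<lambda>z. euler_log (\<lambda>_. \<i> * of_real 1) N (1/2 + \<i> * of_real \<tau> * z))"
  define E where "E = (\<lambda>u. euler_log (\<lambda>_. \<i> * of_real 1) N (Complex (1/2) (\<tau> * u)))"
  define C where "C = (\<Sum>p\<le>N. prime_ln (1/2) p)"
  define \<beta> where "\<beta> = (\<Sum>p\<le>N. prime_ln (b * \<tau> + 1/2) p)"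
  \<comment> \<open>The preimage of \<open>Re s > 0\<close>, where \<open>euler_log\<close> is
    holomorphic, under \<open>s = 1/2 + \<i> * \<tau> * z\<close>.\<close>
  define S where "S = {z. Im z < 1 / (2 * \<tau>)}"
  have n1: "norm (\<i> * of_real 1) \<le> 1" by simp
  have E: "E \<in> borel_measurable borel" "\<And>u. norm (E u) \<le> C"
    unfolding E_def C_def by (rule euler_log_line[OF n1])+
  have C: "C \<ge> 0" unfolding C_def by (intro sum_nonneg prime_ln_nonneg) auto
  have Re: "1/2 + \<i> * of_real \<tau> * Complex u (- v) = Complex (1/2 + v * \<tau>) (\<tau> * u)" for u v
    by (simp add: complex_eq_iff)
  have FE: "F (of_real u) = E u" for u
    unfolding F_def E_def using Re[of u 0] by (simp add: complex_of_real_def)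
  have bound: "norm (LBINT u:{-U..U}. (K a u * (1 - u\<^sup>2 / U\<^sup>2)) *\<^sub>R E u) \<le>
     kappa a b * (1 + (b\<^sup>2 + 2 * b) / U) * \<beta> + 2 * b * ((b + 2) * (b * C) * exp (- (a * cos b) * cosh U))"
    if U: "U \<ge> 1" for U
    unfolding FE[symmetric]
  proof (rule kernel_shift[where S = S])
    show "open S" "convex S" unfolding S_def by (auto simp: open_halfspace_Im_lt convex_halfspace_Im_lt)
    have "(euler_log (\<lambda>_. \<i> * of_real 1) N \<circ> (\<lambda>z. 1/2 + \<i> * of_real \<tau> * z)) holomorphic_on S"
    proof (rule holomorphic_on_compose_gen[OF _ holomorphic_euler_log[OF n1]])
      show "(\<lambda>z. 1/2 + \<i> * of_real \<tau> * z) ` S \<subseteq> {s. Re s > 0}"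
        using \<tau> by (auto simp: S_def field_simps)
    qed (intro holomorphic_intros)
    then show "F holomorphic_on S" unfolding F_def o_def .
    show "Complex u (- v) \<in> S" if "0 \<le> v" for u v using that \<tau>
      by (auto simp: S_def intro: order_le_less_trans[of _ 0])
    show "v * norm (F (Complex u (- v))) \<le> b * C" if "0 \<le> v" "v \<le> b" for u v
      unfolding F_def Re C_def using that \<tau> ab
      by (intro mult_mono norm_euler_log_le[OF n1]) auto
    show "norm (F (Complex u (- b))) \<le> \<beta>" for u
      unfolding F_def Re \<beta>_def using ab \<tau> by (intro norm_euler_log_le[OF n1]) (auto simp: add_pos_pos)
  qed (use ab U in auto)
  have "norm (LBINT u. K a u *\<^sub>R E u) \<le> kappa a b * (1 + 0) * \<beta> + 2 * b * ((b + 2) * (b * C) * 0)"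
  proof (rule tendsto_le[OF trivial_limit_at_top_linorder])
    show "((\<lambda>U. norm (LBINT u:{-U..U}. (K a u * (1 - u\<^sup>2 / U\<^sup>2)) *\<^sub>R E u)) \<longlongrightarrow> norm (LBINT u. K a u *\<^sub>R E u)) at_top"
      by (intro tendsto_norm truncated_kernel_tendsto[OF ab(1) E])
    have \<alpha>: "a * cos b > 0" using ab by (intro mult_pos_pos cos_gt_zero_pi) auto
    have l1: "((\<lambda>U. (b\<^sup>2 + 2 * b) / U) \<longlongrightarrow> 0) at_top" by real_asymp
    have l2: "((\<lambda>U. exp (- (a * cos b) * cosh U)) \<longlongrightarrow> 0) at_top"
    proof (rule filterlim_compose[OF exp_at_bot])
      show "LIM U at_top. - (a * cos b) * cosh U :> at_bot"
        using \<alpha> by (intro filterlim_tendsto_neg_mult_at_bot[OF tendsto_const]) (auto simp: cosh_real_at_top)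
    qed
    show "((\<lambda>U. kappa a b * (1 + (b\<^sup>2 + 2 * b) / U) * \<beta> + 2 * b * ((b + 2) * (b * C) * exp (- (a * cos b) * cosh U)))
      \<longlongrightarrow> kappa a b * (1 + 0) * \<beta> + 2 * b * ((b + 2) * (b * C) * 0)) at_top"
      by (intro tendsto_intros l1 l2)
    show "\<forall>\<^sub>F U in at_top. norm (LBINT u:{-U..U}. (K a u * (1 - u\<^sup>2 / U\<^sup>2)) *\<^sub>R E u) \<le>
     kappa a b * (1 + (b\<^sup>2 + 2 * b) / U) * \<beta> + 2 * b * ((b + 2) * (b * C) * exp (- (a * cos b) * cosh U))"
      using eventually_ge_at_top[of 1] by eventually_elim (rule bound)
  qed
  then have "norm (LBINT u. K a u *\<^sub>R E u) \<le> kappa a b * \<beta>" by simp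
  moreover have "(LBINT u:{0..}. K a u * S_N \<tau> N u) = Im (LBINT u. K a u *\<^sub>R E u)"
    using integral_K_S_N[OF ab(1), of 1 N \<tau>] unfolding E_def by simp
  ultimately show ?thesis unfolding \<beta>_def using abs_Im_le_cmod order_trans abs_le_D1 by metis
qed

text \<open>The term with \<open>zeta_N\<close> only lowers \<open>I_N\<close>, and completing the
  prime sum gives a bound free of \<open>N\<close>; this makes the supremum in
  \<open>theorem3\<close> finite.\<close>

lemma I_N_bounded:
  assumes "a > 0" "0 < b" "b < pi / 2" "\<tau> > 0" "b * \<tau> > 1/2"
  shows "I_N a b \<tau> N \<le> kappa a b * (\<Sum>p. prime_ln (b * \<tau> + 1/2) p) / pi"
proof -
  define \<gamma> where "\<gamma> = b * \<tau> + 1/2"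
  have \<gamma>: "\<gamma> > 1" using assms by (simp add: \<gamma>_def)
  have "(\<Sum>p\<le>N. prime_ln \<gamma> p) \<le> (\<Sum>p. prime_ln \<gamma> p)"
    using \<gamma> by (intro sum_le_suminf summable_prime_ln) (auto intro: prime_ln_nonneg)
  then have "(LBINT u:{0..}. K a u * S_N \<tau> N u) \<le> kappa a b * (\<Sum>p. prime_ln \<gamma> p)"
    using integral_K_S_N_bound[OF assms(1-4), of N] mult_left_mono[OF _ kappa_nonneg] order_trans
    unfolding \<gamma>_def by blast
  moreover have "kappa a b * ln (zeta_N N \<gamma>) \<ge> 0" using kappa_nonneg ln_zeta_N_nonneg[OF \<gamma>] by simp
  ultimately show ?thesis unfolding I_N_def \<gamma>_def[symmetric] by (simp add: divide_right_mono)
qed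

section \<open>Simultaneous approximation\<close>

text \<open>Splitting the coefficients into positive and negative parts and exponentiating gives two
  equal products of prime powers; unique factorisation then equates \<open>nat (k p)\<close> with
  \<open>nat (- k p)\<close>.\<close>

lemma ln_primes_independent:
  fixes k :: "nat \<Rightarrow> int"
  assumes P: "finite P" "\<And>p. p \<in> P \<Longrightarrow> prime p"
    and sum: "(\<Sum>p\<in>P. of_int (k p) * ln (real p)) = 0" and p: "p \<in> P"
  shows "k p = 0"
proof -
  define A where "A = (\<lambda>f :: nat \<Rightarrow> nat. \<Prod>q\<in>P. q ^ f q)"
  have pos: "A f > 0" for f unfolding A_def using P prime_gt_0_nat by (intro prod_pos) auto
  have lnA: "ln (real (A f)) = (\<Sum>q\<in>P. real (f q) * ln (real q))" for f
  proof -
    have "ln (real (A f)) = ln (\<Prod>q\<in>P. real q ^ f q)" by (simp add: A_def)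
    also have "\<dots> = (\<Sum>q\<in>P. ln (real q ^ f q))" using P prime_gt_0_nat by (intro ln_prod) auto
    also have "\<dots> = (\<Sum>q\<in>P. real (f q) * ln (real q))"
      using P prime_gt_0_nat by (intro sum.cong refl) (auto simp: ln_realpow)
    finally show ?thesis .
  qed
  have "ln (real (A (\<lambda>q. nat (k q)))) - ln (real (A (\<lambda>q. nat (- k q)))) = (\<Sum>q\<in>P. of_int (k q) * ln (real q))"
    unfolding lnA sum_subtractf[symmetric]
  proof (intro sum.cong refl)
    fix q
    have "real (nat (k q)) - real (nat (- k q)) = of_int (k q)" by (cases "k q \<ge> 0") auto
    then show "real (nat (k q)) * ln (real q) - real (nat (- k q)) * ln (real q) = of_int (k q) * ln (real q)"
      by (metis left_diff_distrib)
  qed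
  then have "ln (real (A (\<lambda>q. nat (k q)))) = ln (real (A (\<lambda>q. nat (- k q))))" using sum by simp
  then have "A (\<lambda>q. nat (k q)) = A (\<lambda>q. nat (- k q))"
    using pos ln_inj_iff by (metis of_nat_0_less_iff of_nat_eq_iff)
  then have "multiplicity p (A (\<lambda>q. nat (k q))) = multiplicity p (A (\<lambda>q. nat (- k q)))" by simp
  moreover have "multiplicity p (A f) = f p" for f
    unfolding A_def using P p by (subst multiplicity_prod_prime_powers) auto
  ultimately have "nat (k p) = nat (- k p)" by simp
  then show ?thesis by linarith
qed

lemma norm_cis_diff_le: "norm (cis x - cis y) \<le> \<bar>x - y\<bar>"
proof -
  have "cis x - cis y = cis y * (exp (\<i> * of_real (x - y)) - 1)"
    unfolding cis_conv_exp[symmetric] by (simp add: algebra_simps cis_mult)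
  then have "norm (cis x - cis y) = 2 * \<bar>sin ((x - y) / 2)\<bar>"
    by (simp only: norm_mult norm_cis dist_exp_i_1 mult_1)
  also have "\<dots> \<le> 2 * \<bar>(x - y) / 2\<bar>" by (intro mult_left_mono abs_sin_x_le_abs_x) auto
  finally show ?thesis by simp
qed

lemma cis_add_2pi_int: "cis (x + 2 * pi * of_int n) = cis x"
  by (simp add: cis_mult[symmetric] cis_multiple_2pi[of "of_int n", simplified])

text \<open>Kronecker's theorem with a real parameter, for the numbers
  \<open>- ln p / (2 * pi)\<close> and one common target; their independence over the integers is
  that of the \<open>ln p\<close>.\<close>

lemma kronecker_primes:
  fixes \<alpha> :: real
  assumes P: "finite P" "\<And>p. p \<in> P \<Longrightarrow> prime p" and \<eta>: "\<eta> > 0"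
  obtains t where "\<And>p. p \<in> P \<Longrightarrow> norm (cis (- (t * ln (real p))) - cis (2 * pi * \<alpha>)) < \<eta>"
proof -
  define n where "n = card P"
  obtain q where q: "bij_betw q {..<n} P" using ex_bij_betw_nat_finite[OF P(1)] by (auto simp: n_def atLeast0LessThan)
  define \<theta> where "\<theta> = (\<lambda>i. - ln (real (q i)) / (2 * pi))"
  have qP: "q i \<in> P" if "i < n" for i using q that by (auto simp: bij_betw_def)
  have inj: "inj_on \<theta> {..<n}"
  proof (rule inj_onI)
    fix i j assume ij: "i \<in> {..<n}" "j \<in> {..<n}" "\<theta> i = \<theta> j"
    then have "ln (real (q i)) = ln (real (q j))" by (simp add: \<theta>_def)
    moreover have "real (q i) > 0" "real (q j) > 0" using ij qP P(2) prime_gt_0_nat by auto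
    ultimately have "q i = q j" by simp
    then show "i = j" using q ij by (auto simp: bij_betw_def inj_on_def)
  qed
  \<comment> \<open>Views the reals as a module over the integers, the setting in which
    \<open>dependent\<close> expresses the needed independence.\<close>
  interpret Modules.module "(\<lambda>r. (*) (real_of_int r))"
    by (simp add: Modules.module.intro distrib_left mult.commute)
  have "\<not> dependent (\<theta> ` {..<n})"
  proof
    assume "dependent (\<theta> ` {..<n})"
    then obtain u where u: "\<exists>v\<in>\<theta> ` {..<n}. u v \<noteq> 0" "(\<Sum>v\<in>\<theta> ` {..<n}. real_of_int (u v) * v) = 0"
      by (subst (asm) dependent_finite) auto
    \<comment> \<open>The dependence has its coefficients at the values of \<theta>; the inverse
      enumeration carries them over to the primes.\<close>
    define q' where "q' = inv_into {..<n} q"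
    have q': "q' (q i) = i" if "i < n" for i using q that by (simp add: q'_def bij_betw_def)
    have "0 = (\<Sum>i<n. real_of_int (u (\<theta> i)) * \<theta> i)" using u(2) by (simp only: sum.reindex[OF inj] o_def)
    also have "\<dots> = (\<Sum>i<n. real_of_int (u (\<theta> (q' (q i)))) * (- ln (real (q i)) / (2 * pi)))"
      by (intro sum.cong refl) (simp add: q' \<theta>_def)
    also have "\<dots> = (\<Sum>p\<in>P. real_of_int (u (\<theta> (q' p))) * (- ln (real p) / (2 * pi)))"
      using sum.reindex_bij_betw[OF q] by simp
    also have "\<dots> = (\<Sum>p\<in>P. real_of_int (u (\<theta> (q' p))) * ln (real p)) * (- 1 / (2 * pi))"
      unfolding sum_distrib_right by (intro sum.cong refl) simp
    finally have "(\<Sum>p\<in>P. real_of_int (u (\<theta> (q' p))) * ln (real p)) = 0" by simp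
    then have "u (\<theta> (q' p)) = 0" if "p \<in> P" for p
      using ln_primes_independent[of P "\<lambda>p. u (\<theta> (q' p))" p] P that by blast
    then have "u (\<theta> i) = 0" if "i < n" for i using that qP q' by metis
    then show False using u(1) by auto
  qed
  then obtain t h where th: "\<And>i. i < n \<Longrightarrow> \<bar>t * \<theta> i - of_int (h i) - \<alpha>\<bar> < \<eta> / (2 * pi)"
    using Kronecker_thm_1[OF _ inj, of "\<eta> / (2 * pi)" "\<lambda>_. \<alpha>"] \<eta> by auto
  show ?thesis
  proof (rule that[of t])
    fix p assume "p \<in> P"
    then obtain i where i: "i < n" "p = q i" using q by (auto simp: bij_betw_def)
    have "- (t * ln (real p)) = 2 * pi * (t * \<theta> i)" unfolding i(2) \<theta>_def by (simp add: field_simps)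
    then have "norm (cis (- (t * ln (real p))) - cis (2 * pi * \<alpha>)) =
        norm (cis (2 * pi * (t * \<theta> i)) - cis (2 * pi * \<alpha> + 2 * pi * of_int (h i)))"
      using cis_add_2pi_int by simp
    also have "\<dots> \<le> \<bar>2 * pi * (t * \<theta> i) - (2 * pi * \<alpha> + 2 * pi * of_int (h i))\<bar>" by (rule norm_cis_diff_le)
    also have "2 * pi * (t * \<theta> i) - (2 * pi * \<alpha> + 2 * pi * of_int (h i)) = 2 * pi * (t * \<theta> i - of_int (h i) - \<alpha>)"
      by (simp add: algebra_simps)
    also have "\<bar>\<dots>\<bar> = 2 * pi * \<bar>t * \<theta> i - of_int (h i) - \<alpha>\<bar>" by (simp add: abs_mult)
    also have "\<dots> < \<eta>" using th[OF i(1)] by (simp add: field_simps)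
    finally show "norm (cis (- (t * ln (real p))) - cis (2 * pi * \<alpha>)) < \<eta>" .
  qed
qed

text \<open>Pigeonhole: the vector of residues of \<open>T \<theta>\<^sub>p\<close>, rounded to precision \<open>1/k\<close>, takes only finitely
  many values, and \<open>T - r\<close> is an almost period whenever \<open>r\<close> has the same rounded residues as \<open>T\<close>.\<close>

lemma almost_periods_relatively_dense:
  fixes \<theta> :: "nat \<Rightarrow> real"
  assumes P: "finite P" and \<eta>: "\<eta> > 0"
  obtains l where "\<And>T. \<exists>s. \<bar>s - T\<bar> \<le> l \<and> (\<forall>p\<in>P. norm (cis (s * \<theta> p) - 1) < \<eta>)"
proof -
  obtain k :: nat where k: "k > 0" "2 * pi / real k < \<eta>"
  proof -
    obtain k :: nat where "2 * pi / \<eta> < real k" using reals_Archimedean2 by blast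
    moreover from this have "real k > 0" using \<eta> by (smt (verit) divide_pos_pos pi_gt_zero)
    ultimately show ?thesis using that[of k] \<eta> by (simp add: field_simps)
  qed
  define x where "x = (\<lambda>T p. frac (T * \<theta> p / (2 * pi)))"
  define F where "F = (\<lambda>T. restrict (\<lambda>p. nat \<lfloor>real k * x T p\<rfloor>) P)"
  have "range F \<subseteq> P \<rightarrow>\<^sub>E {..<k}"
  proof (intro image_subsetI)
    fix T
    have "nat \<lfloor>real k * x T p\<rfloor> < k" for p
    proof -
      have "real k * x T p < real k * 1" using k frac_lt_1 by (intro mult_strict_left_mono) (auto simp: x_def)
      moreover have "real k * x T p \<ge> 0" by (simp add: x_def)
      ultimately have "\<lfloor>real k * x T p\<rfloor> < int k" by (simp add: floor_less_iff)
      then show ?thesis using k by linarith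
    qed
    then show "F T \<in> P \<rightarrow>\<^sub>E {..<k}" by (auto simp: F_def)
  qed
  then have fin: "finite (range F)" by (rule finite_subset) (use P in \<open>auto intro: finite_PiE\<close>)
  define r where "r = (\<lambda>v. SOME T. F T = v)"
  have r: "F (r (F T)) = F T" for T unfolding r_def by (rule someI[of _ T]) simp
  define l where "l = Max ((\<lambda>v. \<bar>r v\<bar>) ` range F)"
  show ?thesis
  proof (rule that[of l])
    fix T
    define s where "s = T - r (F T)"
    have "\<bar>r (F T)\<bar> \<le> l" unfolding l_def using fin by (intro Max_ge) auto
    then have "\<bar>s - T\<bar> \<le> l" by (simp add: s_def)
    moreover have "norm (cis (s * \<theta> p) - 1) < \<eta>" if p: "p \<in> P" for p
    proof -
      let ?a = "x T p" and ?b = "x (r (F T)) p"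
      have "nat \<lfloor>real k * ?a\<rfloor> = nat \<lfloor>real k * ?b\<rfloor>"
        using fun_cong[OF r[of T], of p] p by (simp add: F_def)
      moreover have "real k * ?a \<ge> 0" "real k * ?b \<ge> 0" by (auto simp: x_def)
      ultimately have "\<lfloor>real k * ?a\<rfloor> = \<lfloor>real k * ?b\<rfloor>" by (simp add: nat_eq_iff)
      then have "\<bar>real k * ?a - real k * ?b\<bar> < 1" by linarith
      then have "real k * \<bar>?a - ?b\<bar> < 1" by (simp add: abs_mult flip: right_diff_distrib)
      then have d: "\<bar>?a - ?b\<bar> < 1 / real k" using k by (simp add: field_simps)
      define m where "m = \<lfloor>T * \<theta> p / (2 * pi)\<rfloor> - \<lfloor>r (F T) * \<theta> p / (2 * pi)\<rfloor>"
      have "s * \<theta> p = 2 * pi * (?a - ?b) + 2 * pi * of_int m"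
        unfolding s_def x_def frac_def m_def by (simp add: field_simps)
      then have "cis (s * \<theta> p) = cis (2 * pi * (?a - ?b))" using cis_add_2pi_int by metis
      then have "norm (cis (s * \<theta> p) - 1) \<le> \<bar>2 * pi * (?a - ?b) - 0\<bar>"
        using norm_cis_diff_le[of "2 * pi * (?a - ?b)" 0] by simp
      also have "\<dots> = 2 * pi * \<bar>?a - ?b\<bar>" by (simp add: abs_mult)
      also have "\<dots> \<le> 2 * pi * (1 / real k)" using d by (intro mult_left_mono) auto
      finally show ?thesis using k by simp
    qed
    ultimately show "\<exists>s. \<bar>s - T\<bar> \<le> l \<and> (\<forall>p\<in>P. norm (cis (s * \<theta> p) - 1) < \<eta>)" by blast
  qed
qed

text \<open>Kronecker's theorem gives one time \<open>t1\<close> of unknown position. Adding an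
  almost period close to \<open>T\<close> keeps the approximation and lands within
  \<open>l + \<bar>t1\<bar>\<close> of \<open>T\<close>.\<close>

lemma prime_powers_approximation:
  assumes e: "e = 1 \<or> e = - 1" and \<eta>: "\<eta> > 0"
  obtains l where "\<And>T. \<exists>t. \<bar>t - T\<bar> \<le> l \<and>
    (\<forall>p. prime p \<and> p \<le> N \<longrightarrow> norm ((of_nat p :: complex) powr (- (\<i> * of_real t)) - \<i> * of_real e) < \<eta>)"
proof -
  define P where "P = {p. prime p \<and> p \<le> N}"
  have P: "finite P" "\<And>p. p \<in> P \<Longrightarrow> prime p" by (auto simp: P_def)
  \<comment> \<open>A quarter turn in the direction of \<open>e\<close>.\<close>
  have c: "cis (2 * pi * (e / 4)) = \<i> * of_real e" using e by (auto simp: complex_eq_iff)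
  obtain t1 where t1: "\<And>p. p \<in> P \<Longrightarrow> norm (cis (- (t1 * ln (real p))) - \<i> * of_real e) < \<eta> / 2"
    using kronecker_primes[OF P, of "\<eta> / 2" "e / 4"] \<eta> unfolding c by auto
  obtain l where l: "\<And>T. \<exists>s. \<bar>s - T\<bar> \<le> l \<and> (\<forall>p\<in>P. norm (cis (s * (- ln (real p))) - 1) < \<eta> / 2)"
    using almost_periods_relatively_dense[OF P(1), of "\<eta> / 2" "\<lambda>p. - ln (real p)"] \<eta> by auto
  show ?thesis
  proof (rule that[of "l + \<bar>t1\<bar>"])
    fix T
    obtain s where s: "\<bar>s - T\<bar> \<le> l" "\<And>p. p \<in> P \<Longrightarrow> norm (cis (s * (- ln (real p))) - 1) < \<eta> / 2"
      using l by blast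
    have "norm ((of_nat p :: complex) powr (- (\<i> * of_real (s + t1))) - \<i> * of_real e) < \<eta>" if "prime p" "p \<le> N" for p
    proof -
      have p: "p \<in> P" using that by (simp add: P_def)
      have i: "\<i> * of_real (s + t1) = Complex 0 (s + t1)" by (simp add: complex_eq_iff)
      have "(of_nat p :: complex) powr (- (\<i> * of_real (s + t1))) = cis (- ((s + t1) * ln (real p)))"
        unfolding i using prime_gt_0_nat[OF that(1)] by (subst nat_powr_Complex) auto
      also have "\<dots> = cis (s * (- ln (real p))) * cis (- (t1 * ln (real p)))"
        by (simp add: cis_mult algebra_simps)
      also have "\<dots> - \<i> * of_real e = (cis (s * (- ln (real p))) - 1) * cis (- (t1 * ln (real p))) +
          (cis (- (t1 * ln (real p))) - \<i> * of_real e)" by (simp add: algebra_simps)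
      also have "norm \<dots> \<le> norm ((cis (s * (- ln (real p))) - 1) * cis (- (t1 * ln (real p)))) +
          norm (cis (- (t1 * ln (real p))) - \<i> * of_real e)" by (rule norm_triangle_ineq)
      also have "\<dots> < \<eta> / 2 + \<eta> / 2"
        unfolding norm_mult norm_cis using s(2)[OF p] t1[OF p] by simp
      finally show ?thesis by simp
    qed
    moreover have "\<bar>(s + t1) - T\<bar> \<le> l + \<bar>t1\<bar>" using s(1) by linarith
    ultimately show "\<exists>t. \<bar>t - T\<bar> \<le> l + \<bar>t1\<bar> \<and>
      (\<forall>p. prime p \<and> p \<le> N \<longrightarrow> norm ((of_nat p :: complex) powr (- (\<i> * of_real t)) - \<i> * of_real e) < \<eta>)"
      by blast
  qed
qed

section \<open>Large values\<close>

lemma set_integrable_truncated_kernel: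
  fixes F :: "real \<Rightarrow> complex"
  assumes "continuous_on {-U..U} F"
  shows "set_integrable lborel {-U..U} (\<lambda>u. (K a u * (1 - u\<^sup>2 / U\<^sup>2)) *\<^sub>R F u)"
  unfolding K_def divide_inverse using assms by (intro borel_integrable_atLeastAtMost' continuous_intros) auto

lemma truncated_kernel_bounds:
  assumes "U > 0" shows "0 \<le> indicator {-U..U} u * (K a u * (1 - u\<^sup>2 / U\<^sup>2))"
    and "indicator {-U..U} u * (K a u * (1 - u\<^sup>2 / U\<^sup>2)) \<le> K a u"
proof -
  have "0 \<le> 1 - u\<^sup>2 / U\<^sup>2" "1 - u\<^sup>2 / U\<^sup>2 \<le> 1" if "\<bar>u\<bar> \<le> U"
  proof -
    have "u\<^sup>2 \<le> U\<^sup>2" using that assms by (metis abs_ge_zero power2_abs power_mono)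
    then show "0 \<le> 1 - u\<^sup>2 / U\<^sup>2" "1 - u\<^sup>2 / U\<^sup>2 \<le> 1" using assms by (auto simp: divide_le_eq)
  qed
  then show "0 \<le> indicator {-U..U} u * (K a u * (1 - u\<^sup>2 / U\<^sup>2))"
    "indicator {-U..U} u * (K a u * (1 - u\<^sup>2 / U\<^sup>2)) \<le> K a u"
    using K_pos[of a u] by (auto simp: indicator_def abs_le_iff mult_left_le)
qed

lemma norm_truncated_kernel_integral_le:
  fixes F :: "real \<Rightarrow> complex"
  assumes F: "continuous_on {-U..U} F" "\<And>u. \<bar>u\<bar> \<le> U \<Longrightarrow> norm (F u) \<le> C" and U: "U > 0" and a: "a > 0"
  shows "norm (LBINT u:{-U..U}. (K a u * (1 - u\<^sup>2 / U\<^sup>2)) *\<^sub>R F u) \<le> C * K_hat_0 a"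
proof -
  have C: "C \<ge> 0" using order_trans[OF norm_ge_zero F(2)[of 0]] U by simp
  have "norm (LBINT u:{-U..U}. (K a u * (1 - u\<^sup>2 / U\<^sup>2)) *\<^sub>R F u) \<le> (LBINT u. C * K a u)"
    unfolding set_lebesgue_integral_def
  proof (rule Bochner_Integration.integral_norm_bound_integral)
    show "integrable lborel (\<lambda>u. indicator {-U..U} u *\<^sub>R (K a u * (1 - u\<^sup>2 / U\<^sup>2)) *\<^sub>R F u)"
      using set_integrable_truncated_kernel[OF F(1)] unfolding set_integrable_def .
    show "integrable lborel (\<lambda>u. C * K a u)" using integrable_K[OF a] by simp
    fix u
    show "norm (indicator {-U..U} u *\<^sub>R (K a u * (1 - u\<^sup>2 / U\<^sup>2)) *\<^sub>R F u) \<le> C * K a u"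
    proof (cases "\<bar>u\<bar> \<le> U")
      case True
      have "norm (indicator {-U..U} u *\<^sub>R (K a u * (1 - u\<^sup>2 / U\<^sup>2)) *\<^sub>R F u)
          = (indicator {-U..U} u * (K a u * (1 - u\<^sup>2 / U\<^sup>2))) * norm (F u)"
        using truncated_kernel_bounds(1)[OF U, of u a] by (simp add: abs_mult[symmetric] mult.assoc[symmetric])
      also have "\<dots> \<le> K a u * C"
        using truncated_kernel_bounds[OF U, of u a] F(2)[OF True] K_pos[of a u] by (intro mult_mono) auto
      finally show ?thesis by (simp add: mult.commute)
    next
      case False
      then show ?thesis using C K_pos[of a u] by (auto simp: indicator_def)
    qed
  qed
  also have "\<dots> = C * K_hat_0 a" by (simp add: K_hat_0_def)
  finally show ?thesis .
qed

text \<open>The truncated kernel lies between 0 and \<open>K a\<close>, so its mass is at most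
  \<open>K_hat_0 a\<close>; since this mass may be smaller, \<open>X\<close> has to be
  nonnegative.\<close>

lemma truncated_kernel_integral_upper:
  fixes F :: "real \<Rightarrow> complex" and e X :: real
  assumes F: "continuous_on {-U..U} F" "\<And>u. \<bar>u\<bar> \<le> U \<Longrightarrow> e * Im (F u) \<le> X" and U: "U > 0" and a: "a > 0" and X: "X \<ge> 0"
  shows "e * Im (LBINT u:{-U..U}. (K a u * (1 - u\<^sup>2 / U\<^sup>2)) *\<^sub>R F u) \<le> X * K_hat_0 a"
proof -
  let ?f = "\<lambda>u. indicator {-U..U} u *\<^sub>R (K a u * (1 - u\<^sup>2 / U\<^sup>2)) *\<^sub>R F u"
  have i: "integrable lborel ?f"
    using set_integrable_truncated_kernel[OF F(1)] unfolding set_integrable_def .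
  have "e * Im (LBINT u:{-U..U}. (K a u * (1 - u\<^sup>2 / U\<^sup>2)) *\<^sub>R F u) = (LBINT u. e * Im (?f u))"
    unfolding set_lebesgue_integral_def using i by (simp only: integral_Im integral_mult_right_zero)
  also have "\<dots> \<le> (LBINT u. X * K a u)"
  proof (rule Bochner_Integration.integral_mono)
    show "integrable lborel (\<lambda>u. e * Im (?f u))" using i by (intro integrable_mult_right integrable_Im)
    show "integrable lborel (\<lambda>u. X * K a u)" using integrable_K[OF a] by simp
    fix u
    let ?k = "indicator {-U..U} u * (K a u * (1 - u\<^sup>2 / U\<^sup>2))"
    have "e * Im (?f u) = ?k * (e * Im (F u))" by simp
    also have "\<dots> \<le> ?k * X"
    proof (cases "\<bar>u\<bar> \<le> U")
      case True then show ?thesis using F(2)[OF True] truncated_kernel_bounds(1)[OF U] by (intro mult_left_mono) auto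
    next
      case False then show ?thesis by (auto simp: indicator_def)
    qed
    also have "\<dots> \<le> K a u * X" using truncated_kernel_bounds(2)[OF U] X by (intro mult_right_mono)
    finally show "e * Im (?f u) \<le> X * K a u" by (simp add: mult.commute)
  qed
  also have "\<dots> = X * K_hat_0 a" by (simp add: K_hat_0_def)
  finally show ?thesis .
qed

lemma K_hat_0_pos: assumes a: "a > 0" shows "K_hat_0 a > 0"
proof -
  have "(LBINT u. indicator {-1..1::real} u *\<^sub>R exp (- a * cosh 1)) \<le> (LBINT u. K a u)"
  proof (rule Bochner_Integration.integral_mono)
    show "integrable lborel (\<lambda>u. indicator {-1..1::real} u *\<^sub>R exp (- a * cosh 1))"
      using borel_integrable_atLeastAtMost'[of "-1" 1 "\<lambda>_. exp (- a * cosh 1)"]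
      unfolding set_integrable_def by auto
    fix u :: real
    show "indicator {-1..1} u *\<^sub>R exp (- a * cosh 1) \<le> K a u"
    proof (cases "\<bar>u\<bar> \<le> 1")
      case True
      have "cosh \<bar>u\<bar> \<le> cosh 1" using True by (subst cosh_real_nonneg_le_iff) auto
      then have "exp (- a * cosh 1) \<le> K a u" using a by (simp add: K_def)
      then show ?thesis using True by (auto simp: indicator_def)
    next
      case False then show ?thesis using K_pos[of a u] by (auto simp: indicator_def)
    qed
  qed (rule integrable_K[OF a])
  moreover have "(LBINT u. indicator {-1..1::real} u *\<^sub>R exp (- a * cosh 1)) = 2 * exp (- a * cosh (1::real))" by simp
  moreover have "2 * exp (- a * cosh (1::real)) > 0" by simp
  ultimately show ?thesis unfolding K_hat_0_def by linarith
qed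

text \<open>The small primes contribute nearly the integral of \<open>K a * S_N\<close>, the rest at
  most nearly \<open>kappa a b * ln (zeta_N M \<gamma>)\<close>; the difference is
  \<open>pi * I_N\<close>. The threshold \<open>T1\<close> is independent of \<delta>, which later
  permits the limit \<delta> \<rightarrow> 0 for fixed \<open>T\<close>.\<close>

lemma zeta_log_integral_lower_bound:
  assumes RH: "riemann_hypothesis" and ab: "a > 0" "0 < b" "b < pi / 2" and \<tau>: "\<tau> > 0" "b * \<tau> > 1/2"
    and e: "e = 1 \<or> e = - 1" and M: "M \<ge> 1" and \<epsilon>: "\<epsilon> > 0"
  obtains c l T1 \<delta>0 where "\<delta>0 > 0" "\<And>T. T \<ge> T1 \<Longrightarrow> \<exists>t0. \<bar>t0 - T\<bar> \<le> l \<and>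
    ln (ln (ln T)) + c \<ge> 1 \<and> t0 - \<tau> * (ln (ln (ln T)) + c) > 0 \<and>
    (\<forall>\<delta>. 0 < \<delta> \<and> \<delta> < \<delta>0 \<longrightarrow>
      e * Im (LBINT u:{-(ln (ln (ln T)) + c)..ln (ln (ln T)) + c}. (K a u * (1 - u\<^sup>2 / (ln (ln (ln T)) + c)\<^sup>2)) *\<^sub>R
          zeta_log (Complex (1/2 + \<delta>) (t0 + \<tau> * u))) \<ge> pi * I_N a b \<tau> M - \<epsilon>)"
proof -
  define \<gamma> where "\<gamma> = b * \<tau> + 1/2"
  have \<gamma>: "\<gamma> > 1" using \<tau> by (simp add: \<gamma>_def)
  obtain C where C: "C > 0" "\<And>s. 1/2 < Re s \<Longrightarrow> Re s \<le> \<gamma> + 1 \<Longrightarrow> Im s \<ge> 3 \<Longrightarrow>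
      norm (zeta_log s) * (Re s - 1/2) \<le> C * ln (Im s)"
    using norm_zeta_log_le[OF RH, of "\<gamma> + 1"] by blast
  define CM where "CM = (\<Sum>p\<le>M. prime_ln (1/2) p)"
  have CM: "CM \<ge> 0" unfolding CM_def by (intro sum_nonneg prime_ln_nonneg) auto
  define \<beta> where "\<beta> = ln (zeta_N M \<gamma>)"
  have \<beta>: "\<beta> \<ge> 0" unfolding \<beta>_def by (rule ln_zeta_N_nonneg[OF \<gamma>])
  define A where "A = K_hat_0 a"
  have A: "A > 0" unfolding A_def by (rule K_hat_0_pos[OF ab(1)])
  have cb: "cos b > 0" using ab by (intro cos_gt_zero_pi) auto
  define \<alpha> where "\<alpha> = a * cos b"
  have \<alpha>: "\<alpha> > 0" using ab cb by (simp add: \<alpha>_def)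
  \<comment> \<open>Matches \<open>euler_log_diff\<close>: the error
    \<open>8 * (M + 1) * \<eta>\<close>, integrated against \<open>K a\<close>, is
    \<epsilon>/4.\<close>
  define \<eta> where "\<eta> = \<epsilon> / (32 * (real M + 1) * A)"
  have \<eta>: "\<eta> > 0" using \<epsilon> A by (simp add: \<eta>_def)
  have \<eta>A: "8 * (real M + 1) * \<eta> * A = \<epsilon> / 4"
  proof -
    have "(real M + 1) * A \<noteq> 0" using A by simp
    then show ?thesis unfolding \<eta>_def by (simp add: divide_simps)
  qed
  obtain l where l: "\<And>T. \<exists>t. \<bar>t - T\<bar> \<le> l \<and>
    (\<forall>p. prime p \<and> p \<le> M \<longrightarrow> norm ((of_nat p :: complex) powr (- (\<i> * of_real t)) - \<i> * of_real e) < \<eta>)"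
    using prime_powers_approximation[OF e \<eta>, of M] by blast
  obtain \<delta>1 where \<delta>1: "\<delta>1 > 0" "\<And>\<delta>. 0 < \<delta> \<Longrightarrow> \<delta> < \<delta>1 \<Longrightarrow> 1 - real M powr (- \<delta>) \<le> \<eta>"
  proof -
    have "((\<lambda>\<delta>. 1 - real M powr (- \<delta>)) \<longlongrightarrow> 1 - real M powr (- 0)) (at_right 0)"
      using M by (intro tendsto_intros) auto
    then have "((\<lambda>\<delta>. 1 - real M powr (- \<delta>)) \<longlongrightarrow> 0) (at_right 0)" using M by simp
    then have "\<forall>\<^sub>F \<delta> in at_right 0. 1 - real M powr (- \<delta>) < \<eta>" using \<eta> by (rule order_tendstoD(2))
    then show ?thesis using that unfolding eventually_at_right_field by (metis less_imp_le)
  qed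
  define \<delta>0 where "\<delta>0 = min 1 \<delta>1"
  have \<delta>0: "\<delta>0 > 0" using \<delta>1 by (simp add: \<delta>0_def)
  define E where "E = (\<lambda>u. euler_log (\<lambda>_. \<i> * of_real e) M (Complex (1/2) (\<tau> * u)))"
  have n1: "norm (\<i> * of_real e) \<le> 1" using e by (auto simp: norm_mult)
  have E: "E \<in> borel_measurable borel" "\<And>u. norm (E u) \<le> CM"
    unfolding E_def CM_def by (rule euler_log_line[OF n1])+
  define J where "J = (LBINT u. K a u *\<^sub>R E u)"
  have J: "e * Im J = pi * I_N a b \<tau> M + kappa a b * \<beta>"
    unfolding J_def E_def integral_K_S_N[OF ab(1) e] I_N_def \<beta>_def \<gamma>_def by simp
  have "\<forall>\<^sub>F U in at_top. norm ((LBINT u:{-U..U}. (K a u * (1 - u\<^sup>2 / U\<^sup>2)) *\<^sub>R E u) - J) < \<epsilon> / 4"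
    using tendstoD[OF truncated_kernel_tendsto[OF ab(1) E], of "\<epsilon> / 4"] \<epsilon> unfolding J_def dist_norm by simp
  moreover have "((\<lambda>U. kappa a b * ((b\<^sup>2 + 2 * b) / U) * \<beta>) \<longlongrightarrow> kappa a b * 0 * \<beta>) at_top"
  proof -
    have "((\<lambda>U. (b\<^sup>2 + 2 * b) / U) \<longlongrightarrow> 0) at_top" by real_asymp
    then show ?thesis by (intro tendsto_intros)
  qed
  then have "\<forall>\<^sub>F U in at_top. kappa a b * ((b\<^sup>2 + 2 * b) / U) * \<beta> < \<epsilon> / 4"
    using \<epsilon> by (intro order_tendstoD(2)) auto
  ultimately have "\<forall>\<^sub>F U in at_top. norm ((LBINT u:{-U..U}. (K a u * (1 - u\<^sup>2 / U\<^sup>2)) *\<^sub>R E u) - J) < \<epsilon> / 4 \<and>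
      kappa a b * ((b\<^sup>2 + 2 * b) / U) * \<beta> < \<epsilon> / 4" by eventually_elim blast
  then obtain U0 where U0: "\<And>U. U \<ge> U0 \<Longrightarrow> norm ((LBINT u:{-U..U}. (K a u * (1 - u\<^sup>2 / U\<^sup>2)) *\<^sub>R E u) - J) < \<epsilon> / 4"
      "\<And>U. U \<ge> U0 \<Longrightarrow> kappa a b * ((b\<^sup>2 + 2 * b) / U) * \<beta> < \<epsilon> / 4"
    unfolding eventually_at_top_linorder by blast
  \<comment> \<open>Makes
    \<open>\<alpha> * cosh U \<ge> \<alpha> * exp U / 2 = 2 * ln (ln T)\<close>, so the kernel on
    the sides is at most \<open>1 / (ln T)\<^sup>2\<close>, enough against
    \<open>ln (2 * T)\<close>.\<close>
  define c where "c = ln (4 / \<alpha>)"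
  have ec: "exp c = 4 / \<alpha>" using \<alpha> by (simp add: c_def)
  \<comment> \<open>On the sides \<open>v * norm R\<close> is at most \<open>D * ln (2 * T)\<close>:
    \<open>C / \<tau>\<close> stems from \<open>zeta_log\<close>, as
    \<open>\<tau> * v \<le> Re s - 1/2\<close>, and \<open>b * CM\<close> from the small
    primes.\<close>
  define D where "D = C / \<tau> + b * CM"
  have D: "D \<ge> 0" using C CM \<tau> ab by (simp add: D_def)
  define U where "U = (\<lambda>T. ln (ln (ln T)) + c)"
  have "\<forall>\<^sub>F T in at_top. U T \<ge> max U0 1"
  proof -
    have "filterlim (\<lambda>T. ln (ln (ln T)) + c) at_top at_top" by real_asymp
    then show ?thesis unfolding U_def filterlim_at_top by blast
  qed
  moreover have "\<forall>\<^sub>F T in at_top. T - l - \<tau> * U T \<ge> 3"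
  proof -
    have "filterlim (\<lambda>T. T - l - \<tau> * (ln (ln (ln T)) + c)) at_top at_top" by real_asymp
    then show ?thesis unfolding U_def filterlim_at_top by blast
  qed
  moreover have "\<forall>\<^sub>F T in at_top. 2 * b * ((b + 2) * D) * (ln (2 * T) / (ln T)\<^sup>2) < \<epsilon> / 4"
  proof -
    have "((\<lambda>T::real. ln (2 * T) / (ln T)\<^sup>2) \<longlongrightarrow> 0) at_top" by real_asymp
    then have "((\<lambda>T. 2 * b * ((b + 2) * D) * (ln (2 * T) / (ln T)\<^sup>2)) \<longlongrightarrow> 2 * b * ((b + 2) * D) * 0) at_top"
      by (intro tendsto_intros)
    then show ?thesis using \<epsilon> by (intro order_tendstoD(2)) auto
  qed
  moreover have "\<forall>\<^sub>F T in at_top. ln (ln T) > (0::real)" by real_asymp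
  moreover have "\<forall>\<^sub>F T in at_top. ln T > (1::real)" by real_asymp
  moreover have "\<forall>\<^sub>F T in at_top. T > (1::real)" by real_asymp
  ultimately have "\<forall>\<^sub>F T in at_top. U T \<ge> max U0 1 \<and> T - l - \<tau> * U T \<ge> 3 \<and>
      2 * b * ((b + 2) * D) * (ln (2 * T) / (ln T)\<^sup>2) < \<epsilon> / 4 \<and> ln (ln T) > 0 \<and> ln T > 1 \<and> T > 1"
    by eventually_elim auto
  then obtain T1 where T1: "\<And>T. T \<ge> T1 \<Longrightarrow> U T \<ge> max U0 1 \<and> T - l - \<tau> * U T \<ge> 3 \<and>
      2 * b * ((b + 2) * D) * (ln (2 * T) / (ln T)\<^sup>2) < \<epsilon> / 4 \<and> ln (ln T) > 0 \<and> ln T > 1 \<and> T > 1"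
    unfolding eventually_at_top_linorder by blast
  have main: "\<exists>t0. \<bar>t0 - T\<bar> \<le> l \<and> U T \<ge> 1 \<and> t0 - \<tau> * U T > 0 \<and>
    (\<forall>\<delta>. 0 < \<delta> \<and> \<delta> < \<delta>0 \<longrightarrow>
      e * Im (LBINT u:{-(U T)..U T}. (K a u * (1 - u\<^sup>2 / (U T)\<^sup>2)) *\<^sub>R
          zeta_log (Complex (1/2 + \<delta>) (t0 + \<tau> * u))) \<ge> pi * I_N a b \<tau> M - \<epsilon>)" if T: "T \<ge> T1" for T
  proof -
    define V where "V = U T"
    have V: "V \<ge> U0" "V \<ge> 1" "T - l - \<tau> * V \<ge> 3" and T2: "2 * b * ((b + 2) * D) * (ln (2 * T) / (ln T)\<^sup>2) < \<epsilon> / 4"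
      "ln (ln T) > 0" "ln T > 1" "T > 1" using T1[OF T] by (auto simp: V_def)
    obtain t0 where t0: "\<bar>t0 - T\<bar> \<le> l" "\<And>p. prime p \<Longrightarrow> p \<le> M \<Longrightarrow>
        norm ((of_nat p :: complex) powr (- (\<i> * of_real t0)) - \<i> * of_real e) < \<eta>"
      using l by blast
    have t0V: "t0 - \<tau> * V \<ge> 3" "t0 + \<tau> * V \<le> 2 * T" using t0(1) V(3) by (auto simp: abs_le_iff)
    have expV: "exp (- \<alpha> * cosh V) \<le> 1 / (ln T)\<^sup>2"
    proof -
      have "exp V = ln (ln T) * exp c" using T2 by (simp add: V_def U_def exp_add)
      then have "\<alpha> * (exp \<bar>V\<bar> / 2) = 2 * ln (ln T)" using V \<alpha> by (simp add: ec)
      moreover have "\<alpha> * (exp \<bar>V\<bar> / 2) \<le> \<alpha> * cosh V" using cosh_ge_exp[of V] \<alpha> by (intro mult_left_mono) auto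
      ultimately have "exp (- \<alpha> * cosh V) \<le> exp (- (2 * ln (ln T)))" by simp
      also have "\<dots> = inverse ((exp (ln (ln T)))\<^sup>2)" by (simp add: exp_minus exp_double)
      also have "\<dots> = 1 / (ln T)\<^sup>2" using T2 by (subst exp_ln) (auto simp: inverse_eq_divide)
      finally show ?thesis .
    qed
    have "e * Im (LBINT u:{-V..V}. (K a u * (1 - u\<^sup>2 / V\<^sup>2)) *\<^sub>R zeta_log (Complex (1/2 + \<delta>) (t0 + \<tau> * u)))
        \<ge> pi * I_N a b \<tau> M - \<epsilon>" if \<delta>: "0 < \<delta>" "\<delta> < \<delta>0" for \<delta>
    proof -
      define s where "s = (\<lambda>z. of_real (1/2 + \<delta>) + \<i> * of_real t0 + \<i> * of_real \<tau> * z)"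
      define R where "R = (\<lambda>z. zeta_log (s z) - euler_log (\<lambda>_. 1) M (s z))"
      define E' where "E' = (\<lambda>u. euler_log (\<lambda>_. 1) M (Complex (1/2 + \<delta>) (t0 + \<tau> * u)))"
      \<comment> \<open>The preimage of the quarter plane under \<open>s\<close>.\<close>
      define S where "S = {z. Im z < \<delta> / \<tau>} \<inter> {z. Re z > - t0 / \<tau>}"
      have sC: "s (Complex u (- v)) = Complex (1/2 + \<delta> + \<tau> * v) (t0 + \<tau> * u)" for u v
        by (simp add: s_def complex_eq_iff)
      have sR: "s (of_real u) = Complex (1/2 + \<delta>) (t0 + \<tau> * u)" for u
        by (simp add: s_def complex_eq_iff)
      have sS: "s z \<in> quarter_plane" if "z \<in> S" for z
      proof -
        have "Re (s z) = 1/2 + \<delta> - \<tau> * Im z" "Im (s z) = t0 + \<tau> * Re z" by (auto simp: s_def)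
        then show ?thesis using that \<tau> by (auto simp: S_def field_simps)
      qed
      have hs: "s holomorphic_on S" unfolding s_def by (intro holomorphic_intros)
      have hz: "(\<lambda>z. zeta_log (s z)) holomorphic_on S"
        using holomorphic_on_compose_gen[OF hs zeta_log(1)[OF RH]] sS by (auto simp: o_def)
      have he: "(\<lambda>z. euler_log (\<lambda>_. 1) M (s z)) holomorphic_on S"
      proof -
        have "s ` S \<subseteq> {s. Re s > 0}" using sS by force
        then show ?thesis
          using holomorphic_on_compose_gen[OF hs holomorphic_euler_log[of "\<lambda>_. 1" M]] by (auto simp: o_def)
      qed
      have rect: "Complex u (- v) \<in> S" if "\<bar>u\<bar> \<le> V" "0 \<le> v" for u v
      proof -
        have "\<tau> * (- u) \<le> \<tau> * V" using that \<tau> by (intro mult_left_mono) auto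
        then have "- t0 < \<tau> * u" using t0V by simp
        then show ?thesis using that \<tau> \<delta> by (auto simp: S_def field_simps intro: order_le_less_trans[of _ 0])
      qed
      have lin: "of_real ` {-V..V} \<subseteq> S"
        using rect[of _ 0] by (auto simp: complex_of_real_def)
      have cont: "continuous_on {-V..V} (\<lambda>u. G (of_real u))" if "G holomorphic_on S" for G :: "complex \<Rightarrow> complex"
        by (rule continuous_on_compose2[OF holomorphic_on_imp_continuous_on[OF that] _ lin]) (intro continuous_intros)
      have Rbound: "norm (LBINT u:{-V..V}. (K a u * (1 - u\<^sup>2 / V\<^sup>2)) *\<^sub>R R (of_real u)) \<le>
          kappa a b * (1 + (b\<^sup>2 + 2 * b) / V) * \<beta> + 2 * b * ((b + 2) * (D * ln (2 * T)) * exp (- (a * cos b) * cosh V))"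
      proof (rule kernel_shift[where S = S])
        show "open S" "convex S" unfolding S_def
          by (auto intro!: open_Int convex_Int open_halfspace_Im_lt open_halfspace_Re_gt convex_halfspace_Im_lt convex_halfspace_Re_gt)
        show "R holomorphic_on S" unfolding R_def by (intro holomorphic_intros hz he)
        show "v * norm (R (Complex u (- v))) \<le> D * ln (2 * T)" if uv: "\<bar>u\<bar> = V" "0 \<le> v" "v \<le> b" for u v
        proof -
          let ?s = "Complex (1/2 + \<delta> + \<tau> * v) (t0 + \<tau> * u)"
          have Im: "3 \<le> t0 + \<tau> * u" "t0 + \<tau> * u \<le> 2 * T"
          proof -
            have "u = V \<or> u = - V" "0 \<le> \<tau> * V" using uv(1) V \<tau> by (auto simp: abs_if split: if_splits)
            then show "3 \<le> t0 + \<tau> * u" "t0 + \<tau> * u \<le> 2 * T" using t0V by auto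
          qed
          have tv: "0 \<le> \<tau> * v" "\<tau> * v \<le> \<tau> * b" using uv \<tau> by (auto intro!: mult_left_mono)
          have "v * norm (zeta_log ?s) = (\<tau> * v) * norm (zeta_log ?s) / \<tau>" using \<tau> by simp
          also have "\<dots> \<le> (norm (zeta_log ?s) * (Re ?s - 1/2)) / \<tau>"
            using \<tau> \<delta> by (intro divide_right_mono) (auto simp: algebra_simps)
          also have "\<dots> \<le> (C * ln (2 * T)) / \<tau>"
          proof (intro divide_right_mono)
            have "norm (zeta_log ?s) * (Re ?s - 1/2) \<le> C * ln (Im ?s)"
              using tv \<delta> Im by (intro C(2)) (auto simp: \<gamma>_def \<delta>0_def mult.commute)
            also have "\<dots> \<le> C * ln (2 * T)" using Im C(1) by (intro mult_left_mono) auto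
            finally show "norm (zeta_log ?s) * (Re ?s - 1/2) \<le> C * ln (2 * T)" .
          qed (use \<tau> in simp)
          finally have 1: "v * norm (zeta_log ?s) \<le> C / \<tau> * ln (2 * T)" by simp
          have "v * norm (euler_log (\<lambda>_. 1) M ?s) \<le> b * CM"
            unfolding CM_def using uv tv \<delta> ab by (intro mult_mono norm_euler_log_le) auto
          also have "\<dots> \<le> b * CM * ln (2 * T)"
          proof -
            have "ln (2 * T) \<ge> ln T" using T2(4) by simp
            then have "ln (2 * T) \<ge> 1" using T2(3) by linarith
            then have "b * CM * 1 \<le> b * CM * ln (2 * T)" using ab CM by (intro mult_left_mono) auto
            then show ?thesis by simp
          qed
          finally have 2: "v * norm (euler_log (\<lambda>_. 1) M ?s) \<le> b * CM * ln (2 * T)" .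
          have "v * norm (R (Complex u (- v))) \<le> v * (norm (zeta_log ?s) + norm (euler_log (\<lambda>_. 1) M ?s))"
            unfolding R_def sC using uv by (intro mult_left_mono norm_triangle_ineq4) auto
          then show ?thesis using 1 2 unfolding D_def by (simp add: algebra_simps)
        qed
        \<comment> \<open>Here \<open>Re s \<ge> \<gamma> > 1\<close>, so \<open>zeta_log\<close> is
          the prime series and \<open>R\<close> is its tail.\<close>
        show "norm (R (Complex u (- b))) \<le> \<beta>" if "\<bar>u\<bar> \<le> V" for u
        proof -
          let ?s = "Complex (1/2 + \<delta> + \<tau> * b) (t0 + \<tau> * u)"
          have "- t0 / \<tau> < u" using rect[OF that, of 0] by (simp add: S_def)
          then have "Im ?s > 0" using \<tau> by (simp add: field_simps)
          moreover have "Re ?s \<ge> \<gamma>" using \<delta> by (simp add: \<gamma>_def mult.commute)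
          ultimately have "R (Complex u (- b)) = zeta_log_series ?s - (\<Sum>p\<le>M. prime_log ?s p)" "Re ?s \<ge> \<gamma>"
            unfolding R_def sC sum_prime_log_eq using zeta_log(3)[OF RH, of ?s] \<gamma> by auto
          then show ?thesis unfolding \<beta>_def using zeta_log_series_truncate[OF _ \<gamma>] by simp
        qed
      qed (use ab V rect in auto)
      \<comment> \<open>One quarter of \<epsilon> pays for the excess of the weight on the lower
        side, one for the vertical sides; the other two are kept for replacing \<open>E'\<close> by
        \<open>E\<close> and for truncating at \<open>V\<close>.\<close>
      have R2: "norm (LBINT u:{-V..V}. (K a u * (1 - u\<^sup>2 / V\<^sup>2)) *\<^sub>R R (of_real u)) \<le> kappa a b * \<beta> + \<epsilon> / 4 + \<epsilon> / 4"
      proof -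
        have "ln (2 * T) \<ge> 0" using T2 by simp
        then have "2 * b * ((b + 2) * (D * ln (2 * T)) * exp (- \<alpha> * cosh V)) \<le>
            2 * b * ((b + 2) * (D * ln (2 * T)) * (1 / (ln T)\<^sup>2))"
          using expV ab D by (intro mult_left_mono) auto
        also have "\<dots> = 2 * b * ((b + 2) * D) * (ln (2 * T) / (ln T)\<^sup>2)" by simp
        finally have "2 * b * ((b + 2) * (D * ln (2 * T)) * exp (- (a * cos b) * cosh V)) \<le> \<epsilon> / 4"
          using T2(1) unfolding \<alpha>_def by linarith
        moreover have "kappa a b * (1 + (b\<^sup>2 + 2 * b) / V) * \<beta> = kappa a b * \<beta> + kappa a b * ((b\<^sup>2 + 2 * b) / V) * \<beta>"
          by (simp only: distrib_left distrib_right mult_1_right)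
        ultimately show ?thesis using Rbound U0(2)[OF V(1)] by linarith
      qed
      have E'eq: "E' u = euler_log (\<lambda>p. of_nat p powr (- (\<i> * of_real t0))) M (Complex (1/2 + \<delta>) (\<tau> * u))" for u
      proof -
        have "Complex (1/2 + \<delta>) (t0 + \<tau> * u) = Complex (1/2 + \<delta>) (\<tau> * u) + \<i> * of_real t0"
          by (simp add: complex_eq_iff)
        then show ?thesis unfolding E'_def by (simp only: euler_log_add)
      qed
      have Ediff: "norm (E' u - E u) \<le> 8 * (real M + 1) * \<eta>" for u
        unfolding E'eq E_def
      proof (rule euler_log_diff)
        show "norm ((of_nat p :: complex) powr (- (\<i> * of_real t0))) \<le> 1" for p
          by (cases "p = 0") (auto simp: norm_nat_powr)
        show "1 - real M powr (- \<delta>) \<le> \<eta>" using \<delta> \<delta>1(2) by (simp add: \<delta>0_def)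
      qed (use n1 \<delta> M t0(2) in \<open>auto intro: less_imp_le\<close>)
      have cE': "continuous_on {-V..V} E'"
        using cont[OF he] unfolding sR E'_def .
      have cE: "continuous_on {-V..V} E"
        unfolding E_def
      proof (rule continuous_on_compose2[OF holomorphic_on_imp_continuous_on[OF holomorphic_euler_log[OF n1]]])
        show "continuous_on {-V..V} (\<lambda>u. Complex (1/2) (\<tau> * u))" unfolding Complex_eq by (intro continuous_intros)
      qed auto
      have cR: "continuous_on {-V..V} (\<lambda>u. R (of_real u))"
        by (rule cont) (unfold R_def, intro holomorphic_intros hz he)
      let ?I = "\<lambda>F. LBINT u:{-V..V}. (K a u * (1 - u\<^sup>2 / V\<^sup>2)) *\<^sub>R (F u :: complex)"
      have add: "?I (\<lambda>u. F u + G u) = ?I F + ?I G" if "continuous_on {-V..V} F" "continuous_on {-V..V} G" for F G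
        using set_integral_add(2)[OF set_integrable_truncated_kernel[OF that(1), of a] set_integrable_truncated_kernel[OF that(2), of a]]
        by (simp add: scaleR_add_right)
      have "norm (?I (\<lambda>u. E' u - E u)) \<le> 8 * (real M + 1) * \<eta> * K_hat_0 a"
        using Ediff V ab by (intro norm_truncated_kernel_integral_le continuous_intros cE cE') auto
      then have n2: "norm (?I (\<lambda>u. E' u - E u)) \<le> \<epsilon> / 4" using \<eta>A unfolding A_def by simp
      have n3: "norm (?I E - J) < \<epsilon> / 4" using U0(1)[OF V(1)] .
      have "?I (\<lambda>u. zeta_log (Complex (1/2 + \<delta>) (t0 + \<tau> * u))) = ?I (\<lambda>u. R (of_real u) + ((E' u - E u) + E u))"
        by (intro set_lebesgue_integral_cong) (auto simp: R_def sR E'_def)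
      also have "\<dots> = ?I (\<lambda>u. R (of_real u)) + ?I (\<lambda>u. (E' u - E u) + E u)"
        by (intro add continuous_intros cE cE' cR)
      also have "?I (\<lambda>u. (E' u - E u) + E u) = ?I (\<lambda>u. E' u - E u) + ?I E"
        by (intro add continuous_intros cE cE')
      finally have sum: "?I (\<lambda>u. zeta_log (Complex (1/2 + \<delta>) (t0 + \<tau> * u))) - J =
          ?I (\<lambda>u. R (of_real u)) + (?I (\<lambda>u. E' u - E u) + (?I E - J))" by simp
      have "norm (?I (\<lambda>u. zeta_log (Complex (1/2 + \<delta>) (t0 + \<tau> * u))) - J) \<le>
          norm (?I (\<lambda>u. R (of_real u))) + (norm (?I (\<lambda>u. E' u - E u)) + norm (?I E - J))"
        unfolding sum by (meson add_left_mono norm_triangle_ineq order_trans)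
      then have "norm (?I (\<lambda>u. zeta_log (Complex (1/2 + \<delta>) (t0 + \<tau> * u))) - J) \<le> kappa a b * \<beta> + \<epsilon>"
        using R2 n2 n3 by linarith
      then have "\<bar>Im (?I (\<lambda>u. zeta_log (Complex (1/2 + \<delta>) (t0 + \<tau> * u))) - J)\<bar> \<le> kappa a b * \<beta> + \<epsilon>"
        using order_trans[OF abs_Im_le_cmod] by blast
      then have "\<bar>Im (?I (\<lambda>u. zeta_log (Complex (1/2 + \<delta>) (t0 + \<tau> * u)))) - Im J\<bar> \<le> kappa a b * \<beta> + \<epsilon>"
        by simp
      then have "e * Im (?I (\<lambda>u. zeta_log (Complex (1/2 + \<delta>) (t0 + \<tau> * u)))) \<ge> e * Im J - (kappa a b * \<beta> + \<epsilon>)"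
        using e by (auto simp: abs_le_iff)
      then show ?thesis using J by linarith
    qed
    then show ?thesis using t0(1) V t0V by (intro exI[of _ t0]) (auto simp: V_def)
  qed
  show ?thesis using that[OF \<delta>0, of T1 l c] main unfolding U_def by blast
qed

text \<open>An average of size \<open>Y\<close> against mass at most \<open>A\<close> forces a value
  near \<open>Y / A\<close> at distance \<delta> from the critical line, and compactness of the
  range of \<open>u\<close> gives a limit point on it as \<delta> \<rightarrow> 0. Admitting every
  larger \<open>H\<close> lets the constants for both signs be merged by \<open>max\<close>.\<close>

lemma zeta_S_large_values:
  assumes RH: "riemann_hypothesis" and ab: "a > 0" "0 < b" "b < pi / 2" and \<tau>: "\<tau> > 0" "b * \<tau> > 1/2"
    and e: "e = 1 \<or> e = - 1" and M: "M \<ge> 1" and \<epsilon>: "\<epsilon> > 0" and pos: "I_N a b \<tau> M - \<epsilon> > 0"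
  shows "\<exists>c0 T0. \<forall>T\<ge>T0. \<forall>H. H \<ge> \<tau> * ln (ln (ln T)) + c0 \<longrightarrow>
    (\<exists>t. \<bar>T - t\<bar> \<le> H \<and> e * zeta_S t > (I_N a b \<tau> M - 2 * \<epsilon>) / K_hat_0 a)"
proof -
  define A where "A = K_hat_0 a"
  have A: "A > 0" unfolding A_def by (rule K_hat_0_pos[OF ab(1)])
  define Y where "Y = pi * (I_N a b \<tau> M - \<epsilon>)"
  have Y: "Y > 0" using pos by (simp add: Y_def)
  \<comment> \<open>The bound 1 limits the final displacement; the other one makes two losses of
    \<eta>, divided by \<pi>, smaller than \<open>\<epsilon> / A\<close>.\<close>
  define \<eta> where "\<eta> = min 1 (pi * \<epsilon> / (4 * A))"
  have \<eta>: "\<eta> > 0" using \<epsilon> A by (simp add: \<eta>_def)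
  obtain c l T1 \<delta>0 where \<delta>0: "\<delta>0 > 0" and main: "\<And>T. T \<ge> T1 \<Longrightarrow> \<exists>t0. \<bar>t0 - T\<bar> \<le> l \<and>
    ln (ln (ln T)) + c \<ge> 1 \<and> t0 - \<tau> * (ln (ln (ln T)) + c) > 0 \<and>
    (\<forall>\<delta>. 0 < \<delta> \<and> \<delta> < \<delta>0 \<longrightarrow>
      e * Im (LBINT u:{-(ln (ln (ln T)) + c)..ln (ln (ln T)) + c}. (K a u * (1 - u\<^sup>2 / (ln (ln (ln T)) + c)\<^sup>2)) *\<^sub>R
          zeta_log (Complex (1/2 + \<delta>) (t0 + \<tau> * u))) \<ge> pi * I_N a b \<tau> M - pi * \<epsilon>)"
    by (rule zeta_log_integral_lower_bound[OF RH ab \<tau> e M mult_pos_pos[OF pi_gt_zero \<epsilon>]]) (rule that)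
  \<comment> \<open>In the constant, \<open>\<tau> * c\<close> comes from \<open>\<tau> * U\<close>,
    \<open>l\<close> from the distance of \<open>t0\<close> to \<open>T\<close>, and 1 from the
    displacement by less than \<eta>.\<close>
  have "\<exists>t. \<bar>T - t\<bar> \<le> H \<and> e * zeta_S t > (I_N a b \<tau> M - 2 * \<epsilon>) / A"
    if T: "T \<ge> T1" and H: "H \<ge> \<tau> * ln (ln (ln T)) + (\<tau> * c + l + 1)" for T H
  proof -
    define U where "U = ln (ln (ln T)) + c"
    obtain t0 where t0: "\<bar>t0 - T\<bar> \<le> l" "U \<ge> 1" "t0 - \<tau> * U > 0"
      and int: "\<And>\<delta>. 0 < \<delta> \<Longrightarrow> \<delta> < \<delta>0 \<Longrightarrow> Y \<le> e * Im (LBINT u:{-U..U}. (K a u * (1 - u\<^sup>2 / U\<^sup>2)) *\<^sub>R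
          zeta_log (Complex (1/2 + \<delta>) (t0 + \<tau> * u)))"
      using main[OF T] unfolding U_def Y_def right_diff_distrib by blast
    have tu: "t0 + \<tau> * u > 0" if "\<bar>u\<bar> \<le> U" for u
    proof -
      have "\<tau> * (- u) \<le> \<tau> * U" using that \<tau> by (intro mult_left_mono) auto
      then show ?thesis using t0(3) by simp
    qed
    have large: "\<exists>u. \<bar>u\<bar> \<le> U \<and> e * Im (zeta_log (Complex (1/2 + \<delta>) (t0 + \<tau> * u))) \<ge> (Y - \<eta> * A) / A"
      if \<delta>: "0 < \<delta>" "\<delta> < \<delta>0" for \<delta>
    proof (rule ccontr)
      assume "\<not> ?thesis"
      then have lt: "\<And>u. \<bar>u\<bar> \<le> U \<Longrightarrow> e * Im (zeta_log (Complex (1/2 + \<delta>) (t0 + \<tau> * u))) < (Y - \<eta> * A) / A"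
        by force
      have "continuous_on {-U..U} (\<lambda>u. zeta_log (Complex (1/2 + \<delta>) (t0 + \<tau> * u)))"
      proof (rule continuous_on_compose2[OF holomorphic_on_imp_continuous_on[OF zeta_log(1)[OF RH]]])
        show "continuous_on {-U..U} (\<lambda>u. Complex (1/2 + \<delta>) (t0 + \<tau> * u))"
          unfolding Complex_eq by (intro continuous_intros)
      qed (use tu \<delta> in \<open>auto simp: abs_le_iff\<close>)
      \<comment> \<open>The \<open>max\<close> with 0 provides the nonnegative bound that
        \<open>truncated_kernel_integral_upper\<close> asks for; both alternatives stay below
        \<open>Y\<close>.\<close>
      then have "e * Im (LBINT u:{-U..U}. (K a u * (1 - u\<^sup>2 / U\<^sup>2)) *\<^sub>R zeta_log (Complex (1/2 + \<delta>) (t0 + \<tau> * u)))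
          \<le> max 0 ((Y - \<eta> * A) / A) * A"
        using t0(2) lt ab unfolding A_def
        by (intro truncated_kernel_integral_upper order_trans[OF less_imp_le[OF lt[unfolded A_def]] max.cobounded2]) auto
      also have "\<dots> < Y" using Y A \<eta> by (auto simp: max_def)
      finally show False using int[OF \<delta>] by simp
    qed
    \<comment> \<open>The offset 2 keeps every term strictly below \<open>\<delta>0\<close>.\<close>
    define \<delta> where "\<delta> = (\<lambda>n::nat. \<delta>0 / (real n + 2))"
    have \<delta>: "0 < \<delta> n" "\<delta> n < \<delta>0" for n using \<delta>0 by (auto simp: \<delta>_def field_simps intro: add_pos_nonneg)
    have \<delta>lim: "\<delta> \<longlonglongrightarrow> 0" unfolding \<delta>_def by real_asymp
    obtain u where u: "\<And>n. \<bar>u n\<bar> \<le> U" "\<And>n. e * Im (zeta_log (Complex (1/2 + \<delta> n) (t0 + \<tau> * u n))) \<ge> (Y - \<eta> * A) / A"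
      using large[OF \<delta>] by metis
    have "\<forall>n. u n \<in> {-U..U}" using u(1) by (auto simp: abs_le_iff minus_le_iff)
    then obtain v r where v: "v \<in> {-U..U}" "strict_mono (r :: nat \<Rightarrow> nat)" "(u \<circ> r) \<longlonglongrightarrow> v"
      using compact_imp_seq_compact[OF compact_Icc, of "-U" U] unfolding seq_compact_def by blast
    define s where "s = (\<lambda>n. Complex (1/2 + \<delta> (r n)) (t0 + \<tau> * u (r n)))"
    have "s \<longlonglongrightarrow> Complex (1/2 + 0) (t0 + \<tau> * v)"
      unfolding s_def using LIMSEQ_subseq_LIMSEQ[OF \<delta>lim v(2)] v(3) unfolding o_def Complex_eq
      by (intro tendsto_intros)
    then have sl: "s \<longlonglongrightarrow> Complex (1/2) (t0 + \<tau> * v)" by simp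
    have "\<exists>t. \<bar>t - (t0 + \<tau> * v)\<bar> < \<eta> \<and> e * zeta_S t \<ge> ((Y - \<eta> * A) / A - \<eta>) / pi"
      by (rule zeta_S_near_limit_point[OF RH e _ \<eta> sl]) (use tu v(1) \<delta> u(2) in \<open>auto simp: s_def\<close>)
    then obtain t where t: "\<bar>t - (t0 + \<tau> * v)\<bar> < \<eta>" "e * zeta_S t \<ge> ((Y - \<eta> * A) / A - \<eta>) / pi" by blast
    have "\<bar>T - t\<bar> \<le> H"
    proof -
      have "\<bar>\<tau> * v\<bar> \<le> \<tau> * U" using v(1) \<tau> by (auto simp: abs_mult abs_le_iff intro!: mult_left_mono)
      moreover have "\<tau> * U + l + 1 \<le> H" using H by (simp add: U_def algebra_simps)
      moreover have "\<eta> \<le> 1" by (simp add: \<eta>_def)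
      ultimately show ?thesis using t(1) t0(1) by linarith
    qed
    moreover have "e * zeta_S t > (I_N a b \<tau> M - 2 * \<epsilon>) / A"
    proof -
      have "\<eta> \<le> pi * \<epsilon> / (4 * A)" by (simp add: \<eta>_def)
      then have "2 * \<eta> / pi \<le> 2 * (pi * \<epsilon> / (4 * A)) / pi" by (intro divide_right_mono mult_left_mono) auto
      also have "\<dots> = (\<epsilon> / 2) / A" by simp
      also have "\<dots> < \<epsilon> / A" using \<epsilon> A by (intro divide_strict_right_mono) auto
      finally have "2 * \<eta> / pi < \<epsilon> / A" .
      moreover have "((Y - \<eta> * A) / A - \<eta>) / pi = (I_N a b \<tau> M - \<epsilon>) / A - 2 * \<eta> / pi"
        using A by (simp add: Y_def field_simps)
      moreover have "(I_N a b \<tau> M - 2 * \<epsilon>) / A = (I_N a b \<tau> M - \<epsilon>) / A - \<epsilon> / A"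
        by (simp add: diff_divide_distrib)
      ultimately show ?thesis using t(2) by linarith
    qed
    ultimately show ?thesis by blast
  qed
  then show ?thesis unfolding A_def by blast
qed

text \<open>The maxima are suprema in the extended reals, so one point above the bound proves each
  inequality. The constants precede \<open>N\<close>, as they depend on \<epsilon>,
  \<open>a\<close>, \<open>b\<close> and \<tau> alone. The witness 1 for
  \<open>\<epsilon>\<^sub>0\<close> is an arbitrary positive number.\<close>

theorem theorem3:
  fixes a b \<tau> :: real
  assumes "riemann_hypothesis"
    and "a > 0" and "\<tau> > 0" and "0 < b" and "b < pi / 2" and "b * \<tau> > 1 / 2"
  shows "\<exists>\<epsilon>\<^sub>0>0. \<forall>\<epsilon>. 0 < \<epsilon> \<and> \<epsilon> < \<epsilon>\<^sub>0 \<longrightarrow>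
    (\<exists>c\<^sub>0 T\<^sub>0. \<forall>N\<ge>2. I_N a b \<tau> N > 0 \<longrightarrow>
      (\<forall>T\<ge>T\<^sub>0. let H = \<tau> * ln (ln (ln T)) + c\<^sub>0 in
        (SUP t\<in>{t. \<bar>T - t\<bar> \<le> H}. ereal (zeta_S t)) > ereal ((I_N a b \<tau> N - \<epsilon>) / K_hat_0 a) \<and>
        (SUP t\<in>{t. \<bar>T - t\<bar> \<le> H}. ereal (- zeta_S t)) > ereal ((I_N a b \<tau> N - \<epsilon>) / K_hat_0 a)))"
proof (rule exI[of _ 1], intro conjI allI impI)
  fix \<epsilon> :: real assume \<epsilon>: "0 < \<epsilon> \<and> \<epsilon> < 1"
  show "\<exists>c\<^sub>0 T\<^sub>0. \<forall>N\<ge>2. I_N a b \<tau> N > 0 \<longrightarrow>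
      (\<forall>T\<ge>T\<^sub>0. let H = \<tau> * ln (ln (ln T)) + c\<^sub>0 in
        (SUP t\<in>{t. \<bar>T - t\<bar> \<le> H}. ereal (zeta_S t)) > ereal ((I_N a b \<tau> N - \<epsilon>) / K_hat_0 a) \<and>
        (SUP t\<in>{t. \<bar>T - t\<bar> \<le> H}. ereal (- zeta_S t)) > ereal ((I_N a b \<tau> N - \<epsilon>) / K_hat_0 a))"
  proof (cases "\<exists>N\<ge>2. I_N a b \<tau> N > 0")
    case False
    then show ?thesis by auto
  next
    case True
    then obtain N0 where N0: "N0 \<ge> 2" "I_N a b \<tau> N0 > 0" by blast
    define W where "W = (SUP N\<in>{2..}. I_N a b \<tau> N)"
    have bdd: "bdd_above ((\<lambda>N. I_N a b \<tau> N) ` {2..})"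
      using I_N_bounded[OF assms(2,4,5,3,6)] by (intro bdd_aboveI2) auto
    have W: "I_N a b \<tau> N \<le> W" if "N \<ge> 2" for N
      unfolding W_def using that bdd by (intro cSUP_upper) auto
    have "W > 0" using W[OF N0(1)] N0(2) by linarith
    \<comment> \<open>For every \<open>N \<ge> 2\<close> this gives \<open>I_M - 2 * \<epsilon>' > W
      - 3 * \<epsilon>' \<ge> I_N - \<epsilon>\<close>; the comparison with \<open>W\<close> keeps
      \<open>I_M - \<epsilon>'\<close> positive.\<close>
    define \<epsilon>' where "\<epsilon>' = min \<epsilon> W / 4"
    have \<epsilon>': "\<epsilon>' > 0" "4 * \<epsilon>' \<le> \<epsilon>" "4 * \<epsilon>' \<le> W" using \<epsilon> \<open>W > 0\<close> by (auto simp: \<epsilon>'_def)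
    have "\<exists>M\<in>{2..}. W - \<epsilon>' < I_N a b \<tau> M"
      using less_cSUP_iff[of "{2..}" "\<lambda>N. I_N a b \<tau> N" "W - \<epsilon>'"] bdd \<epsilon>'(1) unfolding W_def[symmetric] by auto
    then obtain M where M: "M \<ge> 2" "W - \<epsilon>' < I_N a b \<tau> M" by auto
    have pos: "I_N a b \<tau> M - \<epsilon>' > 0" using M \<epsilon>' by linarith
    note large = zeta_S_large_values[OF assms(1,2,4,5,3,6) _ _ \<epsilon>'(1) pos]
    obtain c1 T1 where 1: "\<forall>T\<ge>T1. \<forall>H\<ge>\<tau> * ln (ln (ln T)) + c1.
        \<exists>t. \<bar>T - t\<bar> \<le> H \<and> 1 * zeta_S t > (I_N a b \<tau> M - 2 * \<epsilon>') / K_hat_0 a"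
      using large[of 1] M(1) by auto
    obtain c2 T2 where 2: "\<forall>T\<ge>T2. \<forall>H\<ge>\<tau> * ln (ln (ln T)) + c2.
        \<exists>t. \<bar>T - t\<bar> \<le> H \<and> (- 1) * zeta_S t > (I_N a b \<tau> M - 2 * \<epsilon>') / K_hat_0 a"
      using large[of "- 1"] M(1) by auto
    have mono: "(I_N a b \<tau> N - \<epsilon>) / K_hat_0 a \<le> (I_N a b \<tau> M - 2 * \<epsilon>') / K_hat_0 a" if "N \<ge> 2" for N
      using W[OF that] M(2) \<epsilon>' K_hat_0_pos[OF assms(2)] by (intro divide_right_mono) auto
    show ?thesis
    proof (rule exI[of _ "max c1 c2"], rule exI[of _ "max T1 T2"], intro allI impI)
      fix N :: nat and T :: real assume N: "2 \<le> N" and "I_N a b \<tau> N > 0" and T: "max T1 T2 \<le> T"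
      define H where "H = \<tau> * ln (ln (ln T)) + max c1 c2"
      obtain t where t: "\<bar>T - t\<bar> \<le> H" "zeta_S t > (I_N a b \<tau> M - 2 * \<epsilon>') / K_hat_0 a"
        using 1[rule_format, of T H] T by (auto simp: H_def)
      obtain t' where t': "\<bar>T - t'\<bar> \<le> H" "- zeta_S t' > (I_N a b \<tau> M - 2 * \<epsilon>') / K_hat_0 a"
        using 2[rule_format, of T H] T by (auto simp: H_def)
      have "(SUP t\<in>{t. \<bar>T - t\<bar> \<le> H}. ereal (zeta_S t)) > ereal ((I_N a b \<tau> N - \<epsilon>) / K_hat_0 a)"
        unfolding less_SUP_iff using t mono[OF N] by (intro bexI[of _ t]) auto
      moreover have "(SUP t\<in>{t. \<bar>T - t\<bar> \<le> H}. ereal (- zeta_S t)) > ereal ((I_N a b \<tau> N - \<epsilon>) / K_hat_0 a)"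
        unfolding less_SUP_iff using t' mono[OF N] by (intro bexI[of _ t']) auto
      ultimately show "let H = \<tau> * ln (ln (ln T)) + max c1 c2 in
        (SUP t\<in>{t. \<bar>T - t\<bar> \<le> H}. ereal (zeta_S t)) > ereal ((I_N a b \<tau> N - \<epsilon>) / K_hat_0 a) \<and>
        (SUP t\<in>{t. \<bar>T - t\<bar> \<le> H}. ereal (- zeta_S t)) > ereal ((I_N a b \<tau> N - \<epsilon>) / K_hat_0 a)"
        unfolding Let_def H_def by blast
    qed
  qed
qed simp

end
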